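(* Let $d\ge2$. There exist constants $c,c'$ depending only on $d$ such that for every $m\ge0$, if $D_m\subset\mathbb{Z}^d$ denotes the set of fully occupied sites for the divisible sandpile started from mass $m$ at the origin and $r=(m/\omega_d)^{1/d}$, then $$B_{r-c}\subset D_m\subset B_{r+c'}.$$
   Context: $\omega_d$ is the volume of the unit ball in $\mathbb{R}^d$; $B_\rho=\{x\in\mathbb{Z}^d:|x|<\rho\}$. Divisible sandpile on $\mathbb{Z}^d$: each site has a nonnegative real mass; a site with mass $\ge1$ (full) may topple, keeping mass $1$ and distributing its excess mass equally among its $2d$ neighbors. Toppling full sites (each full site eventually toppled) the mass configuration converges to a limit with all masses $\le1$, independent of the toppling order; fully occupied sites are those with final mass exactly $1$. *)

theory Defs
  imports "HOL-Analysis.Analysis"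
begin

type_synonym 'd site = "int ^ 'd"
type_synonym 'd config = "'d site \<Rightarrow> real"

definition enorm :: "'d::finite site \<Rightarrow> real" where
  "enorm x = sqrt (\<Sum>i\<in>UNIV. (real_of_int (x $ i))\<^sup>2)"

definition lball :: "real \<Rightarrow> ('d::finite) site set" where
  "lball \<rho> = {x. enorm x < \<rho>}"

definition omega :: "'d::finite itself \<Rightarrow> real" where
  "omega _ = measure lborel (ball (0::real ^ 'd) 1)"

definition adj :: "'d::finite site \<Rightarrow> 'd site \<Rightarrow> bool" where
  "adj x y \<longleftrightarrow> (\<Sum>i\<in>UNIV. \<bar>x $ i - y $ i\<bar>) = 1"

definition topple :: "'d::finite site \<Rightarrow> 'd config \<Rightarrow> 'd config" where
  "topple x \<mu> = (if \<mu> x \<ge> 1 then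
      (\<lambda>y. if y = x then 1
            else if adj x y then \<mu> y + (\<mu> x - 1) / (2 * real CARD('d))
            else \<mu> y)
    else \<mu>)"

definition point_mass :: "real \<Rightarrow> 'd::finite config" where
  "point_mass m = (\<lambda>y. if y = 0 then m else 0)"

definition toppling_seq :: "real \<Rightarrow> (nat \<Rightarrow> 'd::finite config) \<Rightarrow> (nat \<Rightarrow> 'd site) \<Rightarrow> bool" where
  "toppling_seq m \<mu> xs \<longleftrightarrow>
     \<mu> 0 = point_mass m \<and>
     (\<forall>k. \<mu> (Suc k) = topple (xs k) (\<mu> k)) \<and>
     (\<forall>k y. \<mu> k y \<ge> 1 \<longrightarrow> (\<exists>j\<ge>k. xs j = y))"

definition occupied :: "'d::finite config \<Rightarrow> 'd site set" where
  "occupied \<nu> = {y. \<nu> y = 1}"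

end

theory Submission
  imports Defs
begin

text \<open>
  The odometer \<open>u\<close> (mass emitted from each site) satisfies \<open>m \<delta>\<^sub>0 + \<Delta>u = \<nu> \<le> 1\<close> and lies below
  every \<open>w \<ge> 0\<close> with \<open>m \<delta>\<^sub>0 + \<Delta>w \<le> 1\<close>, so it suffices to find a super- and a subsolution supported
  on balls whose radii differ by \<open>O(1)\<close>.  Near the boundary both are \<open>|x|\<^sup>2\<close> plus a multiple of an
  explicit radial potential \<open>\<Phi>\<close>, normalised to vanish to second order there.  Near the origin
  \<open>\<Phi>\<close> is replaced by \<open>\<Phi> + h * e\<close>, where \<open>e = \<Delta>\<Phi> + \<kappa> \<delta>\<^sub>0\<close> has total mass \<open>0\<close> and \<open>h\<close> is the heat
  kernel integrated up to time \<open>\<rho>\<^sup>2\<close>: then \<open>\<Delta>(\<Phi> + h * e) + \<kappa> \<delta>\<^sub>0\<close> is of order \<open>\<rho>\<^sup>-\<^sup>d\<^sup>-\<^sup>1\<close>, and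
  \<open>h * e\<close> of order \<open>\<rho>\<^sup>1\<^sup>-\<^sup>d\<close> at distance \<open>\<rho>\<close>.  Both errors are absorbed by changing the coefficients
  by factors \<open>1 + O(1/\<rho>)\<close>, and the two pieces are glued by taking minima or maxima.  The constant
  \<open>\<kappa>\<close> is never computed: counting lattice points and conservation of mass show that \<open>\<rho>\<close>, given by
  \<open>m = \<kappa> \<rho>\<^sup>d\<close>, equals \<open>r\<close> up to \<open>O(1)\<close>.
\<close>

section \<open>The one-dimensional heat kernel\<close>

text \<open>Neither piece can do the work of the other. The Laplacian of \<Phi> is of order
  |x|^(-d-2); multiplied by a coefficient of order \<rho>^d this is harmless at distance \<rho> but
  ruins the inequality near the origin. The correction h * e, with the same coefficient, is of size
  O(\<rho>) at distance \<rho>, whereas near the boundary the barrier must be controlled up to O(1).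
  Gluing works because the factors 1 + O(1/\<rho>) give the pieces different coefficients of \<Phi>:
  the discrepancy, a large multiple of \<rho>^(d-1), times the variation \<rho>^(2-d) of \<Phi>
  across a shell at distance of order \<rho>, is of order \<rho> and beats the error from h * e.
  Stopping the heat kernel at the diffusive time \<rho>^2 avoids the full Green function, which
  diverges for d = 2, and treats all d \<ge> 2 alike. As e has total mass 0, convolution with it
  costs a gradient of the kernel and a first moment of e; the latter is bounded because |y| |e(y)|
  is of order |y|^(-d-1). Hence the interest in gradient bounds, in the bulk and in the
  tail.\<close>

text \<open>Law of the walk with steps \<open>-1, 0, 1\<close> of probability \<open>1/4, 1/2, 1/4\<close>.  Unlike simple random
  walk it has no parity, so it is unimodal.\<close>

definition lazy_walk :: "nat \<Rightarrow> int \<Rightarrow> real" where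
  "lazy_walk n k = real ((2 * n) choose (n + nat \<bar>k\<bar>)) / 4 ^ n"

lemma lazy_walk_minus [simp]: "lazy_walk n (- k) = lazy_walk n k"
  by (simp add: lazy_walk_def)

lemma lazy_walk_nonneg: "0 \<le> lazy_walk n k"
  by (simp add: lazy_walk_def)

lemma lazy_walk_0: "lazy_walk 0 k = (if k = 0 then 1 else 0)"
  by (auto simp: lazy_walk_def)

text \<open>With N = 2n and a = n + k this is (a + 1) C(N, a + 1) = (N - a) C(N, a). The reflection
  k -> -k - 1 exchanges the two sides, which reduces negative k to nonnegative k.\<close>

lemma lazy_walk_ratio:
  "(real n + k + 1) * lazy_walk n (k + 1) = (real n - k) * lazy_walk n k"
proof -
  have *: "(real n + real j + 1) * lazy_walk n (int j + 1) = (real n - real j) * lazy_walk n (int j)" for j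
  proof (cases "j \<le> n")
    case True
    have "Suc (n + j) * ((2 * n) choose Suc (n + j)) = (2 * n - (n + j)) * ((2 * n) choose (n + j))"
      by (metis Suc_times_binomial_eq binomial_absorb_comp binomial_absorption)
    hence "real (Suc (n + j)) * real ((2 * n) choose Suc (n + j)) = real (2 * n - (n + j)) * real ((2 * n) choose (n + j))"
      by (metis of_nat_mult)
    moreover have "real (2 * n - (n + j)) = real n - real j"
      using True by simp
    moreover have "nat \<bar>int j + 1\<bar> = Suc j" by simp
    ultimately show ?thesis
      by (simp add: lazy_walk_def field_simps)
  next
    case False
    moreover have "nat \<bar>int j + 1\<bar> = Suc j" by simp
    ultimately show ?thesis by (simp add: lazy_walk_def binomial_eq_0)
  qed
  show ?thesis
  proof (cases "k \<ge> 0")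
    case True
    then show ?thesis using *[of "nat k"] by simp
  next
    case False
    define j where "j = nat (- k - 1)"
    have k: "k = - int j - 1" using False by (simp add: j_def)
    have "lazy_walk n (k + 1) = lazy_walk n (int j)"
      by (metis k add_diff_cancel diff_add_cancel lazy_walk_minus)
    moreover have "lazy_walk n k = lazy_walk n (int j + 1)"
      using lazy_walk_minus[of n "int j + 1"] by (simp add: k)
    ultimately show ?thesis using *[of j] by (simp add: k algebra_simps)
  qed
qed

lemma lazy_walk_Suc:
  "lazy_walk (Suc n) k = (lazy_walk n (k - 1) + 2 * lazy_walk n k + lazy_walk n (k + 1)) / 4"
proof -
  have *: "lazy_walk (Suc n) (int j) = (lazy_walk n (int j - 1) + 2 * lazy_walk n (int j) + lazy_walk n (int j + 1)) / 4" for j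
  proof (cases j)
    case 0
    have "(2 * n + 2) choose (n + 1) = ((2 * n) choose n) + ((2*n) choose (n + 1)) + (((2*n+1) choose n))"
      using binomial_Suc_Suc[of "2*n+1" n] by simp
    moreover have "(2*n+1) choose n = (2*n+1) choose (n+1)"
      using binomial_symmetric[of n "2*n+1"] by simp
    ultimately have "(2 * n + 2) choose (n + 1) = 2 * ((2 * n) choose n) + 2 * ((2*n) choose (n + 1))"
      by simp
    thus ?thesis by (simp add: lazy_walk_def 0 field_simps)
  next
    case (Suc i)
    have "(2 * n + 2) choose (n + i + 2) = ((2*n) choose (n + i)) + 2 * ((2 * n) choose (n + i + 1)) + ((2*n) choose (n + i + 2))"
      by simp
    hence "real ((2 * n + 2) choose (n + i + 2)) = real ((2*n) choose (n + i)) + 2 * real ((2 * n) choose (n + i + 1)) + real ((2*n) choose (n + i + 2))"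
      by linarith
    moreover have "nat \<bar>int j + 1\<bar> = i + 2" "nat \<bar>int j\<bar> = i + 1" "nat \<bar>int j - 1\<bar> = i"
      using Suc by auto
    moreover have "2 * Suc n = 2 * n + 2" "Suc n + (i + 1) = n + i + 2" "n + (i + 1) = n + i + 1" "n + (i + 2) = n + i + 2"
      by auto
    ultimately show ?thesis
      unfolding lazy_walk_def by (simp only: power_Suc) (simp add: field_simps)
  qed
  show ?thesis
  proof (cases "k \<ge> 0")
    case True
    then show ?thesis using *[of "nat k"] by simp
  next
    case False
    moreover have "- k - 1 = - (k + 1)" "- k + 1 = - (k - 1)" by auto
    hence "lazy_walk n (- k - 1) = lazy_walk n (k + 1)" "lazy_walk n (- k + 1) = lazy_walk n (k - 1)"
      by (metis lazy_walk_minus)+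
    ultimately show ?thesis using *[of "nat (- k)"] by simp
  qed
qed

text \<open>The ratio identities at k - 1 and k give (n + 1) w(k - 1) = (n + k) w(k) + k w(k - 1)
  and (n + 1) w(k + 1) = (n - k) w(k) - k w(k + 1), where w = \<open>lazy_walk n\<close>. Their
  difference is k times the numerator in \<open>lazy_walk_Suc\<close>.\<close>

lemma lazy_walk_two_step:
  "(real n + 1) * (lazy_walk n (k - 1) - lazy_walk n (k + 1)) = 4 * k * lazy_walk (Suc n) k"
  using lazy_walk_ratio[of n k] lazy_walk_ratio[of n "k - 1"] lazy_walk_Suc[of n k]
  by (simp add: algebra_simps)

lemma lazy_walk_antimono:
  assumes "k \<ge> 0" shows "lazy_walk n (k + 1) \<le> lazy_walk n k"
proof (cases "k \<ge> n")
  case True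
  hence "lazy_walk n (k + 1) = 0" by (auto simp: lazy_walk_def intro!: binomial_eq_0)
  thus ?thesis using lazy_walk_nonneg by simp
next
  case False
  have "(real n - k) * lazy_walk n k \<le> (real n + k + 1) * lazy_walk n k"
    using lazy_walk_nonneg[of n k] assms by (intro mult_right_mono) auto
  hence "(real n + k + 1) * lazy_walk n (k+1) \<le> (real n + k + 1) * lazy_walk n k"
    by (simp add: lazy_walk_ratio)
  thus ?thesis using assms by (simp add: mult_le_cancel_left)
qed

lemma sum_lazy_walk_le: "finite A \<Longrightarrow> (\<Sum>k\<in>A. lazy_walk n k) \<le> 1"
proof (induction n arbitrary: A)
  case 0
  then show ?case by (simp add: lazy_walk_0 sum.If_cases card_le_Suc0_iff_eq flip: One_nat_def)
next
  case (Suc n)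
  have "(\<Sum>k\<in>A. lazy_walk n (k - 1)) = (\<Sum>k\<in>(\<lambda>k. k - 1) ` A. lazy_walk n k)"
    by (subst sum.reindex) (auto simp: inj_on_def)
  moreover have "(\<Sum>k\<in>A. lazy_walk n (k + 1)) = (\<Sum>k\<in>(\<lambda>k. k + 1) ` A. lazy_walk n k)"
    by (subst sum.reindex) (auto simp: inj_on_def)
  ultimately show ?case
    using Suc.IH[of A] Suc.IH[of "(\<lambda>k. k + 1) ` A"] Suc.IH[of "(\<lambda>k. k - 1) ` A"] Suc.prems
    by (simp add: lazy_walk_Suc sum.distrib flip: sum_divide_distrib sum_distrib_left)
qed

lemma lazy_walk_le_1: "lazy_walk n k \<le> 1"
  using sum_lazy_walk_le[of "{k}" n] by simp

text \<open>The lazy walk run at the jumps of a Poisson clock of rate 2; in terms of Bessel functions this is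
  \<open>exp (- t) I\<^sub>k(t)\<close>, and \<open>heat1_two_step\<close> is the recurrence \<open>I\<^sub>k\<^sub>-\<^sub>1 - I\<^sub>k\<^sub>+\<^sub>1 = (2 k / t) I\<^sub>k\<close>,
  which turns pointwise bounds into gradient bounds and yields the decay of the tails.\<close>

definition heat1 :: "real \<Rightarrow> int \<Rightarrow> real" where
  "heat1 t k = exp (- 2 * t) * (\<Sum>n. lazy_walk n k * 2 ^ n / fact n * t ^ n)"

lemma summable_heat1:
  assumes "\<And>n. \<bar>c n\<bar> \<le> 1"
  shows "summable (\<lambda>n. c n * 2 ^ n / fact n * (t::real) ^ n)"
proof (rule summable_comparison_test')
  show "summable (\<lambda>n. inverse (fact n) * (2 * \<bar>t\<bar>) ^ n)" by (rule summable_exp)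
  fix n
  have "\<bar>c n\<bar> * ((2 * \<bar>t\<bar>) ^ n / fact n) \<le> 1 * ((2 * \<bar>t\<bar>) ^ n / fact n)"
    using assms by (intro mult_right_mono) auto
  thus "norm (c n * 2 ^ n / fact n * t ^ n) \<le> inverse (fact n) * (2 * \<bar>t\<bar>) ^ n"
    by (simp add: abs_mult power_abs power_mult_distrib field_simps)
qed

lemma lazy_walk_abs_le: "\<bar>lazy_walk n k\<bar> \<le> 1"
  using lazy_walk_nonneg lazy_walk_le_1 by simp

lemmas summable_lazy =  summable_heat1[OF lazy_walk_abs_le]

lemma heat1_minus [simp]: "heat1 t (- k) = heat1 t k"
  by (simp add: heat1_def)

lemma heat1_nonneg: "t \<ge> 0 \<Longrightarrow> 0 \<le> heat1 t k"
  unfolding heat1_def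
  by (intro mult_nonneg_nonneg suminf_nonneg summable_lazy) (auto simp: lazy_walk_nonneg)

lemma heat1_0: "heat1 0 k = (if k = 0 then 1 else 0)"
  using powser_zero[of "\<lambda>n. lazy_walk n k * 2 ^ n / fact n"] by (simp add: heat1_def lazy_walk_0)

lemma heat1_antimono:
  assumes "t \<ge> 0" "0 \<le> k" "k \<le> l" shows "heat1 t l \<le> heat1 t k"
proof -
  have *: "heat1 t (k + 1) \<le> heat1 t k" if "k \<ge> 0" for k
    unfolding heat1_def using assms(1)
    by (intro mult_left_mono suminf_le summable_lazy mult_right_mono divide_right_mono lazy_walk_antimono that) auto
  from assms(3,2) show ?thesis
    by (induction l rule: int_ge_induct) (auto intro: order_trans[OF *])
qed

lemma sum_heat1_le:
  assumes "t \<ge> 0" "finite A" shows "(\<Sum>k\<in>A. heat1 t k) \<le> 1"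
proof -
  have "(\<Sum>k\<in>A. heat1 t k) = exp (- 2 * t) * (\<Sum>n. \<Sum>k\<in>A. lazy_walk n k * 2 ^ n / fact n * t ^ n)"
    by (simp only: heat1_def flip: sum_distrib_left) (subst suminf_sum[OF summable_lazy], simp)
  also have "\<dots> \<le> exp (- 2 * t) * (\<Sum>n. 1 * 2 ^ n / fact n * t ^ n)"
  proof (intro mult_left_mono suminf_le)
    fix n
    show "(\<Sum>k\<in>A. lazy_walk n k * 2 ^ n / fact n * t ^ n) \<le> 1 * 2 ^ n / fact n * t ^ n"
      using sum_lazy_walk_le[OF assms(2), of n] assms(1)
      by (simp only: flip: sum_distrib_right sum_divide_distrib) (intro mult_right_mono divide_right_mono; simp)
  next
    show "summable (\<lambda>n. \<Sum>k\<in>A. lazy_walk n k * 2 ^ n / fact n * t ^ n)"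
      by (intro summable_sum summable_lazy)
  qed (use summable_heat1[of "\<lambda>_. 1" t] in simp_all)
  also have "(\<Sum>n. 1 * 2 ^ n / fact n * t ^ n) = exp (2 * t)"
    unfolding exp_def by (intro suminf_cong) (simp add: power_mult_distrib divide_inverse mult_ac scaleR_conv_of_real)
  also have "exp (- 2 * t) * exp (2 * t) = 1" by (simp flip: exp_add)
  finally show ?thesis .
qed

text \<open>Differentiating the series replaces \<open>n\<close> by \<open>Suc n\<close>, and
  \<open>lazy_walk_Suc\<close> expands this into neighbours. Rate 2 and holding probability 1/2
  combine to simple random walk at rate 1.\<close>

lemma DERIV_heat1:
  "((\<lambda>t. heat1 t k) has_real_derivative (heat1 t (k - 1) + heat1 t (k + 1)) / 2 - heat1 t k) (at t)"
proof -
  let ?c = "\<lambda>k n. lazy_walk n k * 2 ^ n / fact n"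
  let ?F = "\<lambda>k. \<Sum>n. ?c k n * t ^ n"
  have D: "((\<lambda>x. \<Sum>n. ?c k n * x ^ n) has_field_derivative (\<Sum>n. diffs (?c k) n * t ^ n)) (at t)"
    by (rule termdiffs_strong_converges_everywhere) (rule summable_lazy)
  have "diffs (?c k) n * t ^ n = (?c (k-1) n * t ^ n + ?c (k+1) n * t ^ n) / 2 + ?c k n * t ^ n" for n
  proof -
    have "diffs (?c k) n = 2 * lazy_walk (Suc n) k * 2 ^ n / fact n"
      unfolding diffs_def fact_Suc by simp
    thus ?thesis by (simp only: lazy_walk_Suc) (simp add: field_simps)
  qed
  moreover have "(\<Sum>n. (?c (k-1) n * t ^ n + ?c (k+1) n * t ^ n) / 2 + ?c k n * t ^ n)
     = (?F (k-1) + ?F (k+1)) / 2 + ?F k"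
    by (rule sums_unique[symmetric], intro sums_add sums_divide summable_sums summable_lazy)
  ultimately have E: "(\<Sum>n. diffs (?c k) n * t ^ n) = (?F (k-1) + ?F (k+1)) / 2 + ?F k"
    by simp
  show ?thesis unfolding heat1_def
    by (rule derivative_eq_intros D refl)+ (simp only: E, simp add: algebra_simps)
qed

lemma heat1_two_step: "t * (heat1 t (k - 1) - heat1 t (k + 1)) = 2 * k * heat1 t k"
proof -
  let ?c = "\<lambda>k n. lazy_walk n k * 2 ^ n / fact n"
  let ?F = "\<lambda>k. \<Sum>n. ?c k n * t ^ n"
  have "?F k = ?c k 0 * t ^ 0 + (\<Sum>n. ?c k (Suc n) * t ^ Suc n)"
    using suminf_split_head[OF summable_lazy[of "\<lambda>n. n" "\<lambda>_. k" t]] by simp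
  \<comment> \<open>The term n = 0 drops out: \<open>lazy_walk 0 k\<close> vanishes unless k = 0,
    and then the factor k does.\<close>
  hence "2 * k * ?F k = (\<Sum>n. 2 * k * (?c k (Suc n) * t ^ Suc n))"
    using summable_lazy[of "\<lambda>n. n" "\<lambda>_. k" t, THEN summable_ignore_initial_segment, of 1]
    by (subst suminf_mult) (auto simp: lazy_walk_0)
  also have "\<dots> = (\<Sum>n. t * (?c (k-1) n * t ^ n - ?c (k+1) n * t ^ n))"
  proof (intro suminf_cong)
    fix n
    have "2 * k * (?c k (Suc n) * t ^ Suc n) = 4 * k * lazy_walk (Suc n) k * (2 ^ n * t ^ Suc n / fact (Suc n))"
      by (simp add: field_simps)
    also have "\<dots> = (real n + 1) * (lazy_walk n (k - 1) - lazy_walk n (k + 1)) * (2 ^ n * t ^ Suc n / fact (Suc n))"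
      by (simp only: lazy_walk_two_step)
    also have "\<dots> = t * (?c (k-1) n * t ^ n - ?c (k+1) n * t ^ n)"
    proof -
      have *: "P * D * (X * (t * Y) / (P * F)) = t * (D * X / F * Y)" if "P \<noteq> 0" for P D X Y F :: real
        using that by simp
      show ?thesis
        using *[of "real n + 1" "lazy_walk n (k - 1) - lazy_walk n (k + 1)" "2 ^ n" "t ^ n" "fact n"]
        by (simp add: diff_divide_distrib left_diff_distrib add.commute)
    qed
    finally show "2 * k * (?c k (Suc n) * t ^ Suc n) = t * (?c (k-1) n * t ^ n - ?c (k+1) n * t ^ n)" .
  qed
  also have "\<dots> = t * (?F (k-1) - ?F (k+1))"
    by (subst suminf_mult, intro summable_diff summable_lazy, subst suminf_diff) (rule summable_lazy refl)+
  finally have "real_of_int (2 * k) * ?F k = t * (?F (k-1) - ?F (k+1))" .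
  hence eq: "2 * real_of_int k * ?F k = t * (?F (k-1) - ?F (k+1))" by (simp only: of_int_mult of_int_numeral)
  have "t * (E * a - E * b) = 2 * real_of_int k * (E * c)" if "2 * real_of_int k * c = t * (a - b)" for a b c E :: real
    using that by algebra
  from this[OF eq] show ?thesis by (simp only: heat1_def)
qed


section \<open>Pointwise, tail and gradient bounds in one dimension\<close>

lemma heat1_abs: "heat1 t \<bar>k\<bar> = heat1 t k"
  by (cases "k \<ge> 0") auto

lemma heat1_le_0: "t \<ge> 0 \<Longrightarrow> heat1 t k \<le> heat1 t 0"
  by (subst heat1_abs[symmetric]) (rule heat1_antimono, auto)

text \<open>The k + 1 sites from 0 to k all have at least the value at k, and the total mass is at
  most 1.\<close>

lemma heat1_le_inverse:
  assumes "t \<ge> 0" "k \<ge> 0" shows "(real_of_int k + 1) * heat1 t k \<le> 1"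
proof -
  have "(real_of_int k + 1) * heat1 t k = (\<Sum>j\<in>{0..k}. heat1 t k)" using assms by simp
  also have "\<dots> \<le> (\<Sum>j\<in>{0..k}. heat1 t j)"
    by (intro sum_mono heat1_antimono) (use assms in auto)
  also have "\<dots> \<le> 1" by (rule sum_heat1_le) (use assms in auto)
  finally show ?thesis .
qed

text \<open>The recurrence bounds the loss from 0 to 2j by 2 j^2 / t times the value at 0. So the
  even sites up to about sqrt t still have at least half of the maximum, and these sites, about sqrt
  t / 2 in number, share a mass of at most 1.\<close>

lemma heat1_le_inverse_sqrt:
  assumes "t > 0" shows "heat1 t k \<le> 4 / sqrt t"
proof -
  have lower: "t * (heat1 t 0 - heat1 t (2 * int j)) \<le> 2 * (real j)^2 * heat1 t 0" for j
  proof (induction j)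
    case (Suc j)
    have "t * (heat1 t (2 * int j) - heat1 t (2 * int (Suc j))) = 2 * (2 * int j + 1) * heat1 t (2 * int j + 1)"
      using heat1_two_step[of t "2 * int j + 1"] by (simp add: algebra_simps)
    also have "\<dots> \<le> 2 * (2 * int j + 1) * heat1 t 0"
      using heat1_le_0[of t "2 * int j + 1"] assms by (intro mult_left_mono) auto
    finally show ?case using Suc by (simp add: algebra_simps power2_eq_square)
  qed simp
  define J where "J = nat \<lfloor>sqrt t / 2\<rfloor>"
  have J: "real J \<le> sqrt t / 2" "real J + 1 \<ge> sqrt t / 2"
    using assms by (auto simp: J_def) linarith
  have half: "heat1 t 0 / 2 \<le> heat1 t (2 * int j)" if "j \<le> J" for j
  proof -
    have "2 * (real j)^2 \<le> 2 * (sqrt t / 2)^2"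
      using that J(1) by (intro mult_left_mono power_mono) auto
    also have "\<dots> = t / 2" using assms by (simp add: power_divide)
    finally have "2 * (real j)^2 * heat1 t 0 \<le> t / 2 * heat1 t 0"
      using heat1_nonneg[of t 0] assms by (intro mult_right_mono) auto
    with lower[of j] have "t * (heat1 t 0 - heat1 t (2 * int j)) \<le> t * (heat1 t 0 / 2)"
      by simp
    thus ?thesis using assms by (simp add: mult_le_cancel_left_pos)
  qed
  have "sqrt t / 2 * (heat1 t 0 / 2) \<le> (real J + 1) * (heat1 t 0 / 2)"
    using J(2) heat1_nonneg[of t 0] assms by (intro mult_right_mono) auto
  also have "\<dots> = (\<Sum>j\<in>{..J}. heat1 t 0 / 2)" by simp
  also have "\<dots> \<le> (\<Sum>j\<in>{..J}. heat1 t (2 * int j))" by (intro sum_mono half) auto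
  also have "\<dots> = (\<Sum>k\<in>(\<lambda>j. 2 * int j) ` {..J}. heat1 t k)"
    by (subst sum.reindex) (auto simp: inj_on_def)
  also have "\<dots> \<le> 1" by (rule sum_heat1_le) (use assms in auto)
  finally have "heat1 t 0 \<le> 4 / sqrt t" using assms by (simp add: field_simps)
  thus ?thesis using heat1_le_0[of t k] assms by linarith
qed

text \<open>By the recurrence, each double step to the right of k loses at least the factor 1 +
  2k/t.\<close>

lemma heat1_geometric_decay:
  assumes "t > 0" "k \<ge> 1"
  shows "heat1 t (k + 2 * int i) * (1 + 2 * real_of_int k / t) ^ i \<le> heat1 t k"
proof (induction i)
  case (Suc i)
  let ?l = "k + 2 * int i + 1"
  have "2 * real_of_int k * heat1 t (?l + 1) \<le> 2 * real_of_int ?l * heat1 t (?l + 1)"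
    using assms heat1_nonneg[of t "?l + 1"] by (intro mult_right_mono) auto
  also have "\<dots> \<le> 2 * real_of_int ?l * heat1 t ?l"
    using assms heat1_antimono[of t ?l "?l + 1"] by (intro mult_left_mono) auto
  also have "\<dots> = t * (heat1 t (?l - 1) - heat1 t (?l + 1))"
    using heat1_two_step[of t ?l] by simp
  finally have "heat1 t (?l + 1) * (1 + 2 * real_of_int k / t) \<le> heat1 t (?l - 1)"
    using assms by (simp add: field_simps)
  hence "heat1 t (?l + 1) * (1 + 2 * real_of_int k / t) * (1 + 2 * real_of_int k / t) ^ i \<le> heat1 t (k + 2 * int i) * (1 + 2 * real_of_int k / t) ^ i"
    using assms by (intro mult_right_mono) auto
  with Suc show ?case by (simp add: algebra_simps)
qed simp

text \<open>About k/4 double steps from n = k - 2i, which is at least k/2, lose a factor (1 +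
  k/t)^i. Splitting off M blocks of length j = i div M and applying Bernoulli's inequality to each
  gives decay of order M in k^2/t, which serves in place of a Gaussian tail. The factor
  \<open>heat1 t n\<close> is kept so that it can be bounded either by 1/sqrt t or by 1/n.\<close>

lemma heat1_tail:
  assumes "t > 0" "M > 0" "k \<ge> 8 * int M"
  obtains n where "2 * n \<ge> k" "heat1 t k \<le> (16 * real M * t / (real_of_int k)^2) ^ M * heat1 t n"
proof -
  define i where "i = nat (k div 4)"
  define n where "n = k - 2 * int i"
  have k0: "k > 0" using assms by auto
  have n: "2 * n \<ge> k" "n \<ge> 1" using k0 by (auto simp: n_def i_def)
  define j where "j = i div M"
  have i: "i \<ge> 2 * M" "8 * int i \<ge> k" using assms by (auto simp: i_def)
  have j1: "M * j \<le> i" by (simp add: j_def)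
  have "i < M * j + M" unfolding j_def
    using mult_div_mod_eq[of M i] mod_less_divisor[of M i] assms(2) by linarith
  moreover have "M * 1 \<le> M * j" using i(1) assms(2)
    by (intro mult_left_mono) (auto simp: j_def Suc_le_eq div_greater_zero_iff)
  ultimately have "i \<le> 2 * (M * j)" by linarith
  hence "int i \<le> 2 * int (M * j)" by linarith
  hence "k \<le> 16 * int (M * j)" using i by linarith
  hence "real_of_int k \<le> real_of_int (16 * int (M * j))" by (simp only: of_int_le_iff)
  hence j2: "real_of_int k \<le> 16 * real M * real j" by simp
  have "((real_of_int k)^2 / (16 * real M * t)) ^ M \<le> (j * real_of_int k / t) ^ M"
  proof (intro power_mono)
    have "real_of_int k * real_of_int k \<le> (16 * real M * real j) * real_of_int k"
      using j2 k0 by (intro mult_right_mono) auto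
    thus "(real_of_int k)^2 / (16 * real M * t) \<le> j * real_of_int k / t"
      using assms by (simp add: field_simps power2_eq_square)
  qed (use assms in auto)
  also have "\<dots> \<le> ((1 + real_of_int k / t) ^ j) ^ M"
  proof (intro power_mono)
    have "1 + real j * (k / t) \<le> (1 + real_of_int k / t) ^ j"
      by (rule Bernoulli_inequality) (use assms k0 in \<open>auto intro: order_trans[of _ 0]\<close>)
    thus "j * real_of_int k / t \<le> (1 + real_of_int k / t) ^ j" by simp
  qed (use assms k0 in auto)
  also have "\<dots> = (1 + real_of_int k / t) ^ (M * j)" by (simp add: mult.commute flip: power_mult)
  also have "\<dots> \<le> (1 + real_of_int k / t) ^ i"
    using j1 assms k0 by (intro power_increasing) auto
  also have "\<dots> \<le> (1 + 2 * real_of_int n / t) ^ i"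
  proof (intro power_mono add_left_mono divide_right_mono)
    show "real_of_int k \<le> 2 * real_of_int n" using n(1) by linarith
  qed (use assms k0 in auto)
  finally have "heat1 t k * ((real_of_int k)^2 / (16 * real M * t)) ^ M \<le> heat1 t (n + 2 * int i) * (1 + 2 * real_of_int n / t) ^ i"
    using assms heat1_nonneg[of t k] by (simp add: n_def mult_left_mono)
  also have "\<dots> \<le> heat1 t n" by (rule heat1_geometric_decay) (use assms n in auto)
  finally have *: "heat1 t k * ((real_of_int k)^2 / (16 * real M * t)) ^ M \<le> heat1 t n" .
  have inv: "(16 * real M * t / (real_of_int k)^2) ^ M * ((real_of_int k)^2 / (16 * real M * t)) ^ M = 1"
    using assms k0 by (simp flip: power_mult_distrib)
  have "heat1 t k = (16 * real M * t / (real_of_int k)^2) ^ M * (heat1 t k * ((real_of_int k)^2 / (16 * real M * t)) ^ M)"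
    using inv by (simp add: mult.left_commute)
  also have "\<dots> \<le> (16 * real M * t / (real_of_int k)^2) ^ M * heat1 t n"
    using * assms by (intro mult_left_mono) auto
  finally have "heat1 t k \<le> (16 * real M * t / (real_of_int k)^2) ^ M * heat1 t n" .
  with n(1) show ?thesis by (rule that)
qed

text \<open>Time is written as \<eta>^2 so that all exponents are natural numbers; the real bound K
  makes the estimate uniform over the tail.\<close>

lemma heat1_tail_bound:
  assumes "\<eta> > 0" "M > 0" "\<bar>real_of_int k\<bar> \<ge> K" "K \<ge> 8 * real M"
  shows "heat1 (\<eta>^2) k \<le> 4 * (16 * real M) ^ M * (\<eta> / K) ^ (2 * M) / \<eta>"
proof -
  have "8 * int M \<le> \<bar>k\<bar>" using assms by linarith
  then obtain n where n: "heat1 (\<eta>^2) \<bar>k\<bar> \<le> (16 * real M * \<eta>^2 / (real_of_int \<bar>k\<bar>)^2) ^ M * heat1 (\<eta>^2) n"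
    using heat1_tail[of "\<eta>^2" M "\<bar>k\<bar>"] assms by auto
  have K: "K > 0" using assms by linarith
  have "heat1 (\<eta>^2) n \<le> 4 / \<eta>" using heat1_le_inverse_sqrt[of "\<eta>^2" n] assms by simp
  moreover have "(16 * real M * \<eta>^2 / (real_of_int \<bar>k\<bar>)^2) ^ M \<le> (16 * real M * \<eta>^2 / K^2) ^ M"
    using power_mono[OF assms(3), of 2] K assms(3)
    by (intro power_mono divide_left_mono mult_pos_pos) auto
  ultimately have "(16 * real M * \<eta>^2 / (real_of_int \<bar>k\<bar>)^2) ^ M * heat1 (\<eta>^2) n \<le> (16 * real M * \<eta>^2 / K^2) ^ M * (4 / \<eta>)"
    using heat1_nonneg[of "\<eta>^2" n] by (intro mult_mono) auto
  also have "\<dots> = 4 * (16 * real M) ^ M * (\<eta> / K) ^ (2 * M) / \<eta>"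
    by (simp add: power_mult_distrib power_divide power_mult)
  finally show ?thesis using n by (simp add: heat1_abs)
qed

text \<open>By monotonicity a one-step difference is at most the two-step difference centred at
  \<open>max k 1\<close>, which \<open>heat1_two_step\<close> evaluates.\<close>

lemma heat1_diff_le:
  assumes "t > 0" "k \<ge> 0"
  shows "\<bar>heat1 t (k + 1) - heat1 t k\<bar> \<le> 2 * real_of_int (max k 1) / t * heat1 t (max k 1)"
proof -
  have mono: "heat1 t (k + 1) \<le> heat1 t k" by (rule heat1_antimono) (use assms in auto)
  show ?thesis
  proof (cases "k = 0")
    case True
    have "heat1 t 2 \<le> heat1 t 1" by (rule heat1_antimono) (use assms in auto)
    thus ?thesis using heat1_two_step[of t 1] mono assms True by (simp add: field_simps)
  next
    case False
    have "heat1 t k \<le> heat1 t (k - 1)" by (rule heat1_antimono) (use assms False in auto)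
    moreover have "heat1 t (k - 1) - heat1 t (k + 1) = 2 * real_of_int k / t * heat1 t k"
      using heat1_two_step[of t k] assms by (simp add: field_simps)
    moreover have "max k 1 = k" using assms False by auto
    ultimately show ?thesis using mono by simp
  qed
qed

lemma heat1_diff_reflect:
  "\<bar>heat1 t (k + 1) - heat1 t k\<bar> = \<bar>heat1 t (- k - 1 + 1) - heat1 t (- k - 1)\<bar>"
proof -
  have "- k - 1 + 1 = - k" "- k - 1 = - (k + 1)" by auto
  hence "heat1 t (- k - 1 + 1) = heat1 t k" "heat1 t (- k - 1) = heat1 t (k + 1)" by (simp_all only: heat1_minus)
  thus ?thesis by (simp only: abs_minus_commute)
qed

lemma heat1_diff_bound:
  assumes "t > 0" shows "\<bar>heat1 t (k + 1) - heat1 t k\<bar> \<le> 2 / t"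
proof -
  have *: "\<bar>heat1 t (k + 1) - heat1 t k\<bar> \<le> 2 / t" if "k \<ge> 0" for k
  proof -
    have "real_of_int (max k 1) * heat1 t (max k 1) \<le> (real_of_int (max k 1) + 1) * heat1 t (max k 1)"
      using heat1_nonneg[of t "max k 1"] assms by (intro mult_right_mono) auto
    also have "\<dots> \<le> 1" by (rule heat1_le_inverse) (use assms in auto)
    finally have "2 / t * (real_of_int (max k 1) * heat1 t (max k 1)) \<le> 2 / t * 1"
      using assms by (intro mult_left_mono) auto
    thus ?thesis using heat1_diff_le[OF assms that] by simp
  qed
  show ?thesis
    using *[of k] *[of "- k - 1"] heat1_diff_reflect[of t k] by (cases "k \<ge> 0") auto
qed

text \<open>The margin is K + 1 because the reflection k -> -k - 1, applied to negative k, loses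
  one. The factor 1/\<eta> gained over the bound for values comes from k \<open>heat1 t n\<close>
  \<le> 2 for n \<ge> k/2.\<close>

lemma heat1_diff_tail_bound:
  assumes "\<eta> > 0" "M > 0" "\<bar>real_of_int k\<bar> \<ge> K + 1" "K \<ge> 8 * real M"
  shows "\<bar>heat1 (\<eta>^2) (k + 1) - heat1 (\<eta>^2) k\<bar> \<le> 4 * (16 * real M) ^ M * (\<eta> / K) ^ (2 * M) / \<eta>^2"
proof -
  have *: "\<bar>heat1 (\<eta>^2) (k + 1) - heat1 (\<eta>^2) k\<bar> \<le> 4 * (16 * real M) ^ M * (\<eta> / K) ^ (2 * M) / \<eta>^2"
    if k: "k \<ge> K" for k :: int
  proof -
    have k8: "8 * int M \<le> k" using assms k by linarith
    then obtain n where n: "2 * n \<ge> k" "heat1 (\<eta>^2) k \<le> (16 * real M * \<eta>^2 / (real_of_int k)^2) ^ M * heat1 (\<eta>^2) n"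
      using heat1_tail[of "\<eta>^2" M k] assms by auto
    have K: "K > 0" using assms by linarith
    have k1: "max k 1 = k" using K k by linarith
    have n0: "n \<ge> 0" using n(1) k1 by linarith
    have "real_of_int k * heat1 (\<eta>^2) n \<le> 2 * (real_of_int n + 1) * heat1 (\<eta>^2) n"
    proof (intro mult_right_mono heat1_nonneg)
      have "real_of_int k \<le> 2 * real_of_int n" using n(1) by linarith
      thus "real_of_int k \<le> 2 * (real_of_int n + 1)" by simp
    qed auto
    also have "\<dots> = 2 * ((real_of_int n + 1) * heat1 (\<eta>^2) n)" by simp
    also have "\<dots> \<le> 2 * 1" using heat1_le_inverse[of "\<eta>^2" n] n0 by (intro mult_left_mono) auto
    finally have kn: "real_of_int k * heat1 (\<eta>^2) n \<le> 2" by simp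
    have "(16 * real M * \<eta>^2 / (real_of_int k)^2) ^ M \<le> (16 * real M * \<eta>^2 / K^2) ^ M"
      using power_mono[OF k, of 2] K k
      by (intro power_mono divide_left_mono mult_pos_pos) auto
    hence X: "(16 * real M * \<eta>^2 / (real_of_int k)^2) ^ M * (real_of_int k * heat1 (\<eta>^2) n) \<le> (16 * real M * \<eta>^2 / K^2) ^ M * 2"
      using kn k1 heat1_nonneg[of "\<eta>^2" n] by (intro mult_mono) auto
    have "\<bar>heat1 (\<eta>^2) (k + 1) - heat1 (\<eta>^2) k\<bar> \<le> 2 / \<eta>^2 * (real_of_int k * heat1 (\<eta>^2) k)"
      using heat1_diff_le[of "\<eta>^2" k] assms k1 k8 by (simp add: mult.assoc)
    also have "\<dots> \<le> 2 / \<eta>^2 * (real_of_int k * ((16 * real M * \<eta>^2 / (real_of_int k)^2) ^ M * heat1 (\<eta>^2) n))"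
      using n(2) k1 by (intro mult_left_mono) auto
    also have "\<dots> = 2 / \<eta>^2 * ((16 * real M * \<eta>^2 / (real_of_int k)^2) ^ M * (real_of_int k * heat1 (\<eta>^2) n))"
      by simp
    also have "\<dots> \<le> 2 / \<eta>^2 * ((16 * real M * \<eta>^2 / K^2) ^ M * 2)"
      using X by (intro mult_left_mono) auto
    also have "\<dots> = 4 * (16 * real M) ^ M * (\<eta> / K) ^ (2 * M) / \<eta>^2"
      by (simp add: power_mult_distrib power_divide power_mult) (simp only: mult_ac)
    finally show ?thesis .
  qed
  show ?thesis
  proof (cases "k \<ge> 0")
    case True
    thus ?thesis using assms by (intro *) auto
  next
    case False
    show ?thesis by (subst heat1_diff_reflect, rule *) (use False assms in auto)
  qed
qed

section \<open>The discrete Laplacian and the heat kernel on the lattice\<close>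

text \<open>Mean over the neighbours minus the value, so that emitting one unit of mass at x changes
  the configuration by the Laplacian of the indicator of x.\<close>

definition lap :: "('d::finite site \<Rightarrow> real) \<Rightarrow> 'd site \<Rightarrow> real" where
  "lap f x = (\<Sum>i\<in>UNIV. f (x + axis i 1) + f (x - axis i 1) - 2 * f x) / (2 * real CARD('d))"

lemma lap_add: "lap (\<lambda>x. f x + g x) x = lap f x + lap g x"
  by (simp add: lap_def sum.distrib sum_subtractf add_divide_distrib diff_divide_distrib flip: sum_distrib_left)

lemma lap_cmult: "lap (\<lambda>x. c * f x) x = c * lap f x"
  by (simp add: lap_def sum_distrib_left algebra_simps)

lemma lap_diff: "lap (\<lambda>x. f x - g x) x = lap f x - lap g x"
  using lap_add[of f "\<lambda>x. - 1 * g x" x] by (simp add: lap_cmult[of "-1", simplified])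

lemma lap_const [simp]: "lap (\<lambda>x. c) x = 0"
  by (simp add: lap_def)

lemma lap_sum: "lap (\<lambda>x. \<Sum>y\<in>A. f y x) x = (\<Sum>y\<in>A. lap (f y) x)"
  by (induction A rule: infinite_finite_induct) (auto simp: lap_add)

lemma lap_translate: "lap (\<lambda>x. f (x - y)) x = lap f (x - y)"
  by (simp add: lap_def algebra_simps)

text \<open>For gluing: at a site where a minimum or maximum of two functions equals one of them, it
  inherits the one-sided bound on the Laplacian of that piece.\<close>

lemma lap_mono:
  assumes "f x = g x" "\<And>i. f (x + axis i 1) \<le> g (x + axis i 1)" "\<And>i. f (x - axis i 1) \<le> g (x - axis i 1)"
  shows "lap f x \<le> lap g (x::'d::finite site)"
  unfolding lap_def using assms by (intro divide_right_mono sum_mono) (auto intro!: add_mono)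

lemma lap_eq_mean:
  "lap f x = (\<Sum>i\<in>UNIV. f (x + axis i 1) + f (x - axis i 1)) / (2 * real CARD('d)) - f (x::'d::finite site)"
  by (simp add: lap_def sum_subtractf diff_divide_distrib)

lemma axis_nz: "axis i (1::int) \<noteq> (0::'d::finite site)"
  by (simp add: axis_eq_0_iff)

text \<open>Summation by parts: in each direction the increments over edges inside Q cancel in
  pairs, and those over edges leaving Q are nonpositive.\<close>

lemma sum_lap_le_0:
  fixes g :: "'d::finite site \<Rightarrow> real"
  assumes fin: "finite Q"
    and out1: "\<And>x i. x \<in> Q \<Longrightarrow> x + axis i 1 \<notin> Q \<Longrightarrow> g (x + axis i 1) \<le> g x"
    and out2: "\<And>x i. x \<in> Q \<Longrightarrow> x - axis i 1 \<notin> Q \<Longrightarrow> g (x - axis i 1) \<le> g x"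
  shows "(\<Sum>x\<in>Q. lap g x) \<le> 0"
proof -
  have dir: "(\<Sum>x\<in>Q. g (x + axis i 1) + g (x - axis i 1) - 2 * g x) \<le> 0" for i :: 'd
  proof -
    let ?e = "axis i 1 :: 'd site"
    have "(\<Sum>x\<in>Q. g (x + ?e) - g x) \<le> (\<Sum>x\<in>{x\<in>Q. x + ?e \<in> Q}. g (x + ?e) - g x)"
      using out1 by (subst sum.inter_filter[OF fin]) (intro sum_mono, auto)
    moreover have "(\<Sum>x\<in>Q. g (x - ?e) - g x) \<le> (\<Sum>x\<in>{x\<in>Q. x - ?e \<in> Q}. g (x - ?e) - g x)"
      using out2 by (subst sum.inter_filter[OF fin]) (intro sum_mono, auto)
    moreover have "(\<Sum>x\<in>{x\<in>Q. x - ?e \<in> Q}. g (x - ?e) - g x) = (\<Sum>x\<in>{x\<in>Q. x + ?e \<in> Q}. g x - g (x + ?e))"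
      by (rule sum.reindex_bij_witness[of _ "\<lambda>x. x + ?e" "\<lambda>x. x - ?e"]) auto
    moreover have "(\<Sum>x\<in>{x\<in>Q. x + ?e \<in> Q}. g x - g (x + ?e)) = - (\<Sum>x\<in>{x\<in>Q. x + ?e \<in> Q}. g (x + ?e) - g x)"
      by (simp flip: sum_negf)
    moreover have "(\<Sum>x\<in>Q. g (x + ?e) + g (x - ?e) - 2 * g x) = (\<Sum>x\<in>Q. g (x + ?e) - g x) + (\<Sum>x\<in>Q. g (x - ?e) - g x)"
      by (simp flip: sum.distrib)
    ultimately show ?thesis by linarith
  qed
  have "(\<Sum>x\<in>Q. lap g x) = (\<Sum>i\<in>UNIV. \<Sum>x\<in>Q. g (x + axis i 1) + g (x - axis i 1) - 2 * g x) / (2 * real CARD('d))"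
    unfolding lap_def by (subst sum.swap) (simp add: sum_divide_distrib)
  also have "\<dots> \<le> 0"
    by (intro divide_nonpos_nonneg sum_nonpos dir) auto
  finally show ?thesis .
qed

lemma min_principle:
  fixes v :: "'d::finite site \<Rightarrow> real"
  assumes fin: "finite \<Omega>"
    and sup: "\<And>x. x \<in> \<Omega> \<Longrightarrow> lap v x \<le> 0"
    and out1: "\<And>x i. x \<in> \<Omega> \<Longrightarrow> x + axis i 1 \<notin> \<Omega> \<Longrightarrow> c \<le> v (x + axis i 1)"
    and out2: "\<And>x i. x \<in> \<Omega> \<Longrightarrow> x - axis i 1 \<notin> \<Omega> \<Longrightarrow> c \<le> v (x - axis i 1)"
    and x: "x \<in> \<Omega>"
  shows "c \<le> v x"
proof (rule ccontr)
  assume neg: "\<not> c \<le> v x"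
  define m where "m = Min (v ` \<Omega>)"
  have m: "m \<le> v y" if "y \<in> \<Omega>" for y unfolding m_def using fin that by simp
  have mc: "m < c" using m[OF x] neg by simp
  \<comment> \<open>Among the minimisers take one that is extreme in direction \<open>j\<close>.\<close>
  define Z where "Z = {y \<in> \<Omega>. v y = m}"
  have finZ: "finite Z" using fin by (simp add: Z_def)
  have "m \<in> v ` \<Omega>" unfolding m_def using fin x by (intro Min_in) auto
  hence Z: "Z \<noteq> {}" by (auto simp: Z_def)
  fix j :: 'd
  define K where "K = Max ((\<lambda>y. y $ j) ` Z)"
  have "K \<in> (\<lambda>y. y $ j) ` Z" unfolding K_def using finZ Z by (intro Max_in) auto
  then obtain y where y: "y \<in> Z" "y $ j = K" by auto
  have ge1: "m \<le> v (y + axis i 1)" for i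
    using y m[of "y + axis i 1"] out1[of y i] mc by (cases "y + axis i 1 \<in> \<Omega>") (auto simp: Z_def)
  have ge2: "m \<le> v (y - axis i 1)" for i
    using y m[of "y - axis i 1"] out2[of y i] mc by (cases "y - axis i 1 \<in> \<Omega>") (auto simp: Z_def)
  have gt: "m < v (y + axis j 1)"
  proof (cases "y + axis j 1 \<in> \<Omega>")
    case True
    have "y + axis j 1 \<notin> Z"
    proof
      assume "y + axis j 1 \<in> Z"
      hence "(y + axis j 1) $ j \<in> (\<lambda>y. y $ j) ` Z" by (rule imageI)
      hence "(y + axis j 1) $ j \<le> K" unfolding K_def using finZ by (intro Max_ge) auto
      thus False using y by (simp add: axis_def)
    qed
    thus ?thesis using True m[OF True] by (auto simp: Z_def)
  next
    case False
    thus ?thesis using out1[of y j] y mc by (auto simp: Z_def)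
  qed
  have vy: "v y = m" using y by (simp add: Z_def)
  have "0 < (\<Sum>i\<in>UNIV. v (y + axis i 1) + v (y - axis i 1) - 2 * v y)"
  proof (rule sum_pos2)
    show "0 < v (y + axis j 1) + v (y - axis j 1) - 2 * v y"
      using gt ge2[of j] vy by linarith
    show "0 \<le> v (y + axis i 1) + v (y - axis i 1) - 2 * v y" for i
      using ge1[of i] ge2[of i] vy by linarith
  qed auto
  hence "lap v y > 0" by (simp add: lap_def)
  thus False using sup[of y] y by (auto simp: Z_def)
qed

section \<open>The heat kernel on the lattice\<close>

definition heat :: "real \<Rightarrow> 'd::finite site \<Rightarrow> real" where
  "heat t z = (\<Prod>i\<in>UNIV. heat1 t (z $ i))"

lemma heat_nonneg: "t \<ge> 0 \<Longrightarrow> 0 \<le> heat t z"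
  by (simp add: heat_def heat1_nonneg prod_nonneg)

lemma heat_0: "heat 0 z = (if z = 0 then 1 else 0)"
  by (auto simp: heat_def heat1_0 vec_eq_iff)

lemma heat_split:
  fixes z :: "'d::finite site"
  shows "heat t z = heat1 t (z $ i) * (\<Prod>j\<in>UNIV - {i}. heat1 t (z $ j))"
  unfolding heat_def by (subst prod.remove[of _ i]) auto

lemma heat_shift:
  fixes z :: "'d::finite site"
  shows "heat t (z + axis i c) = heat1 t (z $ i + c) * (\<Prod>j\<in>UNIV - {i}. heat1 t (z $ j))"
  unfolding heat_split[of t "z + axis i c" i]
  by (intro arg_cong2[of _ _ _ _ "(*)"] prod.cong) (auto simp: axis_def)

text \<open>In continuous time the coordinates move independently, so the kernel is a product and
  the product rule yields the sum over directions. Each coordinate jumps at rate 1, the whole walk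
  at rate d; hence the factor in front of the normalised Laplacian.\<close>

lemma DERIV_heat:
  fixes z :: "'d::finite site"
  shows "((\<lambda>t. heat t z) has_real_derivative real CARD('d) * lap (heat t) z) (at t)"
proof -
  have eq: "(\<Sum>i\<in>UNIV. ((heat1 t (z $ i - 1) + heat1 t (z $ i + 1)) / 2 - heat1 t (z $ i)) * (\<Prod>j\<in>UNIV - {i}. heat1 t (z $ j)))
       = real CARD('d) * lap (heat t) z"
  proof -
    have "((heat1 t (z $ i - 1) + heat1 t (z $ i + 1)) / 2 - heat1 t (z $ i)) * (\<Prod>j\<in>UNIV - {i}. heat1 t (z $ j))
      = (heat t (z + axis i 1) + heat t (z - axis i 1) - 2 * heat t z) / 2" for i
    proof -
      have "z - axis i 1 = z + axis i (-1)" by (auto simp: vec_eq_iff axis_def)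
      hence "heat t (z - axis i 1) = heat1 t (z $ i - 1) * (\<Prod>j\<in>UNIV - {i}. heat1 t (z $ j))"
        by (simp only: heat_shift) simp
      thus ?thesis by (simp add: heat_shift heat_split[of t z i] field_simps)
    qed
    thus ?thesis by (simp only: lap_def) (simp flip: sum_divide_distrib)
  qed
  show ?thesis
    unfolding eq[symmetric] unfolding heat_def
    by (rule has_field_derivative_prod) (use DERIV_heat1 in auto)
qed

lemma continuous_on_heat: "continuous_on A (\<lambda>t. heat t z)"
  by (intro continuous_at_imp_continuous_on ballI DERIV_isCont[OF DERIV_heat])

lemma sum_heat_le:
  fixes F :: "'d::finite site set"
  assumes "t \<ge> 0" "finite F" shows "(\<Sum>z\<in>F. heat t z) \<le> 1"
proof -
  define B where "B = (\<Union>i\<in>UNIV. (\<lambda>z::'d site. z $ i) ` F)"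
  have B: "finite B" using assms by (auto simp: B_def)
  have "(\<Sum>z\<in>F. heat t z) = (\<Sum>g\<in>vec_nth ` F. \<Prod>i\<in>UNIV. heat1 t (g i))"
    by (subst sum.reindex) (auto simp: inj_on_def vec_nth_inject heat_def)
  also have "\<dots> \<le> (\<Sum>g\<in>PiE UNIV (\<lambda>_::'d. B). \<Prod>i\<in>UNIV. heat1 t (g i))"
    by (intro sum_mono2) (use assms B in \<open>auto simp: B_def PiE_iff intro!: finite_PiE prod_nonneg heat1_nonneg\<close>)
  also have "\<dots> = (\<Prod>i\<in>(UNIV::'d set). \<Sum>k\<in>B. heat1 t k)"
    by (subst prod_sum_PiE) (use B in auto)
  also have "\<dots> \<le> 1"
    by (intro prod_le_1 conjI sum_nonneg heat1_nonneg sum_heat1_le) (use assms B in auto)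
  finally show ?thesis .
qed

text \<open>Distance in the maximum norm, since the tail bounds act on one coordinate factor at a
  time.\<close>

definition far :: "real \<Rightarrow> 'd::finite site \<Rightarrow> bool" where
  "far K z \<longleftrightarrow> (\<exists>j. \<bar>real_of_int (z $ j)\<bar> \<ge> K)"

lemma heat1_le_inv: "\<eta> > 0 \<Longrightarrow> heat1 (\<eta>^2) k \<le> 4 / \<eta>"
  using heat1_le_inverse_sqrt[of "\<eta>^2" k] by simp

lemma prod_heat1_le:
  assumes "\<eta> > 0" shows "(\<Prod>j\<in>A. heat1 (\<eta>^2) (z $ j)) \<le> (4 / \<eta>) ^ card A"
  using prod_mono[of A "\<lambda>j. heat1 (\<eta>^2) (z $ j)" "\<lambda>_. 4 / \<eta>"] assms
  by (auto simp: heat1_le_inv heat1_nonneg)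

lemma card_UNIV_minus: "card (UNIV - {i::'d::finite}) = CARD('d) - 1"
  by (simp add: card_Diff_subset)

lemma CARD_minus: "CARD('d::finite) - 1 + 1 = CARD('d)"
  using zero_less_card_finite[where 'a='d] by linarith

text \<open>The far coordinate contributes its tail bound, each of the others 4/\<eta>.\<close>

lemma heat_tail_bound:
  fixes z :: "'d::finite site"
  assumes "\<eta> > 0" "M > 0" "far K z" "K \<ge> 8 * real M"
  shows "heat (\<eta>^2) z \<le> (16 * real M) ^ M * 4 ^ CARD('d) * (\<eta> / K) ^ (2 * M) / \<eta> ^ CARD('d)"
proof -
  obtain i where i: "\<bar>real_of_int (z $ i)\<bar> \<ge> K" using assms by (auto simp: far_def)
  have K: "K > 0" using assms by linarith
  have "heat (\<eta>^2) z \<le> (4 * (16 * real M) ^ M * (\<eta> / K) ^ (2 * M) / \<eta>) * (4 / \<eta>) ^ (CARD('d) - 1)"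
    unfolding heat_split[of _ z i]
    using prod_heat1_le[OF assms(1), where A="UNIV - {i}" and z=z] heat1_tail_bound[OF assms(1,2) i assms(4)] assms(1) K
    by (intro mult_mono) (auto simp: card_UNIV_minus intro!: prod_nonneg heat1_nonneg)
  also have "\<dots> = (16 * real M) ^ M * (\<eta> / K) ^ (2 * M) * (4 / \<eta>) ^ (CARD('d) - 1 + 1)"
    by (simp only: power_add) simp
  also have "\<dots> = (16 * real M) ^ M * 4 ^ CARD('d) * (\<eta> / K) ^ (2 * M) / \<eta> ^ CARD('d)"
    by (simp only: CARD_minus power_divide) simp
  finally show ?thesis .
qed

lemma heat_diff_bound:
  fixes z :: "'d::finite site"
  assumes "\<eta> > 0"
  shows "\<bar>heat (\<eta>^2) (z + axis i 1) - heat (\<eta>^2) z\<bar> \<le> 4 ^ CARD('d) / \<eta> ^ (CARD('d) + 1)"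
proof -
  have "\<bar>heat (\<eta>^2) (z + axis i 1) - heat (\<eta>^2) z\<bar> =
      \<bar>heat1 (\<eta>^2) (z $ i + 1) - heat1 (\<eta>^2) (z $ i)\<bar> * (\<Prod>j\<in>UNIV - {i}. heat1 (\<eta>^2) (z $ j))"
    by (simp add: heat_shift heat_split[of _ z i] abs_mult prod_nonneg heat1_nonneg flip: left_diff_distrib)
  also have "\<dots> \<le> (2 / \<eta>^2) * (4 / \<eta>) ^ (CARD('d) - 1)"
    using prod_heat1_le[OF assms(1), where A="UNIV - {i}" and z=z] heat1_diff_bound[of "\<eta>^2" "z $ i"] assms
    by (intro mult_mono) (auto simp: card_UNIV_minus intro!: prod_nonneg heat1_nonneg)
  also have "\<dots> \<le> (4 / \<eta>^2) * (4 / \<eta>) ^ (CARD('d) - 1)"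
    using assms by (intro mult_right_mono divide_right_mono) auto
  also have "\<dots> = 1 / \<eta> * (4 / \<eta>) ^ (CARD('d) - 1 + 1)"
    by (simp only: power_add) (simp add: power2_eq_square)
  also have "\<dots> = 4 ^ CARD('d) / \<eta> ^ (CARD('d) + 1)"
    by (simp only: CARD_minus power_divide) simp
  finally show ?thesis .
qed

text \<open>If the far coordinate is the direction of the difference, its increment has the tail
  bound; otherwise the increment gets the plain gradient bound and the far coordinate the tail bound
  for values. Both cases have the same order.\<close>

lemma heat_diff_tail_bound:
  fixes z :: "'d::finite site"
  assumes "\<eta> > 0" "M > 0" "far (K + 1) z" "K \<ge> 8 * real M"
  shows "\<bar>heat (\<eta>^2) (z + axis i 1) - heat (\<eta>^2) z\<bar>
    \<le> (16 * real M) ^ M * 4 ^ CARD('d) * (\<eta> / K) ^ (2 * M) / \<eta> ^ (CARD('d) + 1)"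
proof -
  define P where "P = (\<Prod>j\<in>UNIV - {i}. heat1 (\<eta>^2) (z $ j))"
  define T where "T = (16 * real M) ^ M * (\<eta> / K) ^ (2 * M)"
  have K: "K > 0" using assms by linarith
  have T0: "T \<ge> 0" using K assms by (simp add: T_def)
  have P0: "P \<ge> 0" by (auto simp: P_def intro!: prod_nonneg heat1_nonneg)
  have eq: "\<bar>heat (\<eta>^2) (z + axis i 1) - heat (\<eta>^2) z\<bar> =
      \<bar>heat1 (\<eta>^2) (z $ i + 1) - heat1 (\<eta>^2) (z $ i)\<bar> * P"
    using P0 by (simp add: heat_shift heat_split[of _ z i] abs_mult P_def flip: left_diff_distrib)
  obtain j where j: "\<bar>real_of_int (z $ j)\<bar> \<ge> K + 1" using assms by (auto simp: far_def)
  have "\<bar>heat1 (\<eta>^2) (z $ i + 1) - heat1 (\<eta>^2) (z $ i)\<bar> * P \<le> (4 / \<eta>^2) * T * (4 / \<eta>) ^ (CARD('d) - 1)"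
  proof (cases "j = i")
    case True
    have "P \<le> (4 / \<eta>) ^ (CARD('d) - 1)"
      using prod_heat1_le[OF assms(1), where A="UNIV - {i}" and z=z] by (simp add: card_UNIV_minus P_def)
    moreover have "\<bar>heat1 (\<eta>^2) (z $ i + 1) - heat1 (\<eta>^2) (z $ i)\<bar> \<le> 4 / \<eta>^2 * T"
      using heat1_diff_tail_bound[OF assms(1,2) j assms(4)] True by (simp add: T_def)
    ultimately show ?thesis using P0 T0 by (intro mult_mono) auto
  next
    case False
    have "P = heat1 (\<eta>^2) (z $ j) * (\<Prod>l\<in>UNIV - {i} - {j}. heat1 (\<eta>^2) (z $ l))"
      unfolding P_def by (subst prod.remove[of _ j]) (use False in auto)
    also have "\<dots> \<le> (4 * (16 * real M) ^ M * (\<eta> / K) ^ (2 * M) / \<eta>) * (4 / \<eta>) ^ card (UNIV - {i} - {j})"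
      using heat1_tail_bound[of \<eta> M K "z $ j"] prod_heat1_le[OF assms(1), where A="UNIV - {i} - {j}" and z=z] assms j K
      by (intro mult_mono) (auto intro!: prod_nonneg heat1_nonneg)
    also have "\<dots> = T * (4 / \<eta>) ^ (card (UNIV - {i} - {j}) + 1)"
      by (simp add: T_def)
    also have "card (UNIV - {i} - {j}) + 1 = CARD('d) - 1"
      using False by (subst card_UNIV_minus[of i, symmetric]) (subst card.remove[of "UNIV - {i}" j], auto)
    finally have "P \<le> T * (4 / \<eta>) ^ (CARD('d) - 1)" .
    moreover have "\<bar>heat1 (\<eta>^2) (z $ i + 1) - heat1 (\<eta>^2) (z $ i)\<bar> \<le> 4 / \<eta>^2"
      using heat1_diff_bound[of "\<eta>^2" "z $ i"] assms by (auto intro: order_trans simp: divide_right_mono)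
    ultimately have "\<bar>heat1 (\<eta>^2) (z $ i + 1) - heat1 (\<eta>^2) (z $ i)\<bar> * P \<le> 4 / \<eta>^2 * (T * (4 / \<eta>) ^ (CARD('d) - 1))"
      using P0 by (intro mult_mono) auto
    thus ?thesis by (simp only: mult.assoc)
  qed
  also have "\<dots> = T * (1 / \<eta>) * (4 / \<eta>) ^ (CARD('d) - 1 + 1)"
    by (simp only: power_add) (simp add: power2_eq_square)
  also have "\<dots> = (16 * real M) ^ M * 4 ^ CARD('d) * (\<eta> / K) ^ (2 * M) / \<eta> ^ (CARD('d) + 1)"
    by (simp only: CARD_minus power_divide T_def) (simp add: mult_ac)
  finally show ?thesis using eq by simp
qed

section \<open>The Green function up to a finite time\<close>

text \<open>A path from x to x - y that always moves towards its target has as many steps as the l1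
  norm of y and stays in the box about x with half-widths |y_j|. The increment bound is demanded
  only inside this box, which can be kept away from the origin.\<close>

lemma lattice_path:
  fixes x y :: "'d::finite site"
  assumes step: "\<And>z i. (\<And>j. \<bar>z $ j - x $ j\<bar> \<le> \<bar>y $ j\<bar>) \<Longrightarrow> (\<And>j. \<bar>(z + axis i 1) $ j - x $ j\<bar> \<le> \<bar>y $ j\<bar>) \<Longrightarrow>
      \<bar>f (z + axis i 1) - f z\<bar> \<le> \<epsilon>"
  shows "\<bar>f (x - y) - f x\<bar> \<le> (\<Sum>j\<in>UNIV. \<bar>real_of_int (y $ j)\<bar>) * \<epsilon>"
  using step
proof (induction "nat (\<Sum>j\<in>UNIV. \<bar>y $ j\<bar>)" arbitrary: y rule: less_induct)
  case (less y)
  show ?case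
  proof (cases "y = 0")
    case False
    then obtain i where i: "y $ i \<noteq> 0" by (auto simp: vec_eq_iff)
    define c where "c = sgn (y $ i)"
    have c: "c = 1 \<and> y $ i > 0 \<or> c = -1 \<and> y $ i < 0" using i by (auto simp: c_def sgn_if)
    define y' where "y' = y - axis i c"
    have y'j: "\<bar>y' $ j\<bar> = \<bar>y $ j\<bar> - (if j = i then 1 else 0)" for j
      using c by (auto simp: y'_def axis_def)
    have sum': "(\<Sum>j\<in>UNIV. \<bar>y' $ j\<bar>) = (\<Sum>j\<in>UNIV. \<bar>y $ j\<bar>) - 1"
      by (simp add: y'j sum_subtractf)
    have "\<bar>y $ i\<bar> \<le> (\<Sum>j\<in>UNIV. \<bar>y $ j\<bar>)" by (rule member_le_sum) auto
    hence lt: "nat (\<Sum>j\<in>UNIV. \<bar>y' $ j\<bar>) < nat (\<Sum>j\<in>UNIV. \<bar>y $ j\<bar>)"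
      using i unfolding sum' by linarith
    have le: "\<bar>y' $ j\<bar> \<le> \<bar>y $ j\<bar>" for j using y'j[of j] by auto
    have IH: "\<bar>f (x - y') - f x\<bar> \<le> (\<Sum>j\<in>UNIV. \<bar>real_of_int (y' $ j)\<bar>) * \<epsilon>"
    proof (rule less.hyps[OF lt])
      fix z i
      assume "\<And>j. \<bar>z $ j - x $ j\<bar> \<le> \<bar>y' $ j\<bar>" "\<And>j. \<bar>(z + axis i 1) $ j - x $ j\<bar> \<le> \<bar>y' $ j\<bar>"
      thus "\<bar>f (z + axis i 1) - f z\<bar> \<le> \<epsilon>"
        using le by (intro less.prems) (meson order_trans)+
    qed
    have "\<bar>f (x - y) - f (x - y')\<bar> \<le> \<epsilon>"
    proof (cases "c = 1")
      case True
      have e: "x - y' = (x - y) + axis i 1" by (simp add: y'_def True algebra_simps)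
      have "\<bar>f ((x - y) + axis i 1) - f (x - y)\<bar> \<le> \<epsilon>"
        by (rule less.prems) (use le in \<open>auto simp flip: e simp del: vector_add_component\<close>)
      thus ?thesis by (simp add: e abs_minus_commute)
    next
      case False
      hence c1: "c = -1" using c by auto
      have "axis i (- 1) = - axis i (1::int)" by (auto simp: vec_eq_iff axis_def)
      hence e: "x - y = (x - y') + axis i 1" by (simp add: y'_def c1 algebra_simps)
      have "\<bar>f ((x - y') + axis i 1) - f (x - y')\<bar> \<le> \<epsilon>"
        by (rule less.prems) (use le in \<open>auto simp flip: e simp del: vector_add_component\<close>)
      thus ?thesis by (simp add: e)
    qed
    moreover
    have "(\<Sum>j\<in>UNIV. \<bar>real_of_int (y' $ j)\<bar>) = (\<Sum>j\<in>UNIV. \<bar>real_of_int (y $ j)\<bar>) - 1"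
      using arg_cong[OF sum', of real_of_int] by simp
    hence "(\<Sum>j\<in>UNIV. \<bar>real_of_int (y $ j)\<bar>) = (\<Sum>j\<in>UNIV. \<bar>real_of_int (y' $ j)\<bar>) + 1"
      by linarith
    hence "(\<Sum>j\<in>UNIV. \<bar>real_of_int (y $ j)\<bar>) * \<epsilon> = (\<Sum>j\<in>UNIV. \<bar>real_of_int (y' $ j)\<bar>) * \<epsilon> + \<epsilon>"
      by (simp only: distrib_right mult_1)
    ultimately show ?thesis using IH by linarith
  qed simp
qed

text \<open>Occupation time of z up to time \<rho>^2, multiplied by the jump rate d to match the
  normalised Laplacian.\<close>

definition green :: "real \<Rightarrow> 'd::finite site \<Rightarrow> real" where
  "green \<rho> z = real CARD('d) * integral {0..\<rho>^2} (\<lambda>t. heat t z)"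

lemma heat_integrable: "(\<lambda>t. heat t z) integrable_on {a..b}"
  by (rule integrable_continuous_real[OF continuous_on_heat])

lemma green_nonneg: "0 \<le> green \<rho> z"
  unfolding green_def by (intro mult_nonneg_nonneg integral_nonneg heat_integrable heat_nonneg) auto

text \<open>The heat equation integrated in time: the endpoint values are
  \<open>heat (\<rho>^2)\<close> and the unit mass \<open>heat 0\<close>.\<close>

lemma lap_green:
  fixes z :: "'d::finite site"
  shows "lap (green \<rho>) z = heat (\<rho>^2) z - (if z = 0 then 1 else 0)"
proof -
  let ?I = "\<lambda>z. integral {0..\<rho>^2} (\<lambda>t. heat t z)"
  have I: "((\<lambda>t. heat t z) has_integral ?I z) {0..\<rho>^2}" for z :: "'d site"
    by (rule integrable_integral[OF heat_integrable])
  have "((\<lambda>t. real CARD('d) * lap (heat t) z) has_integral (real CARD('d) * lap ?I z)) {0..\<rho>^2}"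
    unfolding lap_def
    by (intro has_integral_mult_right has_integral_divide has_integral_sum has_integral_add has_integral_diff I) auto
  moreover have "((\<lambda>t. real CARD('d) * lap (heat t) z) has_integral (heat (\<rho>^2) z - heat 0 z)) {0..\<rho>^2}"
    by (rule fundamental_theorem_of_calculus)
       (auto intro: has_field_derivative_at_within DERIV_heat simp flip: has_real_derivative_iff_has_vector_derivative)
  ultimately have "real CARD('d) * lap ?I z = heat (\<rho>^2) z - heat 0 z"
    by (rule has_integral_unique)
  moreover have "lap (green \<rho>) z = real CARD('d) * lap ?I z"
    using lap_cmult[of "real CARD('d)" ?I z] by (simp add: green_def[abs_def])
  ultimately show ?thesis by (simp add: heat_0)
qed

lemma sum_green_le:
  fixes F :: "'d::finite site set"
  assumes "finite F" shows "(\<Sum>z\<in>F. green \<rho> z) \<le> real CARD('d) * \<rho>^2"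
proof -
  have "(\<Sum>z\<in>F. green \<rho> z) = real CARD('d) * integral {0..\<rho>^2} (\<lambda>t. \<Sum>z\<in>F. heat t z)"
    unfolding green_def sum_distrib_left[symmetric]
    by (subst integral_sum[OF assms heat_integrable]) simp
  also have "\<dots> \<le> real CARD('d) * integral {0..\<rho>^2} (\<lambda>t. 1)"
    using assms by (intro mult_left_mono integral_le integrable_sum heat_integrable sum_heat_le) auto
  finally show ?thesis by simp
qed

text \<open>The constant of \<open>heat_tail_bound\<close> for M = d and K = c\<rho>: (16d)^d 4^d =
  (64d)^d, with c^(2d) from the ratio \<eta>/K.\<close>

definition heat_const :: "real \<Rightarrow> 'd::finite itself \<Rightarrow> real" where
  "heat_const c _ = (64 * real CARD('d)) ^ CARD('d) / c ^ (2 * CARD('d))"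

lemma far_mono: "far K z \<Longrightarrow> L \<le> K \<Longrightarrow> far L z"
  unfolding far_def by (meson order_trans)

lemma far_nonzero: "far K z \<Longrightarrow> K > 0 \<Longrightarrow> z \<noteq> 0"
  by (auto simp: far_def)

lemma heat_const_nonneg: "c > 0 \<Longrightarrow> 0 \<le> heat_const c TYPE('d::finite)"
  by (simp add: heat_const_def)

lemma power_64: "(64 * x) ^ n = (16 * x) ^ n * (4::real) ^ n"
  using power_mult_distrib[of "16 * x" 4 n] by simp

lemma power_ratio_split:
  assumes "\<eta> > (0::real)" "c > 0" "\<rho> > 0"
  shows "(\<eta> / (c * \<rho>)) ^ (a + b) / \<eta> ^ b = (\<eta> / \<rho>) ^ a / \<rho> ^ b / c ^ (a + b)"
  using assms by (simp add: power_divide power_mult_distrib power_add)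

text \<open>Tail order M = d suffices: (\<eta>/(c\<rho>))^(2d) / \<eta>^d = (\<eta>/\<rho>)^d /
  (c^(2d) \<rho>^d), which is bounded uniformly in \<eta> = sqrt t \<le> \<rho>, however small t
  is.\<close>

lemma heat_far:
  fixes z :: "'d::finite site"
  assumes "c > 0" "c * \<rho> \<ge> 8 * real CARD('d)" "far (c * \<rho>) z" "0 \<le> t" "t \<le> \<rho>^2" "\<rho> > 0"
  shows "heat t z \<le> heat_const c TYPE('d) / \<rho> ^ CARD('d)"
proof (cases "t = 0")
  case True
  thus ?thesis using far_nonzero[OF assms(3)] assms heat_const_nonneg[OF assms(1), where 'd='d] by (simp add: heat_0)
next
  case False
  let ?n = "CARD('d)"
  define \<eta> where "\<eta> = sqrt t"
  have \<eta>: "0 < \<eta>" "\<eta> \<le> \<rho>" "t = \<eta>^2"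
    using assms False by (auto simp: \<eta>_def real_le_lsqrt)
  have "heat t z \<le> (16 * real ?n) ^ ?n * 4 ^ ?n * (\<eta> / (c * \<rho>)) ^ (2 * ?n) / \<eta> ^ ?n"
    unfolding \<eta>(3) using assms by (intro heat_tail_bound \<eta>) auto
  also have "\<dots> = (64 * real ?n) ^ ?n * ((\<eta> / (c * \<rho>)) ^ (?n + ?n) / \<eta> ^ ?n)"
    unfolding power_64 by (simp flip: mult_2)
  also have "\<dots> = heat_const c TYPE('d) * ((\<eta> / \<rho>) ^ ?n / \<rho> ^ ?n)"
  proof -
    have "?n + ?n = 2 * ?n" by simp
    thus ?thesis using power_ratio_split[OF \<eta>(1) assms(1,6), of ?n ?n]
      unfolding heat_const_def by (simp only:) simp
  qed
  also have "\<dots> \<le> heat_const c TYPE('d) * (1 / \<rho> ^ ?n)"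
    using \<eta> assms by (intro mult_left_mono heat_const_nonneg divide_right_mono power_le_one) auto
  finally show ?thesis by simp
qed

text \<open>As for \<open>heat_far\<close> with M = d; the additional 1/\<eta> of the gradient still
  leaves the nonnegative power (\<eta>/\<rho>)^(d-1). The margin 1 comes from the reflection in one
  dimension, and at t = 0 it keeps both ends of the edge off the origin.\<close>

lemma heat_diff_far:
  fixes z :: "'d::finite site"
  assumes "c > 0" "c * \<rho> \<ge> 8 * real CARD('d)" "far (c * \<rho> + 1) z" "0 \<le> t" "t \<le> \<rho>^2" "\<rho> > 0"
  shows "\<bar>heat t (z + axis i 1) - heat t z\<bar> \<le> heat_const c TYPE('d) / \<rho> ^ (CARD('d) + 1)"
proof (cases "t = 0")
  case True
  have c0: "c * \<rho> > 0" using assms by auto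
  obtain j where j: "\<bar>real_of_int (z $ j)\<bar> \<ge> c * \<rho> + 1" using assms by (auto simp: far_def)
  have "z + axis i 1 \<noteq> 0"
  proof
    assume "z + axis i 1 = 0"
    hence "z $ j + axis i 1 $ j = 0" by (metis vector_add_component zero_index)
    hence "\<bar>z $ j\<bar> \<le> 1" by (auto simp: axis_def split: if_splits)
    thus False using j c0 by linarith
  qed
  moreover have "z \<noteq> 0" using far_nonzero[OF assms(3)] c0 by simp
  ultimately show ?thesis using True assms heat_const_nonneg[OF assms(1), where 'd='d] by (simp add: heat_0)
next
  case False
  let ?n = "CARD('d)"
  define \<eta> where "\<eta> = sqrt t"
  have \<eta>: "0 < \<eta>" "\<eta> \<le> \<rho>" "t = \<eta>^2"
    using assms False by (auto simp: \<eta>_def real_le_lsqrt)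
  have "\<bar>heat t (z + axis i 1) - heat t z\<bar> \<le> (16 * real ?n) ^ ?n * 4 ^ ?n * (\<eta> / (c * \<rho>)) ^ (2 * ?n) / \<eta> ^ (?n + 1)"
    unfolding \<eta>(3) using assms by (intro heat_diff_tail_bound \<eta>) auto
  also have "\<dots> = (64 * real ?n) ^ ?n * ((\<eta> / (c * \<rho>)) ^ (?n - 1 + (?n + 1)) / \<eta> ^ (?n + 1))"
  proof -
    have "?n - 1 + (?n + 1) = 2 * ?n" using CARD_minus[where 'd='d] by linarith
    thus ?thesis by (simp only: power_64 times_divide_eq_right)
  qed
  also have "\<dots> = heat_const c TYPE('d) * ((\<eta> / \<rho>) ^ (?n - 1) / \<rho> ^ (?n + 1))"
  proof -
    have "?n - 1 + (?n + 1) = 2 * ?n" using CARD_minus[where 'd='d] by linarith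
    thus ?thesis using power_ratio_split[OF \<eta>(1) assms(1,6), of "?n - 1" "?n + 1"]
      unfolding heat_const_def by (simp only:) simp
  qed
  also have "\<dots> \<le> heat_const c TYPE('d) * (1 / \<rho> ^ (?n + 1))"
    using \<eta> assms by (intro mult_left_mono heat_const_nonneg divide_right_mono power_le_one) auto
  finally show ?thesis by simp
qed

lemma green_far:
  fixes z :: "'d::finite site"
  assumes "c > 0" "c * \<rho> \<ge> 8 * real CARD('d)" "far (c * \<rho>) z" "\<rho> > 0"
  shows "green \<rho> z \<le> real CARD('d) * (\<rho>^2 * (heat_const c TYPE('d) / \<rho> ^ CARD('d)))"
proof -
  have "integral {0..\<rho>^2} (\<lambda>t. heat t z) \<le> integral {0..\<rho>^2} (\<lambda>t. heat_const c TYPE('d) / \<rho> ^ CARD('d))"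
    using assms by (intro integral_le heat_integrable heat_far) auto
  thus ?thesis unfolding green_def by (intro mult_left_mono) auto
qed

lemma green_diff_far:
  fixes z :: "'d::finite site"
  assumes "c > 0" "c * \<rho> \<ge> 8 * real CARD('d)" "far (c * \<rho> + 1) z" "\<rho> > 0"
  shows "\<bar>green \<rho> (z + axis i 1) - green \<rho> z\<bar> \<le> real CARD('d) * (\<rho>^2 * (heat_const c TYPE('d) / \<rho> ^ (CARD('d) + 1)))"
proof -
  have I: "(\<lambda>t. heat t (z + axis i 1) - heat t z) integrable_on {0..\<rho>^2}"
    by (intro integrable_diff heat_integrable)
  have "norm (integral {0..\<rho>^2} (\<lambda>t. heat t (z + axis i 1) - heat t z))
      \<le> integral {0..\<rho>^2} (\<lambda>t. heat_const c TYPE('d) / \<rho> ^ (CARD('d) + 1))"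
    using heat_diff_far[OF assms(1-3)] assms(4)
    by (intro integral_norm_bound_integral[OF I integrable_const_ivl]) (simp del: power_Suc)
  hence "\<bar>integral {0..\<rho>^2} (\<lambda>t. heat t (z + axis i 1) - heat t z)\<bar>
      \<le> \<rho>^2 * (heat_const c TYPE('d) / \<rho> ^ (CARD('d) + 1))" by simp
  moreover have "green \<rho> (z + axis i 1) - green \<rho> z = real CARD('d) * integral {0..\<rho>^2} (\<lambda>t. heat t (z + axis i 1) - heat t z)"
    unfolding green_def by (subst integral_diff[OF heat_integrable heat_integrable]) (rule right_diff_distrib[symmetric])
  ultimately show ?thesis by (simp only: abs_mult abs_of_nat) (rule mult_left_mono, auto)
qed

section \<open>Radial potentials\<close>

text \<open>An antiderivative of \<open>- t\<close> to the power \<open>- p\<close>; for \<open>p = d / 2\<close> and \<open>t = |x|\<^sup>2\<close> it is the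
  fundamental solution of the Laplacian up to a factor.\<close>

definition pot :: "real \<Rightarrow> real \<Rightarrow> real" where
  "pot p t = (if p = 1 then - ln t else t powr (1 - p) / (p - 1))"

lemma DERIV_powr_const: "t > 0 \<Longrightarrow> ((\<lambda>t. c * t powr a) has_real_derivative c * a * t powr (a - 1)) (at (t::real))"
  by (auto intro!: derivative_eq_intros)

lemma DERIV_pot:
  assumes "t > 0" shows "(pot p has_real_derivative - (t powr - p)) (at t)"
proof (cases "p = 1")
  case True
  have "pot p = (\<lambda>t. - ln t)" by (auto simp: pot_def True fun_eq_iff)
  thus ?thesis using assms True
    by (auto intro!: derivative_eq_intros simp: powr_minus divide_inverse)
next
  case False
  have "pot p = (\<lambda>t. (1 / (p - 1)) * t powr (1 - p))" by (auto simp: pot_def False fun_eq_iff)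
  moreover have "1 / (p - 1) * (1 - p) = -1" using False by (simp add: field_simps)
  ultimately show ?thesis
    using DERIV_powr_const[OF assms, of "1 / (p - 1)" "1 - p"] by simp
qed

text \<open>The expansion goes to third order because for h of order sqrt t the cubic term has order
  t^(-p-1/2), too large for an error; its main part cancels only between opposite neighbours. The
  lower bound on t + h keeps the intermediate point above t/2, whence 2^(p+3).\<close>

lemma pot_taylor:
  assumes "p > 0" "t > 0" "t + h \<ge> t / 2"
  shows "\<bar>pot p (t + h) - (pot p t - t powr - p * h + p * t powr (- p - 1) * h^2 / 2 - p * (p + 1) * t powr (- p - 2) * h ^ 3 / 6)\<bar>
      \<le> p * (p + 1) * (p + 2) * 2 powr (p + 3) * t powr (- p - 3) * h ^ 4 / 24"
proof (cases "h = 0")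
  case True
  thus ?thesis using assms by simp
next
  case False
  define diff where "diff m = (case m of 0 \<Rightarrow> pot p | Suc 0 \<Rightarrow> (\<lambda>t. -1 * t powr - p) | Suc (Suc 0) \<Rightarrow> (\<lambda>t. p * t powr (- p - 1))
     | Suc (Suc (Suc 0)) \<Rightarrow> (\<lambda>t. - p * (p + 1) * t powr (- p - 2)) | _ \<Rightarrow> (\<lambda>t. p * (p + 1) * (p + 2) * t powr (- p - 3)))" for m :: nat
  have "\<exists>\<xi>. (if t + h < t then t + h < \<xi> \<and> \<xi> < t else t < \<xi> \<and> \<xi> < t + h) \<and>
    pot p (t + h) = (\<Sum>m<4. (diff m t / fact m) * (t + h - t)^m) + (diff 4 \<xi> / fact 4) * (t + h - t)^4"
  proof (rule Taylor[where a = "min t (t+h)" and b = "max t (t+h)"])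
    show "\<forall>m s. m < 4 \<and> min t (t + h) \<le> s \<and> s \<le> max t (t + h) \<longrightarrow> DERIV (diff m) s :> diff (Suc m) s"
    proof (intro allI impI)
      fix m :: nat and s assume m: "m < 4 \<and> min t (t + h) \<le> s \<and> s \<le> max t (t + h)"
      hence s: "s > 0" using assms by linarith
      from m consider "m = 0" | "m = 1" | "m = 2" | "m = 3" by linarith
      thus "DERIV (diff m) s :> diff (Suc m) s"
      proof cases
        case 1 thus ?thesis using DERIV_pot[OF s] by (simp add: diff_def)
      next
        case 2 thus ?thesis using DERIV_powr_const[OF s, of "-1" "-p"] by (simp add: diff_def)
      next
        case 3
        have e: "p * (- p - 1) = - p * (p + 1)" "- p - 1 - 1 = - p - 2" by algebra+
        show ?thesis using DERIV_powr_const[OF s, of p "-p-1", unfolded e] 3 by (simp add: diff_def numeral_eq_Suc)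
      next
        case 4
        have e: "- p * (p + 1) * (- p - 2) = p * (p + 1) * (p + 2)" "- p - 2 - 1 = - p - 3" by algebra+
        show ?thesis using DERIV_powr_const[OF s, of "-p*(p+1)" "-p-2", unfolded e] 4 by (simp add: diff_def numeral_eq_Suc)
      qed
    qed
  qed (use False in \<open>auto simp: diff_def\<close>)
  then obtain \<xi> where 1: "if t + h < t then t + h < \<xi> \<and> \<xi> < t else t < \<xi> \<and> \<xi> < t + h" and
    2: "pot p (t + h) = (\<Sum>m<4. (diff m t / fact m) * (t + h - t)^m) + (diff 4 \<xi> / fact 4) * (t + h - t)^4"
    by blast
  have \<xi>: "min t (t + h) \<le> \<xi>" using 1 by (auto split: if_splits)
  have eq: "pot p (t + h) = (\<Sum>m<4. (diff m t / fact m) * h^m) + (diff 4 \<xi> / fact 4) * h^4"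
    using 2 by simp
  have S: "(\<Sum>m<4. (diff m t / fact m) * h^m) = pot p t - t powr - p * h + p * t powr (- p - 1) * h^2 / 2 - p * (p + 1) * t powr (- p - 2) * h ^ 3 / 6"
    by (simp add: diff_def eval_nat_numeral)
  have \<xi>2: "\<xi> \<ge> t / 2" using \<xi> assms by linarith
  have "\<xi> powr (- p - 3) \<le> (t / 2) powr (- p - 3)"
    by (rule powr_mono2') (use \<xi>2 assms in auto)
  also have "\<dots> = 2 powr (p + 3) * t powr (- p - 3)"
  proof -
    have "(2::real) powr (- p - 3) = 1 / 2 powr (p + 3)"
      using powr_minus_divide[of "2::real" "p + 3"] by (simp add: algebra_simps)
    thus ?thesis using assms by (simp add: powr_divide)
  qed
  finally have B: "\<xi> powr (- p - 3) \<le> 2 powr (p + 3) * t powr (- p - 3)" .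
  have "\<bar>(diff 4 \<xi> / fact 4) * h^4\<bar> = p * (p + 1) * (p + 2) * \<xi> powr (- p - 3) * (h^4 / 24)"
    using assms by (simp add: diff_def numeral_eq_Suc abs_mult fact_numeral)
  also have "\<dots> \<le> p * (p + 1) * (p + 2) * (2 powr (p + 3) * t powr (- p - 3)) * (h^4 / 24)"
    using assms B by (intro mult_right_mono mult_left_mono) auto
  finally show ?thesis unfolding eq S by (simp add: mult.assoc)
qed


text \<open>The shift by 2 removes the singularity of the potentials and ensures
  \<open>sq (x \<plusminus> e\<^sub>i) \<ge> sq x / 2\<close>.\<close>

definition sq :: "'d::finite site \<Rightarrow> real" where
  "sq x = 2 + (\<Sum>i\<in>UNIV. (real_of_int (x $ i))^2)"

lemma sq_ge_2: "sq x \<ge> 2"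
  by (simp add: sq_def sum_nonneg)

lemma sq_pos [simp]: "sq x > 0"
  using sq_ge_2[of x] by linarith

lemma sq_enorm: "sq x = 2 + (enorm x)^2"
  by (simp add: sq_def enorm_def sum_nonneg)

lemma sq_plus: "sq (x + axis i 1) = sq x + (1 + 2 * real_of_int (x $ i))"
proof -
  have "(\<Sum>j\<in>UNIV. (real_of_int ((x + axis i 1) $ j))^2) = (\<Sum>j\<in>UNIV. (real_of_int (x $ j))^2 + (if j = i then 1 + 2 * real_of_int (x $ i) else 0))"
    by (intro sum.cong) (auto simp: axis_def power2_eq_square algebra_simps)
  thus ?thesis by (simp add: sq_def sum.distrib)
qed

lemma sq_minus: "sq (x - axis i 1) = sq x + (1 - 2 * real_of_int (x $ i))"
proof -
  have "(\<Sum>j\<in>UNIV. (real_of_int ((x - axis i 1) $ j))^2) = (\<Sum>j\<in>UNIV. (real_of_int (x $ j))^2 + (if j = i then 1 - 2 * real_of_int (x $ i) else 0))"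
    by (intro sum.cong) (auto simp: axis_def power2_eq_square algebra_simps)
  thus ?thesis by (simp add: sq_def sum.distrib)
qed

lemma coord_le_sq: "(real_of_int (x $ i))^2 \<le> sq x - 2"
  using member_le_sum[of i UNIV "\<lambda>i. (real_of_int (x $ i))^2"] by (simp add: sq_def)

lemma coord_le_sqrt: "\<bar>real_of_int (x $ i)\<bar> \<le> sqrt (sq x)"
  using coord_le_sq[of x i] by (intro real_le_rsqrt) auto

lemma sqrt_sq_neighbour:
  fixes x :: "'d::finite site"
  shows
  "sqrt (sq (x + axis i 1)) \<le> sqrt (sq x) + 1" "sqrt (sq (x - axis i 1)) \<le> sqrt (sq x) + 1"
  "sqrt (sq x) - 1 \<le> sqrt (sq (x + axis i 1))" "sqrt (sq x) - 1 \<le> sqrt (sq (x - axis i 1))"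
proof -
  have *: "sqrt (sq (x + axis i 1)) \<le> sqrt (sq x) + 1 \<and> sqrt (sq (x - axis i 1)) \<le> sqrt (sq x) + 1" for x :: "'d site"
  proof -
    have "(sqrt (sq x) + 1)^2 = sq x + 1 + 2 * sqrt (sq x)"
      using sq_ge_2[of x] by (simp add: power2_sum)
    thus ?thesis using coord_le_sqrt[of x i] sq_ge_2[of x]
      by (auto intro!: real_le_lsqrt simp: sq_plus sq_minus)
  qed
  show "sqrt (sq (x + axis i 1)) \<le> sqrt (sq x) + 1" "sqrt (sq (x - axis i 1)) \<le> sqrt (sq x) + 1"
    "sqrt (sq x) - 1 \<le> sqrt (sq (x + axis i 1))" "sqrt (sq x) - 1 \<le> sqrt (sq (x - axis i 1))"
    using *[of x] *[of "x + axis i 1"] *[of "x - axis i 1"] by auto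
qed

lemma finite_sq_less: "finite {x :: 'd::finite site. sq x < L}"
proof -
  define N where "N = \<lceil>L\<rceil>"
  have "{x :: 'd site. sq x < L} \<subseteq> {x. \<forall>i. x $ i \<in> {-N..N}}"
  proof safe
    fix x :: "'d site" and i assume x: "sq x < L"
    have "\<bar>real_of_int (x $ i)\<bar> \<le> (real_of_int (x $ i))^2"
      using self_le_power[of "\<bar>real_of_int (x $ i)\<bar>" 2] by (cases "x $ i = 0") (auto simp: abs_if)
    also have "\<dots> \<le> real_of_int N" using coord_le_sq[of x i] x unfolding N_def by linarith
    finally show "x $ i \<in> {-N..N}" by auto
  qed
  moreover have "finite {x :: 'd site. \<forall>i. x $ i \<in> {-N..N}}"
  proof (rule finite_imageD)
    have "vec_nth ` {x :: 'd site. \<forall>i. x $ i \<in> {-N..N}} \<subseteq> PiE UNIV (\<lambda>_. {-N..N})" by auto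
    thus "finite (vec_nth ` {x :: 'd site. \<forall>i. x $ i \<in> {-N..N}})"
      by (rule finite_subset) (auto intro!: finite_PiE)
  qed (auto simp: inj_on_def vec_nth_inject)
  ultimately show ?thesis by (rule finite_subset)
qed

text \<open>Here a is a coordinate of x and t = \<open>sq x\<close>, so t + 1 + 2a and t + 1 - 2a
  are the values of \<open>sq\<close> at two opposite neighbours. Odd powers of a cancel in the
  sum.\<close>

lemma pot_taylor_pair:
  assumes p: "p > 0" and t: "a^2 + 2 \<le> t"
  shows "\<bar>(pot p (t + (1 + 2 * a)) + pot p (t + (1 - 2 * a)) - 2 * pot p t)
      - (- 2 * t powr - p + p * t powr (- p - 1) * (1 + 4 * a^2) - p * (p + 1) * t powr (- p - 2) * (1 + 12 * a^2) / 3)\<bar>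
      \<le> p * (p + 1) * (p + 2) * 2 powr (p + 3) * t powr (- p - 3) * (2 + 48 * a^2 + 32 * a ^ 4) / 24"
proof -
  have t0: "t > 0" using t by (smt (verit) zero_le_power2)
  \<comment> \<open>t + 2 + 4a and t + 2 - 4a are at least (a + 2)^2 and (a - 2)^2, thanks to the 2
    in \<open>sq\<close>.\<close>
  have "0 \<le> (a - 2)^2" "0 \<le> (a + 2)^2" by auto
  hence h: "t + (1 + 2 * a) \<ge> t / 2" "t + (1 - 2 * a) \<ge> t / 2"
    using t by (auto simp: power2_eq_square algebra_simps)
  define D where "D = p * (p + 1) * (p + 2) * 2 powr (p + 3) * t powr (- p - 3)"
  define u v w where "u = t powr - p" and "v = p * t powr (- p - 1)" and "w = p * (p + 1) * t powr (- p - 2)"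
  have 1: "\<bar>pot p (t + (1 + 2 * a)) - (pot p t - u * (1 + 2 * a) + v * (1 + 2 * a)^2 / 2 - w * (1 + 2 * a) ^ 3 / 6)\<bar> \<le> D * (1 + 2 * a) ^ 4 / 24"
    using pot_taylor[OF p t0 h(1)] by (simp only: D_def u_def v_def w_def)
  have 2: "\<bar>pot p (t + (1 - 2 * a)) - (pot p t - u * (1 - 2 * a) + v * (1 - 2 * a)^2 / 2 - w * (1 - 2 * a) ^ 3 / 6)\<bar> \<le> D * (1 - 2 * a) ^ 4 / 24"
    using pot_taylor[OF p t0 h(2)] by (simp only: D_def u_def v_def w_def)
  have 3: "D * (1 + 2 * a) ^ 4 / 24 + D * (1 - 2 * a) ^ 4 / 24 = D * (2 + 48 * a^2 + 32 * a ^ 4) / 24"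
    by (simp add: field_simps) algebra
  have 4: "(pot p t - u * (1 + 2 * a) + v * (1 + 2 * a)^2 / 2 - w * (1 + 2 * a) ^ 3 / 6) + (pot p t - u * (1 - 2 * a) + v * (1 - 2 * a)^2 / 2 - w * (1 - 2 * a) ^ 3 / 6)
     = 2 * pot p t + (- 2 * u + v * (1 + 4 * a^2) - w * (1 + 12 * a^2) / 3)"
    by (simp add: field_simps) algebra
  have tri: "\<bar>(A + B - 2 * P) - F\<bar> \<le> d" if "\<bar>A - X\<bar> \<le> d1" "\<bar>B - Y\<bar> \<le> d2" "d1 + d2 = d" "X + Y = 2 * P + F"
    for A B P F X Y d d1 d2 :: real
    using that by linarith
  note tri[OF 1 2 3 4]
  thus ?thesis by (simp only: D_def u_def v_def w_def)
qed

section \<open>Lattice points in balls\<close>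

definition corner :: "'d::finite site \<Rightarrow> real ^ 'd" where
  "corner x = (\<chi> i. real_of_int (x $ i))"

lemma norm_corner: "norm (corner x) = enorm x"
  by (simp add: corner_def enorm_def norm_vec_def L2_set_def)

definition cell :: "'d::finite site \<Rightarrow> (real ^ 'd) set" where
  "cell x = {y. \<forall>i. real_of_int (x $ i) < y $ i \<and> y $ i < real_of_int (x $ i) + 1}"

lemma cell_box: "cell x = box (corner x) (corner x + 1)"
  by (auto simp: cell_def corner_def mem_box_cart)

lemma one_inner_Basis: "b \<in> Basis \<Longrightarrow> (1 :: real ^ 'd::finite) \<bullet> b = 1"
  by (auto simp: Basis_vec_def inner_axis)

lemma measure_cell: "emeasure lborel (cell x) = 1"
  unfolding cell_box
  by (subst emeasure_lborel_box_eq) (auto simp: one_inner_Basis inner_add_left)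

lemma norm_cell_le:
  fixes x :: "'d::finite site"
  assumes "\<And>i. 0 \<le> v $ i \<and> v $ i \<le> 1"
  shows "norm (v :: real ^ 'd) \<le> real CARD('d)"
proof -
  have "norm v \<le> (\<Sum>i\<in>UNIV. \<bar>v $ i\<bar>)" by (rule norm_le_l1_cart)
  also have "\<dots> \<le> (\<Sum>i\<in>(UNIV::'d set). 1)" using assms by (intro sum_mono) (simp add: abs_of_nonneg)
  finally show ?thesis by simp
qed

lemma omega_ball:
  assumes "r \<ge> 0"
  shows "measure lborel (ball (0 :: real ^ 'd::finite) r) = omega TYPE('d) * r ^ CARD('d)"
  using content_ball_conv_unit_ball[OF assms, of "0 :: real ^ 'd"] by (simp add: omega_def)

lemma omega_pos: "omega TYPE('d::finite) > 0"
  unfolding omega_def using content_ball_pos[of 1 "0 :: real ^ 'd"] by simp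

text \<open>Packing: the open unit cubes at the sites of F are disjoint and lie in a ball enlarged
  by d, a crude bound for their diameter; the further 1 makes the inequality strict, as the open
  ball demands.\<close>

lemma card_le_volume:
  fixes F :: "'d::finite site set"
  assumes "finite F" "\<And>x. x \<in> F \<Longrightarrow> enorm x \<le> R" "R \<ge> 0"
  shows "real (card F) \<le> omega TYPE('d) * (R + real CARD('d) + 1) ^ CARD('d)"
proof -
  let ?B = "ball (0 :: real ^ 'd) (R + real CARD('d) + 1)"
  have disj: "disjoint_family_on cell F"
  proof (unfold disjoint_family_on_def, safe)
    fix x y :: "'d site" and z assume "x \<noteq> y" "z \<in> cell x" "z \<in> cell y"
    moreover have "x $ i = y $ i" if "z \<in> cell x" "z \<in> cell y" for i
      using that[unfolded cell_def mem_Collect_eq, THEN spec[of _ i]] by linarith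
    ultimately show "z \<in> {}" by (auto simp: vec_eq_iff)
  qed
  have sub: "(\<Union>x\<in>F. cell x) \<subseteq> ?B"
  proof safe
    fix x z assume x: "x \<in> F" "z \<in> cell x"
    have "norm (z - corner x) \<le> real CARD('d)"
    proof (rule norm_cell_le)
      fix i
      have "real_of_int (x $ i) < z $ i \<and> z $ i < real_of_int (x $ i) + 1" using x(2) by (simp add: cell_def)
      thus "0 \<le> (z - corner x) $ i \<and> (z - corner x) $ i \<le> 1" unfolding corner_def by simp
    qed
    moreover have "norm z \<le> norm (corner x) + norm (z - corner x)"
      by (metis add.commute diff_add_cancel norm_triangle_ineq)
    ultimately have "norm z < R + real CARD('d) + 1" using assms(2)[OF x(1)] by (simp add: norm_corner)
    thus "z \<in> ?B" by simp
  qed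
  have "ennreal (real (card F)) = (\<Sum>x\<in>F. emeasure lborel (cell x))"
    by (simp add: measure_cell ennreal_of_nat_eq_real_of_nat)
  also have "\<dots> = emeasure lborel (\<Union>x\<in>F. cell x)"
  proof (rule sum_emeasure)
    show "cell ` F \<subseteq> sets lborel" by (auto simp: cell_box)
  qed (use assms disj in auto)
  also have "\<dots> \<le> emeasure lborel ?B" by (rule emeasure_mono[OF sub]) auto
  also have "\<dots> = ennreal (measure lborel ?B)"
    by (rule emeasure_eq_ennreal_measure) (metis emeasure_lborel_ball_finite less_irrefl infinity_ennreal_def)
  also have "measure lborel ?B = omega TYPE('d) * (R + real CARD('d) + 1) ^ CARD('d)"
    by (rule omega_ball) (use assms in auto)
  finally show ?thesis
    using omega_pos[where 'd='d] assms by (subst (asm) ennreal_le_iff) auto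
qed

text \<open>Covering: each point of the smaller ball lies in the closed unit cube at its
  coordinatewise floor, and that site belongs to F.\<close>

lemma card_ge_volume:
  fixes F :: "'d::finite site set"
  assumes "finite F" "\<And>x. enorm x < R \<Longrightarrow> x \<in> F" "R \<ge> real CARD('d)"
  shows "omega TYPE('d) * (R - real CARD('d)) ^ CARD('d) \<le> real (card F)"
proof -
  let ?B = "ball (0 :: real ^ 'd) (R - real CARD('d))"
  let ?C = "\<lambda>x::'d site. cbox (corner x) (corner x + 1)"
  have sub: "?B \<subseteq> (\<Union>x\<in>F. ?C x)"
  proof
    fix z assume z: "z \<in> ?B"
    define x :: "'d site" where "x = (\<chi> i. \<lfloor>z $ i\<rfloor>)"
    have zx: "z \<in> ?C x" by (auto simp: x_def corner_def mem_box_cart)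
    have "norm (z - corner x) \<le> real CARD('d)"
      by (rule norm_cell_le) (auto simp: x_def corner_def, linarith)
    moreover have "norm (corner x) \<le> norm z + norm (z - corner x)"
      using norm_triangle_ineq4[of z "z - corner x"] by simp
    ultimately have "enorm x < R" using z by (simp add: norm_corner)
    thus "z \<in> (\<Union>x\<in>F. ?C x)" using assms(2) zx by blast
  qed
  have C: "emeasure lborel (?C x) = 1" for x
    by (subst emeasure_lborel_cbox_eq) (auto simp: one_inner_Basis inner_add_left)
  have "ennreal (measure lborel ?B) = emeasure lborel ?B"
    by (rule emeasure_eq_ennreal_measure[symmetric]) (metis emeasure_lborel_ball_finite less_irrefl infinity_ennreal_def)
  also have "\<dots> \<le> emeasure lborel (\<Union>x\<in>F. ?C x)"
    by (rule emeasure_mono[OF sub]) (use assms in auto)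
  also have "\<dots> \<le> (\<Sum>x\<in>F. emeasure lborel (?C x))"
    by (rule emeasure_subadditive_finite) (use assms in auto)
  also have "\<dots> = ennreal (real (card F))" by (simp add: C ennreal_of_nat_eq_real_of_nat)
  finally have "measure lborel ?B \<le> real (card F)" by (subst (asm) ennreal_le_iff) auto
  moreover have "measure lborel ?B = omega TYPE('d) * (R - real CARD('d)) ^ CARD('d)"
    by (rule omega_ball) (use assms in auto)
  ultimately show ?thesis by simp
qed

section \<open>The discrete Laplacian of radial potentials\<close>

lemma lap_sq: "lap sq x = 1"
  by (simp add: lap_def sq_plus sq_minus)

text \<open>Adding the expansions over all directions, with the squared coordinates summing to t -
  2, gives the continuum value (4p - 2d) t^(-p) up to a term with one more power of 1/t. The
  coefficient vanishes at p = d/2 and equals 2 at p = (d + 1)/2, the two cases used.\<close>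

lemma lap_pot_estimate:
  assumes "p > 0"
  obtains C where "C > 0" "\<And>x :: 'd::finite site.
    \<bar>2 * real CARD('d) * lap (\<lambda>x. pot p (sq x)) x - (4 * p - 2 * real CARD('d)) * sq x powr - p\<bar> \<le> C * sq x powr (- p - 1)"
proof -
  let ?d = "real CARD('d)"
  define D where "D = p * (p + 1) * (p + 2) * 2 powr (p + 3)"
  have D: "D > 0" using assms by (simp add: D_def)
  define C where "C = p * (?d + 8) + 4 * p * (p + 1) + p * (p + 1) * (?d + 8) + D * (2 * ?d + 80)"
  have "\<bar>2 * ?d * lap (\<lambda>x. pot p (sq x)) x - (4 * p - 2 * ?d) * sq x powr - p\<bar> \<le> C * sq x powr (- p - 1)" for x :: "'d site"
  proof -
    define t where "t = sq x"
    define u where "u = t powr (- p - 1)"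
    have t: "t \<ge> 2" using sq_ge_2 by (simp add: t_def)
    have u0: "u \<ge> 0" by (simp add: u_def)
    define a where "a i = real_of_int (x $ i)" for i
    have a2: "(\<Sum>i\<in>UNIV. (a i)^2) = t - 2" by (simp add: a_def t_def sq_def)
    have a2i: "(a i)^2 + 2 \<le> t" for i using coord_le_sq[of x i] by (simp add: a_def t_def)
    define M where "M i = - 2 * t powr - p + p * u * (1 + 4 * (a i)^2) - p * (p + 1) * t powr (- p - 2) * (1 + 12 * (a i)^2) / 3" for i
    define R where "R i = D * t powr (- p - 3) * (2 + 48 * (a i)^2 + 32 * (a i) ^ 4) / 24" for i
    have P1: "t powr (- p) = u * t" using t by (simp add: u_def powr_diff powr_minus field_simps)
    have P2: "t powr (- p - 2) = u / t" using t by (simp add: u_def powr_diff powr_minus powr_numeral field_simps power2_eq_square)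
    have P3: "t powr (- p - 3) = u / t^2" using t by (simp add: u_def powr_diff powr_minus powr_numeral field_simps power2_eq_square power3_eq_cube)
    have L: "2 * ?d * lap (\<lambda>x. pot p (sq x)) x = (\<Sum>i\<in>UNIV. pot p (t + (1 + 2 * a i)) + pot p (t + (1 - 2 * a i)) - 2 * pot p t)"
      by (simp add: lap_def sq_plus sq_minus t_def a_def)
    have "\<bar>(\<Sum>i\<in>UNIV. pot p (t + (1 + 2 * a i)) + pot p (t + (1 - 2 * a i)) - 2 * pot p t) - (\<Sum>i\<in>UNIV. M i)\<bar> \<le> (\<Sum>i\<in>UNIV. R i)"
      unfolding sum_subtractf[symmetric]
      by (rule order_trans[OF sum_abs], intro sum_mono)
         (use pot_taylor_pair[OF assms a2i] in \<open>simp only: M_def R_def D_def u_def\<close>)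
    moreover have "(\<Sum>i\<in>UNIV. R i) \<le> D * (2 * ?d + 80) * u"
    proof -
      \<comment> \<open>Fourth powers are bounded by t times squares, so that only the known sum of
        squares enters.\<close>
      have "(\<Sum>i\<in>UNIV. 2 + 48 * (a i)^2 + 32 * (a i) ^ 4) \<le> (\<Sum>i\<in>UNIV. 2 + (48 + 32 * t) * (a i)^2)"
      proof (intro sum_mono)
        fix i
        have "(a i)^2 * (a i)^2 \<le> t * (a i)^2" using a2i[of i] by (intro mult_right_mono) auto
        thus "2 + 48 * (a i)^2 + 32 * (a i) ^ 4 \<le> 2 + (48 + 32 * t) * (a i)^2"
          by (simp add: algebra_simps flip: power_add)
      qed
      also have "\<dots> = 2 * ?d + (48 + 32 * t) * (t - 2)"
        by (simp add: sum.distrib a2 flip: sum_distrib_left)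
      also have "\<dots> \<le> (2 * ?d + 80) * t^2"
      proof -
        have "2 * ?d * 1 \<le> 2 * ?d * t^2" using t by (intro mult_left_mono) (auto simp: one_le_power)
        moreover have "(48 + 32 * t) * (t - 2) = 32 * t^2 - 16 * t - 96" by (simp add: algebra_simps power2_eq_square)
        moreover have "(2 * ?d + 80) * t^2 = 2 * ?d * t^2 + 80 * t^2" by (rule distrib_right)
        moreover have "t^2 \<ge> 0" by simp
        ultimately show ?thesis using t by linarith
      qed
      finally have "D * (u / t^2) / 24 * (\<Sum>i\<in>UNIV. 2 + 48 * (a i)^2 + 32 * (a i) ^ 4) \<le> D * (u / t^2) / 24 * ((2 * ?d + 80) * t^2)"
        using D u0 by (intro mult_left_mono) auto
      also have "\<dots> = D * (2 * ?d + 80) * u / 24" using t by simp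
      also have "\<dots> \<le> D * (2 * ?d + 80) * u" using D u0 by simp
      finally show ?thesis unfolding R_def P3 by (simp add: sum_distrib_left)
    qed
    moreover have "(\<Sum>i\<in>UNIV. M i) - (4 * p - 2 * ?d) * t powr - p
        = p * (?d - 8) * u - 4 * p * (p + 1) * u - p * (p + 1) * (?d / 3 - 8) * (u / t)"
    proof -
      have "(\<Sum>i\<in>UNIV. M i) = - 2 * ?d * t powr - p + p * u * (?d + 4 * (t - 2)) - p * (p + 1) * t powr (- p - 2) * (?d + 12 * (t - 2)) / 3"
        unfolding M_def by (simp add: sum.distrib sum_subtractf a2 flip: sum_distrib_left sum_divide_distrib)
      thus ?thesis unfolding P1 P2 using t by (simp add: field_simps)
    qed
    moreover have "\<bar>p * (?d - 8) * u - 4 * p * (p + 1) * u - p * (p + 1) * (?d / 3 - 8) * (u / t)\<bar>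
        \<le> p * (?d + 8) * u + 4 * p * (p + 1) * u + p * (p + 1) * (?d + 8) * u"
    proof -
      have "\<bar>p * (?d - 8) * u\<bar> \<le> p * (?d + 8) * u" using assms u0 by (auto simp: abs_mult intro!: mult_mono)
      moreover have "\<bar>4 * p * (p + 1) * u\<bar> \<le> 4 * p * (p + 1) * u" using assms u0 by simp
      moreover have "\<bar>p * (p + 1) * (?d / 3 - 8) * (u / t)\<bar> \<le> p * (p + 1) * (?d + 8) * u"
      proof -
        have "u / t \<le> u / 1" using u0 t by (intro divide_left_mono) auto
        moreover have "\<bar>?d / 3 - 8\<bar> \<le> ?d + 8" by simp
        ultimately have "p * (p + 1) * \<bar>?d / 3 - 8\<bar> * (u / t) \<le> p * (p + 1) * (?d + 8) * u"
          using assms u0 t by (intro mult_mono) auto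
        thus ?thesis using assms u0 t by (simp add: abs_mult)
      qed
      ultimately show ?thesis by linarith
    qed
    ultimately have "\<bar>2 * ?d * lap (\<lambda>x. pot p (sq x)) x - (4 * p - 2 * ?d) * t powr - p\<bar>
       \<le> D * (2 * ?d + 80) * u + (p * (?d + 8) * u + 4 * p * (p + 1) * u + p * (p + 1) * (?d + 8) * u)"
      unfolding L by linarith
    also have "\<dots> = C * u" by (simp add: C_def algebra_simps)
    finally show ?thesis by (simp add: t_def u_def)
  qed
  moreover have "C > 0" using assms D by (simp add: C_def add_pos_pos add_nonneg_pos)
  ultimately show ?thesis by (rule that[rotated])
qed

lemma pot_antimono:
  assumes "0 < s" "s \<le> t" shows "pot p t \<le> pot p s"
proof (rule DERIV_nonpos_imp_nonincreasing[OF assms(2)])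
  fix x assume "s \<le> x" "x \<le> t"
  thus "\<exists>y. (pot p has_real_derivative y) (at x) \<and> y \<le> 0"
    using assms by (intro exI[of _ "- (x powr - p)"] conjI DERIV_pot) auto
qed

text \<open>T^(-p) is the rate of decrease of the potential at T, the smallest on the interval up to
  T; so this is the largest linear term that keeps the sum decreasing there. Read the other way, it
  bounds the decrease of the potential from below.\<close>

lemma pot_plus_linear_antimono:
  assumes "0 < s" "s \<le> t" "t \<le> T" "p \<ge> 0"
  shows "pot p t + T powr - p * t \<le> pot p s + T powr - p * s"
proof (rule DERIV_nonpos_imp_nonincreasing[OF assms(2)])
  fix x assume x: "s \<le> x" "x \<le> t"
  have "T powr - p \<le> x powr - p" using assms x by (intro powr_mono2') auto
  moreover have "((\<lambda>t. pot p t + T powr - p * t) has_real_derivative - (x powr - p) + T powr - p * 1) (at x)"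
    using assms x by (intro DERIV_add DERIV_pot DERIV_cmult DERIV_ident) auto
  ultimately show "\<exists>y. ((\<lambda>t. pot p t + T powr - p * t) has_real_derivative y) (at x) \<and> y \<le> 0"
    by (intro exI[of _ "- (x powr - p) + T powr - p * 1"]) auto
qed

lemma powr_neg_le_1: "t \<ge> 1 \<Longrightarrow> p \<ge> 0 \<Longrightarrow> t powr - p \<le> (1::real)"
  by (simp add: powr_minus inverse_le_1_iff ge_one_powr_ge_zero)

text \<open>For \<open>p = (d + 1) / 2\<close> the potential is decreasing, so its Laplacian has nonpositive sum over every
  ball; but away from the origin that Laplacian is at least a multiple of the summand.\<close>

lemma sum_sq_powr_bounded:
  obtains C where "C > 0" "\<And>L. (\<Sum>x\<in>{x :: 'd::finite site. sq x < L}. sq x powr - ((real CARD('d) + 1) / 2)) \<le> C"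
proof -
  let ?d = "real CARD('d)"
  define p where "p = (?d + 1) / 2"
  have p: "p > 0" by (simp add: p_def add_nonneg_pos)
  obtain C where C: "C > 0" "\<And>x :: 'd site. \<bar>2 * ?d * lap (\<lambda>x. pot p (sq x)) x - (4 * p - 2 * ?d) * sq x powr - p\<bar> \<le> C * sq x powr (- p - 1)"
    by (rule lap_pot_estimate[OF p, where 'd='d]) blast
  \<comment> \<open>Outside B the error is at most one of the two copies of
    \<open>sq x powr - p\<close>, and the other survives; the finitely many sites of B are paid for
    by C + 1 each.\<close>
  define B where "B = {x :: 'd site. sq x < C}"
  have finB: "finite B" by (simp add: B_def finite_sq_less)
  have pt: "sq x powr - p \<le> 2 * ?d * lap (\<lambda>x. pot p (sq x)) x + (if x \<in> B then C + 1 else 0)" for x :: "'d site"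
  proof -
    have sq1: "sq x \<ge> 1" using sq_ge_2[of x] by simp
    have e: "sq x powr (- p - 1) = sq x powr - p / sq x"
      using sq1 by (simp add: powr_diff)
    have "4 * p - 2 * ?d = 2" by (simp add: p_def field_simps)
    hence lo: "2 * ?d * lap (\<lambda>x. pot p (sq x)) x \<ge> 2 * sq x powr - p - C * (sq x powr - p / sq x)"
      using C(2)[of x] e by simp
    show ?thesis
    proof (cases "x \<in> B")
      case True
      have "C * (sq x powr - p / sq x) \<le> C * (1 / 1)"
        using C(1) sq1 powr_neg_le_1[OF sq1, of p] p by (intro mult_left_mono frac_le) auto
      moreover have "sq x powr - p \<ge> 0" by simp
      moreover have "(if x \<in> B then C + 1 else 0) = C + 1" using True by simp
      ultimately show ?thesis using lo by linarith
    next
      case False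
      hence "sq x powr - p * (C / sq x) \<le> sq x powr - p * 1"
        using sq1 by (intro mult_left_mono) (auto simp: B_def)
      hence "C * (sq x powr - p / sq x) \<le> sq x powr - p" by (simp add: mult.commute)
      thus ?thesis using lo False by simp
    qed
  qed
  have "(\<Sum>x\<in>{x :: 'd site. sq x < L}. sq x powr - p) \<le> real (card B) * (C + 1) + 1" for L
  proof -
    let ?Q = "{x :: 'd site. sq x < L}"
    have "(\<Sum>x\<in>?Q. sq x powr - p) \<le> (\<Sum>x\<in>?Q. 2 * ?d * lap (\<lambda>x. pot p (sq x)) x + (if x \<in> B then C + 1 else 0))"
      by (intro sum_mono pt)
    also have "\<dots> = (\<Sum>x\<in>?Q. 2 * ?d * lap (\<lambda>x. pot p (sq x)) x) + (\<Sum>x\<in>?Q. if x \<in> B then C + 1 else 0)"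
      by (rule sum.distrib)
    also have "(\<Sum>x\<in>?Q. 2 * ?d * lap (\<lambda>x. pot p (sq x)) x) = 2 * ?d * (\<Sum>x\<in>?Q. lap (\<lambda>x. pot p (sq x)) x)"
      by (rule sum_distrib_left[symmetric])
    also have "(\<Sum>x\<in>?Q. if x \<in> B then C + 1 else 0) = (\<Sum>x\<in>?Q \<inter> B. C + 1)"
      by (rule sum.inter_restrict[OF finite_sq_less, symmetric])
    also have "(\<Sum>x\<in>?Q. lap (\<lambda>x. pot p (sq x)) x) \<le> 0"
      by (rule sum_lap_le_0) (auto simp: finite_sq_less intro!: pot_antimono)
    also have "(\<Sum>x\<in>?Q \<inter> B. C + 1) \<le> (\<Sum>x\<in>B. C + 1)"
      using C(1) finB by (intro sum_mono2) auto
    finally show ?thesis by simp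
  qed
  moreover have "real (card B) * (C + 1) + 1 > 0" using C(1) by (intro add_nonneg_pos) auto
  ultimately show ?thesis unfolding p_def by (rule that[rotated])
qed

section \<open>The harmonic exponent and the mass at the origin\<close>

definition Pot :: "'d::finite site \<Rightarrow> real" where
  "Pot x = pot (real CARD('d) / 2) (sq x)"

text \<open>At p = d/2 the leading coefficient vanishes and only the error, of order |x|^(-d-2),
  remains.\<close>

lemma lap_Pot_bound:
  obtains C where "C > 0" "\<And>x :: 'd::finite site. \<bar>lap Pot x\<bar> \<le> C * sq x powr (- (real CARD('d) / 2) - 1)"
proof -
  let ?d = "real CARD('d)"
  have d: "?d \<ge> 1" by (simp add: Suc_le_eq)
  obtain C where C: "C > 0" "\<And>x :: 'd site. \<bar>2 * ?d * lap (\<lambda>x. pot (?d / 2) (sq x)) x - (4 * (?d / 2) - 2 * ?d) * sq x powr - (?d / 2)\<bar> \<le> C * sq x powr (- (?d / 2) - 1)"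
  proof (rule lap_pot_estimate[where 'd='d])
    show "?d / 2 > 0" using d by simp
  qed blast
  have "\<bar>lap Pot x\<bar> \<le> C * sq x powr (- (?d / 2) - 1)" for x :: "'d site"
  proof -
    have "1 * \<bar>lap Pot x\<bar> \<le> (2 * ?d) * \<bar>lap Pot x\<bar>" using d by (intro mult_right_mono) linarith+
    thus ?thesis using C(2)[of x] by (simp add: Pot_def[abs_def] abs_mult)
  qed
  with C(1) show ?thesis by (rule that)
qed

text \<open>The cut-off \<open>L\<close> avoids infinite sums; nothing but bounds uniform in \<open>L\<close> is needed.\<close>

definition capacity :: "real \<Rightarrow> 'd::finite itself \<Rightarrow> real" where
  "capacity L _ = - (\<Sum>x\<in>{x :: 'd site. sq x < L}. lap Pot x)"

text \<open>The exponent d/2 + 1 is at least (d + 1)/2, so the bounded sums apply. With the lower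
  bound below it makes \<rho> comparable to m^(1/d) although the capacity is unknown.\<close>

lemma capacity_upper:
  obtains K where "K > 0" "\<And>L. capacity L TYPE('d::finite) \<le> K"
proof -
  let ?d = "real CARD('d)"
  obtain C where C: "C > 0" "\<And>x :: 'd site. \<bar>lap Pot x\<bar> \<le> C * sq x powr (- (?d / 2) - 1)"
    by (rule lap_Pot_bound[where 'd='d]) blast
  obtain B where B: "B > 0" "\<And>L. (\<Sum>x\<in>{x :: 'd::finite site. sq x < L}. sq x powr - ((?d + 1) / 2)) \<le> B"
    by (rule sum_sq_powr_bounded[where 'd='d]) blast
  have "capacity L TYPE('d) \<le> C * B" for L
  proof -
    have "capacity L TYPE('d) \<le> (\<Sum>x\<in>{x :: 'd site. sq x < L}. C * sq x powr - ((?d + 1) / 2))"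
      unfolding capacity_def sum_negf[symmetric]
    proof (intro sum_mono)
      fix x :: "'d site"
      have "sq x powr (- (?d / 2) - 1) \<le> sq x powr - ((?d + 1) / 2)"
        using sq_ge_2[of x] by (intro powr_mono) (auto simp: field_simps)
      hence "C * sq x powr (- (?d / 2) - 1) \<le> C * sq x powr - ((?d + 1) / 2)"
        using C(1) by (intro mult_left_mono) auto
      thus "- lap Pot x \<le> C * sq x powr - ((?d + 1) / 2)" using C(2)[of x] by linarith
    qed
    also have "\<dots> \<le> C * B" unfolding sum_distrib_left[symmetric] using C(1) B(2) by (intro mult_left_mono) auto
    finally show ?thesis .
  qed
  moreover have "C * B > 0" using C(1) B(1) by simp
  ultimately show ?thesis by (rule that[rotated])
qed

text \<open>Adding the right multiple of \<open>sq\<close>, whose Laplacian is 1, to the potential keeps it decreasing across the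
  boundary of the ball; so the capacity is at least this multiple of the number of sites.\<close>

lemma capacity_lower:
  assumes "L \<ge> (4 * (real CARD('d::finite) + 1))^2"
  shows "omega TYPE('d) / 4 ^ CARD('d) \<le> capacity L TYPE('d)"
proof -
  let ?d = "real CARD('d)"
  let ?Q = "{x :: 'd site. sq x < L}"
  \<comment> \<open>Neighbours of sites with \<open>sq\<close> below L have \<open>sq\<close> at
    most (S + 1)^2 \<le> 4L, so the slope belonging to T keeps g decreasing along every edge that
    leaves the ball.\<close>
  define T where "T = 4 * L"
  define g where "g x = Pot x + T powr - (?d / 2) * sq x" for x :: "'d site"
  have "4 * (?d + 1) \<ge> 4" by simp
  hence "(4 * (?d + 1))^2 \<ge> 4^2" by (intro power_mono) auto
  hence L: "L \<ge> 16" using assms by simp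
  define S where "S = sqrt L"
  have S: "S \<ge> 4 * (?d + 1)" "S^2 = L" "S \<ge> 0" using assms L by (auto simp: S_def intro: real_le_rsqrt)
  have S1: "S \<ge> 1" using S(1) \<open>4 * (?d + 1) \<ge> 4\<close> by linarith
  have nb: "sq y \<le> T" if "sqrt (sq y) \<le> sqrt (sq x) + 1" "sq x < L" for x y :: "'d site"
  proof -
    have "sqrt (sq y) \<le> S + S"
      using that(1) real_sqrt_less_mono[OF that(2)] S1 unfolding S_def[symmetric] by linarith
    hence "(sqrt (sq y))^2 \<le> (S + S)^2" using sq_ge_2[of y] by (intro power_mono) auto
    thus ?thesis using S(2) sq_ge_2[of y] by (simp add: T_def power2_eq_square algebra_simps)
  qed
  have "(\<Sum>x\<in>?Q. lap g x) \<le> 0"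
    unfolding g_def Pot_def
    by (rule sum_lap_le_0) (auto simp: finite_sq_less intro!: pot_plus_linear_antimono nb sqrt_sq_neighbour)
  moreover have "lap g x = lap Pot x + T powr - (?d / 2)" for x
    unfolding g_def by (simp add: lap_add lap_cmult lap_sq)
  ultimately have 1: "real (card ?Q) * T powr - (?d / 2) \<le> capacity L TYPE('d)"
    by (simp add: sum.distrib capacity_def)
  have T: "T powr - (?d / 2) = 1 / (2 * S) ^ CARD('d)"
  proof -
    have "T = (2 * S)^2" using S by (simp add: T_def power2_eq_square)
    moreover have "2 * S > 0" using S by (smt (verit) of_nat_0_le_iff)
    ultimately have "T powr (?d / 2) = ((2 * S) powr 2) powr (?d / 2)"
      by (simp only: powr_numeral)
    also have "\<dots> = (2 * S) powr ?d" by (simp only: powr_powr) simp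
    also have "\<dots> = (2 * S) ^ CARD('d)" using \<open>2 * S > 0\<close> by (simp add: powr_realpow)
    finally show ?thesis by (simp add: powr_minus_divide)
  qed
  have "omega TYPE('d) * (S - 1 - ?d) ^ CARD('d) \<le> real (card ?Q)"
  proof (rule card_ge_volume[OF finite_sq_less])
    fix x :: "'d site" assume x: "enorm x < S - 1"
    have "0 \<le> enorm x" by (simp add: enorm_def sum_nonneg)
    hence "(enorm x)^2 \<le> (S - 1)^2" using x by (intro power_mono) auto
    also have "\<dots> < L - 2" using S by (simp add: power2_eq_square algebra_simps)
    finally show "x \<in> ?Q" by (simp add: sq_enorm)
  qed (use S in auto)
  moreover have "(S / 2) ^ CARD('d) \<le> (S - 1 - ?d) ^ CARD('d)"
    using S by (intro power_mono) auto
  ultimately have "omega TYPE('d) * (S / 2) ^ CARD('d) \<le> real (card ?Q)"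
    using mult_left_mono[of "(S / 2) ^ CARD('d)" "(S - 1 - ?d) ^ CARD('d)" "omega TYPE('d)"] omega_pos[where 'd='d] by linarith
  hence "omega TYPE('d) * (S / 2) ^ CARD('d) * T powr - (?d / 2) \<le> real (card ?Q) * T powr - (?d / 2)"
    by (intro mult_right_mono) auto
  moreover have "omega TYPE('d) * (S / 2) ^ CARD('d) * T powr - (?d / 2) = omega TYPE('d) / 4 ^ CARD('d)"
  proof -
    have "S > 0" using S by (smt (verit) of_nat_0_le_iff)
    moreover have "(4::real) ^ CARD('d) = 2 ^ CARD('d) * 2 ^ CARD('d)" using power_mult_distrib[of "2::real" 2 "CARD('d)"] by simp
    ultimately show ?thesis unfolding T by (simp add: power_divide power_mult_distrib)
  qed
  ultimately show ?thesis using 1 by linarith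
qed

section \<open>An approximate Green function\<close>

lemma sq_0: "sq 0 = 2"
  by (simp add: sq_def)

text \<open>Were all coordinates smaller, \<open>sq x\<close> would be at most 2 +
  (\<epsilon>\<rho>)^2/4, which is below (\<epsilon>\<rho>)^2 because \<epsilon>\<rho> \<ge>
  2.\<close>

lemma far_of_sq:
  fixes x :: "'d::finite site"
  assumes "\<epsilon> > 0" "\<epsilon> * \<rho> \<ge> 2" "sqrt (sq x) \<ge> \<epsilon> * \<rho>"
  shows "far (\<epsilon> / (2 * real CARD('d)) * \<rho>) x"
proof (rule ccontr)
  let ?d = "real CARD('d)"
  define K where "K = \<epsilon> / (2 * ?d) * \<rho>"
  assume "\<not> far (\<epsilon> / (2 * ?d) * \<rho>) x"
  hence lt: "\<bar>real_of_int (x $ i)\<bar> \<le> K" for i unfolding far_def K_def by (meson less_imp_le not_le)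
  have d: "?d \<ge> 1" by (simp add: Suc_le_eq)
  have "(real_of_int (x $ i))^2 \<le> K^2" for i
  proof -
    have "\<bar>real_of_int (x $ i)\<bar>^2 \<le> K^2" by (rule power_mono[OF lt]) simp
    thus ?thesis by (simp only: power2_abs)
  qed
  hence "(\<Sum>i\<in>UNIV. (real_of_int (x $ i))^2) \<le> (\<Sum>i\<in>(UNIV::'d set). K^2)" by (intro sum_mono)
  also have "\<dots> = ?d * K^2" by simp
  also have "?d * K^2 = (\<epsilon> * \<rho>)^2 / (4 * ?d)"
    unfolding K_def using d by (simp add: power_mult_distrib power_divide power2_eq_square)
  also have "\<dots> \<le> (\<epsilon> * \<rho>)^2 / 4" using d by (intro divide_left_mono) auto
  finally have 1: "sq x \<le> 2 + (\<epsilon> * \<rho>)^2 / 4" by (simp add: sq_def)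
  have "(\<epsilon> * \<rho>)^2 \<le> (sqrt (sq x))^2"
    using assms(2,3) by (intro power_mono) auto
  hence 2: "(\<epsilon> * \<rho>)^2 \<le> sq x" using sq_ge_2[of x] by simp
  have 3: "(\<epsilon> * \<rho>)^2 \<ge> 2^2" using assms(2) by (intro power_mono) auto
  show False using 1 2 3 by simp
qed

lemma l1_le_sqrt_sq:
  fixes y :: "'d::finite site"
  shows "(\<Sum>j\<in>UNIV. \<bar>real_of_int (y $ j)\<bar>) \<le> real CARD('d) * sqrt (sq y)"
  using sum_mono[of UNIV "\<lambda>j. \<bar>real_of_int (y $ j)\<bar>" "\<lambda>_. sqrt (sq y)"] coord_le_sqrt[of y] by simp

text \<open>The Laplacian of E removes e and leaves its convolution with
  \<open>heat (\<rho>^2)\<close>. Both there and in E itself the vanishing total of e permits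
  replacing the kernel at x - y by its increment from x to x - y, at most the length of y times a
  gradient. K and \<open>\<rho>\<^sub>0\<close> are fixed before \<rho> and L, since L will depend
  on the mass.\<close>

lemma approximate_green:
  assumes eps: "\<epsilon> > 0"
  obtains K \<rho>\<^sub>0 where "K > 0" "\<rho>\<^sub>0 \<ge> 1"
    "\<And>\<rho> L. \<rho> \<ge> \<rho>\<^sub>0 \<Longrightarrow> L > 2 \<Longrightarrow> \<exists>E :: 'd::finite site \<Rightarrow> real.
      (\<forall>x. sq x < L \<longrightarrow> \<bar>lap (\<lambda>x. Pot x + E x) x + (if x = 0 then capacity L TYPE('d) else 0)\<bar> \<le> K / \<rho> ^ (CARD('d) + 1)) \<and>
      (\<forall>x. sqrt (sq x) \<ge> \<epsilon> * \<rho> \<longrightarrow> \<bar>E x\<bar> \<le> K * (\<rho>^2 / \<rho> ^ (CARD('d) + 1)))"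
proof -
  let ?n = "CARD('d)"
  let ?d = "real ?n"
  let ?s = "\<lambda>y :: 'd site. sq y powr - ((?d + 1) / 2)"
  have d: "?d \<ge> 1" by (simp add: Suc_le_eq)
  obtain C where C: "C > 0" "\<And>x :: 'd site. \<bar>lap Pot x\<bar> \<le> C * sq x powr (- (?d / 2) - 1)"
    by (rule lap_Pot_bound[where 'd='d]) blast
  obtain B where B: "B > 0" "\<And>L. (\<Sum>x\<in>{x :: 'd::finite site. sq x < L}. sq x powr - ((?d + 1) / 2)) \<le> B"
    by (rule sum_sq_powr_bounded[where 'd='d]) blast
  define c3 where "c3 = \<epsilon> / (2 * ?d)"
  \<comment> \<open>If x has a coordinate of size at least c3 \<rho>, a displacement by at most c3
    \<rho>/2 leaves it at least 2c\<rho>, hence at least c\<rho> + 1, as the gradient bound for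
    \<open>green\<close> demands.\<close>
  define c where "c = c3 / 4"
  have c3: "c3 > 0" using eps d by (simp add: c3_def)
  have c: "c > 0" using c3 by (simp add: c_def)
  define H where "H = heat_const c TYPE('d)"
  have H: "H \<ge> 0" unfolding H_def by (rule heat_const_nonneg[OF c])
  define K1 where "K1 = C * B * ?d * 4 ^ ?n"
  \<comment> \<open>In this order: the gradient of \<open>green\<close> for small y, large y against
    \<open>green\<close> at x, and large y against the total mass of \<open>green\<close>.\<close>
  define K2 where "K2 = C * B * (?d * (?d * H) + 2 / c3 * (?d * H)) + C * (2 / c3) ^ (?n + 2) * ?d"
  define K where "K = K1 + K2"
  have K1: "K1 > 0" using C B d by (simp add: K1_def)
  have K2: "K2 \<ge> 0" using C B d c3 H by (simp add: K2_def)
  define \<rho>\<^sub>0 where "\<rho>\<^sub>0 = 1 + 2 / \<epsilon> + 8 * ?d / c + 2 / c"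
  have \<rho>0: "\<rho>\<^sub>0 \<ge> 1" using eps c d by (simp add: \<rho>\<^sub>0_def)
  have main: "\<exists>E :: 'd site \<Rightarrow> real.
      (\<forall>x. sq x < L \<longrightarrow> \<bar>lap (\<lambda>x. Pot x + E x) x + (if x = 0 then capacity L TYPE('d) else 0)\<bar> \<le> K / \<rho> ^ (?n + 1)) \<and>
      (\<forall>x. sqrt (sq x) \<ge> \<epsilon> * \<rho> \<longrightarrow> \<bar>E x\<bar> \<le> K * (\<rho>^2 / \<rho> ^ (?n + 1)))"
    if \<rho>: "\<rho> \<ge> \<rho>\<^sub>0" and L: "L > 2" for \<rho> L
  proof -
    have split: "1 \<le> r \<and> a \<le> r \<and> b \<le> r \<and> c \<le> r" if "0 \<le> a" "0 \<le> b" "0 \<le> c" "1 + a + b + c \<le> r" for a b c r :: real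
      using that by linarith
    have le: "1 \<le> \<rho> \<and> 2 / \<epsilon> \<le> \<rho> \<and> 8 * ?d / c \<le> \<rho> \<and> 2 / c \<le> \<rho>"
      by (rule split) (use eps c d \<rho> in \<open>auto simp: \<rho>\<^sub>0_def\<close>)
    have r1: "\<rho> \<ge> 1" "\<rho> > 0" "\<epsilon> * \<rho> \<ge> 2" "c * \<rho> \<ge> 8 * ?d" "c * \<rho> \<ge> 2"
      using le eps c by (simp_all add: pos_divide_le_eq mult.commute)
    define Q where "Q = {x :: 'd site. sq x < L}"
    have fQ: "finite Q" by (simp add: Q_def finite_sq_less)
    have Q0: "0 \<in> Q" using L by (simp add: Q_def sq_0)
    define e where "e y = lap Pot y + (if y = 0 then capacity L TYPE('d) else 0)" for y :: "'d site"
    have e0: "(\<Sum>y\<in>Q. e y) = 0"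
    proof -
      have "(\<Sum>y\<in>Q. if y = 0 then capacity L TYPE('d) else 0) = capacity L TYPE('d)"
        using fQ Q0 by (simp add: sum.delta)
      thus ?thesis by (simp add: e_def sum.distrib capacity_def Q_def)
    qed
    have e_bound: "\<bar>e y\<bar> \<le> C * sq y powr (- (?d / 2) - 1)" if "y \<noteq> 0" for y
      using C(2)[of y] that by (simp add: e_def)
    have e_sqrt: "\<bar>e y\<bar> * sqrt (sq y) \<le> C * ?s y" if "y \<noteq> 0" for y
    proof -
      have "\<bar>e y\<bar> * sqrt (sq y) \<le> C * sq y powr (- (?d / 2) - 1) * sq y powr (1 / 2)"
        using e_bound[OF that] sq_ge_2[of y] by (intro mult_mono) (auto simp: powr_half_sqrt)
      also have "\<dots> = C * sq y powr (- (?d / 2) - 1 + 1 / 2)" by (simp only: powr_add mult.assoc)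
      also have "- (?d / 2) - 1 + 1 / 2 = - ((?d + 1) / 2)" by (simp add: field_simps)
      finally show ?thesis .
    qed
    define l1 where "l1 y = (\<Sum>j\<in>UNIV. \<bar>real_of_int (y $ j)\<bar>)" for y :: "'d site"
    \<comment> \<open>At y = 0, the only site where e involves the capacity, the weight
      \<open>l1 y\<close> is 0.\<close>
    have e_l1: "\<bar>e y\<bar> * l1 y \<le> ?d * (C * ?s y)" for y
    proof (cases "y = 0")
      case True
      thus ?thesis using C by (simp add: l1_def)
    next
      case False
      have "\<bar>e y\<bar> * l1 y \<le> \<bar>e y\<bar> * (?d * sqrt (sq y))"
        unfolding l1_def by (intro mult_left_mono l1_le_sqrt_sq) auto
      also have "\<dots> = ?d * (\<bar>e y\<bar> * sqrt (sq y))" by simp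
      also have "\<dots> \<le> ?d * (C * ?s y)"
        using e_sqrt[OF False] by (intro mult_left_mono) auto
      finally show ?thesis .
    qed
    have sumC: "(\<Sum>y\<in>Q. C * ?s y) \<le> C * B"
      unfolding sum_distrib_left[symmetric] Q_def using C(1) B(2) by (intro mult_left_mono) auto
    define E where "E x = (\<Sum>y\<in>Q. e y * green \<rho> (x - y))" for x
    have lapE: "lap (\<lambda>x. Pot x + E x) x + (if x = 0 then capacity L TYPE('d) else 0) = (\<Sum>y\<in>Q. e y * (heat (\<rho>^2) (x - y) - heat (\<rho>^2) x))"
      if x: "x \<in> Q" for x
    proof -
      have "lap E x = (\<Sum>y\<in>Q. e y * lap (green \<rho>) (x - y))"
        unfolding E_def by (simp add: lap_sum lap_cmult lap_translate)
      also have "\<dots> = (\<Sum>y\<in>Q. e y * heat (\<rho>^2) (x - y)) - (\<Sum>y\<in>Q. if y = x then e y else 0)"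
      proof -
        have "e y * lap (green \<rho>) (x - y) = e y * heat (\<rho>^2) (x - y) - (if y = x then e y else 0)" for y
          by (auto simp: lap_green right_diff_distrib)
        thus ?thesis by (simp only: sum_subtractf)
      qed
      also have "(\<Sum>y\<in>Q. if y = x then e y else 0) = e x" using fQ x by simp
      finally have "lap E x = (\<Sum>y\<in>Q. e y * heat (\<rho>^2) (x - y)) - e x" .
      moreover have "(\<Sum>y\<in>Q. e y * (heat (\<rho>^2) (x - y) - heat (\<rho>^2) x)) = (\<Sum>y\<in>Q. e y * heat (\<rho>^2) (x - y)) - (\<Sum>y\<in>Q. e y) * heat (\<rho>^2) x"
        by (simp add: right_diff_distrib sum_subtractf sum_distrib_right)
      ultimately show ?thesis using e0 by (simp add: lap_add e_def)
    qed
    have part1: "\<bar>lap (\<lambda>x. Pot x + E x) x + (if x = 0 then capacity L TYPE('d) else 0)\<bar> \<le> K / \<rho> ^ (?n + 1)"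
      if x: "x \<in> Q" for x
    proof -
      have "\<bar>\<Sum>y\<in>Q. e y * (heat (\<rho>^2) (x - y) - heat (\<rho>^2) x)\<bar> \<le> (\<Sum>y\<in>Q. \<bar>e y\<bar> * (l1 y * (4 ^ ?n / \<rho> ^ (?n + 1))))"
      proof (rule order_trans[OF sum_abs], rule sum_mono)
        fix y
        have "\<bar>heat (\<rho>^2) (x - y) - heat (\<rho>^2) x\<bar> \<le> l1 y * (4 ^ ?n / \<rho> ^ (?n + 1))"
          unfolding l1_def by (rule lattice_path) (rule heat_diff_bound[OF r1(2)])
        thus "\<bar>e y * (heat (\<rho>^2) (x - y) - heat (\<rho>^2) x)\<bar> \<le> \<bar>e y\<bar> * (l1 y * (4 ^ ?n / \<rho> ^ (?n + 1)))"
          unfolding abs_mult by (intro mult_left_mono) auto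
      qed
      also have "\<dots> = (\<Sum>y\<in>Q. \<bar>e y\<bar> * l1 y) * (4 ^ ?n / \<rho> ^ (?n + 1))"
        by (simp only: sum_distrib_right mult.assoc)
      also have "\<dots> \<le> (\<Sum>y\<in>Q. ?d * (C * ?s y)) * (4 ^ ?n / \<rho> ^ (?n + 1))"
        using r1 by (intro mult_right_mono sum_mono e_l1) auto
      also have "\<dots> \<le> (?d * (C * B)) * (4 ^ ?n / \<rho> ^ (?n + 1))"
        unfolding sum_distrib_left[symmetric, of ?d] using r1 sumC by (intro mult_right_mono mult_left_mono) auto
      also have "\<dots> = K1 / \<rho> ^ (?n + 1)" by (simp add: K1_def)
      also have "\<dots> \<le> K / \<rho> ^ (?n + 1)" using K2 r1 by (intro divide_right_mono) (auto simp: K_def)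
      finally show ?thesis by (simp only: lapE[OF x])
    qed
    define G where "G = \<rho>^2 / \<rho> ^ (?n + 1)"
    have G0: "G \<ge> 0" using r1 by (simp add: G_def)
    have part2: "\<bar>E x\<bar> \<le> K * (\<rho>^2 / \<rho> ^ (?n + 1))" if x: "sqrt (sq x) \<ge> \<epsilon> * \<rho>" for x
    proof -
      have far: "far (c3 * \<rho>) x" unfolding c3_def by (rule far_of_sq[OF eps r1(3) x])
      then obtain j where j: "\<bar>real_of_int (x $ j)\<bar> \<ge> c3 * \<rho>" by (auto simp: far_def)
      have c3c: "c3 = 4 * c" by (simp add: c_def)
      have c3half: "c3 * \<rho> / 2 = 2 * (c * \<rho>)" by (simp add: c3c)
      define A where "A = ?d * (?d * H * G) + 2 / c3 * (?d * H * G)"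
      define F where "F = C * (2 / c3) ^ (?n + 2) / \<rho> ^ (?n + 2)"
      have F0: "F \<ge> 0" using C c3 r1 by (simp add: F_def)
      have A0: "?d * H * G \<ge> 0" using H G0 by simp
      \<comment> \<open>For y within c3 \<rho>/2 the path from x to x - y stays far from the origin
        and the gradient of \<open>green\<close> applies. For larger y no cancellation is used: e is
        small there, and the terms in \<open>green \<rho> (x - y)\<close> are summed against the
        total mass, at most d \<rho>^2.\<close>
      have summand: "\<bar>e y * (green \<rho> (x - y) - green \<rho> x)\<bar> \<le> C * ?s y * A + F * green \<rho> (x - y)"
        (is "_ \<le> ?S * A + _") for y
      proof (cases "sqrt (sq y) \<le> c3 * \<rho> / 2")
        case True
        have "\<bar>green \<rho> (x - y) - green \<rho> x\<bar> \<le> l1 y * (?d * (\<rho>^2 * (H / \<rho> ^ (?n + 1))))"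
          unfolding l1_def H_def
        proof (rule lattice_path, rule green_diff_far[OF c r1(4) _ r1(2)])
          fix z assume z: "\<And>j. \<bar>z $ j - x $ j\<bar> \<le> \<bar>y $ j\<bar>"
          have "\<bar>real_of_int (z $ j) - real_of_int (x $ j)\<bar> \<le> \<bar>real_of_int (y $ j)\<bar>"
            using z[of j] by linarith
          moreover have "\<bar>real_of_int (y $ j)\<bar> \<le> c3 * \<rho> / 2" using coord_le_sqrt[of y j] True by linarith
          ultimately have "\<bar>real_of_int (z $ j)\<bar> \<ge> c3 * \<rho> / 2" using j by linarith
          hence "\<bar>real_of_int (z $ j)\<bar> \<ge> c * \<rho> + 1" using r1(5) c3half by linarith
          thus "far (c * \<rho> + 1) z" by (auto simp: far_def)
        qed
        hence "\<bar>e y * (green \<rho> (x - y) - green \<rho> x)\<bar> \<le> \<bar>e y\<bar> * (l1 y * (?d * (\<rho>^2 * (H / \<rho> ^ (?n + 1)))))"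
          unfolding abs_mult by (intro mult_left_mono) auto
        also have "\<dots> = \<bar>e y\<bar> * l1 y * (?d * H * G)" by (simp add: G_def)
        also have "\<dots> \<le> ?d * ?S * (?d * H * G)" using A0 by (intro mult_right_mono e_l1)
        also have "\<dots> = ?S * (?d * (?d * H * G))" by simp
        also have "\<dots> \<le> ?S * A" using C c3 A0 unfolding A_def by (intro mult_left_mono) auto
        also have "\<dots> \<le> ?S * A + F * green \<rho> (x - y)" using mult_nonneg_nonneg[OF F0 green_nonneg[of \<rho> "x - y"]] by linarith
        finally show ?thesis .
      next
        case False
        hence sy: "sqrt (sq y) > c3 * \<rho> / 2" by simp
        have "c3 * \<rho> / 2 \<ge> 4" using r1(5) c3half by linarith
        hence y0: "y \<noteq> 0" using sy real_sqrt_le_mono[of 2 4] by (auto simp: sq_0)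
        have "far (c * \<rho>) x" by (rule far_mono[OF far]) (use c r1 in \<open>simp add: c3c\<close>)
        hence gx: "green \<rho> x \<le> ?d * (\<rho>^2 * (H / \<rho> ^ ?n))"
          unfolding H_def by (intro green_far[OF c r1(4)] r1)
        have eF: "\<bar>e y\<bar> \<le> F"
        proof -
          have "\<bar>e y\<bar> \<le> C * sq y powr (- (?d / 2) - 1)" by (rule e_bound[OF y0])
          also have "sq y powr (- (?d / 2) - 1) = 1 / sqrt (sq y) ^ (?n + 2)"
          proof -
            have "sq y powr (?d / 2 + 1) = (sqrt (sq y) powr 2) powr (?d / 2 + 1)"
              using sq_ge_2[of y] by (simp add: powr_numeral)
            also have "\<dots> = sqrt (sq y) powr real (?n + 2)" by (simp only: powr_powr) (simp add: algebra_simps)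
            also have "\<dots> = sqrt (sq y) ^ (?n + 2)" by (rule powr_realpow) simp
            finally show ?thesis using powr_minus_divide[of "sq y" "?d / 2 + 1"] by simp
          qed
          also have "\<dots> \<le> 1 / (c3 * \<rho> / 2) ^ (?n + 2)"
            using sy c3 r1 by (intro divide_left_mono power_mono mult_pos_pos zero_less_power) auto
          also have "C * (1 / (c3 * \<rho> / 2) ^ (?n + 2)) = F"
            by (simp only: F_def power_divide power_mult_distrib) simp
          finally show ?thesis using C by (simp add: mult_left_mono)
        qed
        have "\<bar>e y\<bar> * (c3 * \<rho> / 2) \<le> \<bar>e y\<bar> * sqrt (sq y)" using sy by (intro mult_left_mono) auto
        also have "\<dots> \<le> ?S" by (rule e_sqrt[OF y0])
        finally have eS: "\<bar>e y\<bar> \<le> ?S * (2 / (c3 * \<rho>))" using c3 r1 by (simp add: field_simps)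
        have "\<bar>e y * (green \<rho> (x - y) - green \<rho> x)\<bar> \<le> \<bar>e y\<bar> * green \<rho> (x - y) + \<bar>e y\<bar> * green \<rho> x"
          unfolding abs_mult distrib_left[symmetric]
          using green_nonneg[of \<rho> x] green_nonneg[of \<rho> "x - y"] by (intro mult_left_mono) auto
        also have "\<dots> \<le> F * green \<rho> (x - y) + ?S * (2 / (c3 * \<rho>)) * (?d * (\<rho>^2 * (H / \<rho> ^ ?n)))"
          using eF eS gx green_nonneg[of \<rho> x] green_nonneg[of \<rho> "x - y"] C c3 r1
          by (intro add_mono mult_mono mult_right_mono) auto
        also have "?S * (2 / (c3 * \<rho>)) * (?d * (\<rho>^2 * (H / \<rho> ^ ?n))) = ?S * (2 / c3 * (?d * H * G))"
          by (simp add: G_def mult_ac)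
        also have "\<dots> \<le> ?S * A" using C d A0 unfolding A_def by (intro mult_left_mono) auto
        finally show ?thesis by simp
      qed
      have "E x = (\<Sum>y\<in>Q. e y * (green \<rho> (x - y) - green \<rho> x))"
      proof -
        have "(\<Sum>y\<in>Q. e y * (green \<rho> (x - y) - green \<rho> x)) = E x - (\<Sum>y\<in>Q. e y) * green \<rho> x"
          by (simp add: E_def right_diff_distrib sum_subtractf sum_distrib_right)
        thus ?thesis using e0 by simp
      qed
      also have "\<bar>\<dots>\<bar> \<le> (\<Sum>y\<in>Q. C * ?s y * A + F * green \<rho> (x - y))"
        by (rule order_trans[OF sum_abs]) (intro sum_mono summand)
      also have "\<dots> = (\<Sum>y\<in>Q. C * ?s y) * A + F * (\<Sum>y\<in>Q. green \<rho> (x - y))"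
        by (simp only: sum.distrib sum_distrib_left sum_distrib_right)
      also have "(\<Sum>y\<in>Q. green \<rho> (x - y)) = (\<Sum>z\<in>(\<lambda>y. x - y) ` Q. green \<rho> z)"
        by (subst sum.reindex) (auto simp: inj_on_def)
      also have "(\<Sum>y\<in>Q. C * ?s y) * A + F * (\<Sum>z\<in>(\<lambda>y. x - y) ` Q. green \<rho> z) \<le> C * B * A + F * (?d * \<rho>^2)"
        using sumC F0 A0 c3 d fQ by (intro add_mono mult_right_mono mult_left_mono sum_green_le) (auto simp: A_def)
      also have "C * B * A = C * B * (?d * (?d * H) + 2 / c3 * (?d * H)) * G"
        by (simp add: A_def algebra_simps)
      also have "F * (?d * \<rho>^2) \<le> C * (2 / c3) ^ (?n + 2) * ?d * G"
      proof -
        have "F * (?d * \<rho>^2) = C * (2 / c3) ^ (?n + 2) * ?d * (\<rho>^2 / \<rho> ^ (?n + 2))"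
          by (simp add: F_def)
        also have "\<dots> \<le> C * (2 / c3) ^ (?n + 2) * ?d * G"
          unfolding G_def using C c3 r1 by (intro mult_left_mono divide_left_mono power_increasing mult_pos_pos zero_less_power) auto
        finally show ?thesis .
      qed
      finally have "\<bar>E x\<bar> \<le> K2 * G" by (simp only: K2_def distrib_right)
      also have "\<dots> \<le> K * G" using K1 G0 by (intro mult_right_mono) (auto simp: K_def)
      finally show ?thesis by (simp add: G_def)
    qed
    show ?thesis using part1 part2 by (intro exI[of _ E]) (auto simp: Q_def)
  qed
  have "K > 0" using K1 K2 by (simp add: K_def)
  from that[OF this \<rho>0 main] show ?thesis .
qed

section \<open>The odometer of a toppling sequence\<close>

lemma adj_iff:
  fixes x :: "'d::finite site"
  shows "adj x y \<longleftrightarrow> (\<exists>i. y = x + axis i 1 \<or> y = x - axis i 1)"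
proof
  assume "adj x y"
  hence s: "(\<Sum>i\<in>UNIV. \<bar>x $ i - y $ i\<bar>) = 1" by (simp add: adj_def)
  then obtain i where i: "\<bar>x $ i - y $ i\<bar> \<noteq> 0"
    using sum.neutral[of UNIV "\<lambda>i. \<bar>x $ i - y $ i\<bar>"] by force
  have "\<bar>x $ i - y $ i\<bar> + (\<Sum>j\<in>UNIV - {i}. \<bar>x $ j - y $ j\<bar>) = 1"
    using s by (subst (asm) sum.remove[of _ i]) auto
  moreover have "(\<Sum>j\<in>UNIV - {i}. \<bar>x $ j - y $ j\<bar>) \<ge> 0" by (intro sum_nonneg) auto
  ultimately have 1: "\<bar>x $ i - y $ i\<bar> = 1" "(\<Sum>j\<in>UNIV - {i}. \<bar>x $ j - y $ j\<bar>) = 0"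
    using i by linarith+
  hence 2: "x $ j = y $ j" if "j \<noteq> i" for j
    using that by (subst (asm) sum_nonneg_eq_0_iff) auto
  have "y = x + axis i 1 \<or> y = x - axis i 1"
  proof (cases "y $ i = x $ i + 1")
    case True
    thus ?thesis using 2 by (auto simp: vec_eq_iff axis_def)
  next
    case False
    hence "y $ i = x $ i - 1" using 1 by linarith
    thus ?thesis using 2 by (auto simp: vec_eq_iff axis_def)
  qed
  thus "\<exists>i. y = x + axis i 1 \<or> y = x - axis i 1" by blast
next
  assume "\<exists>i. y = x + axis i 1 \<or> y = x - axis i 1"
  then obtain i where "y = x + axis i 1 \<or> y = x - axis i 1" by blast
  hence "\<bar>x $ j - y $ j\<bar> = (if j = i then 1 else 0)" for j by (auto simp: axis_def)
  thus "adj x y" by (simp add: adj_def)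
qed

lemma axis_add_axis: "axis i (1::int) + axis j 1 \<noteq> (0 :: 'd::finite site)"
proof
  assume "axis i (1::int) + axis j 1 = (0 :: 'd site)"
  hence "axis i (1::int) $ i + axis j 1 $ i = 0" by (metis vector_add_component zero_index)
  thus False by (auto simp: axis_def split: if_splits)
qed

lemma axis_one_inj: "axis i (1::int) = axis j 1 \<longleftrightarrow> i = (j :: 'd::finite)"
  by (auto simp: axis_eq_axis)

lemma lap_delta:
  fixes x y :: "'d::finite site"
  shows "lap (\<lambda>z. if z = x then a else 0) y = (if y = x then - a else if adj x y then a / (2 * real CARD('d)) else 0)"
proof -
  consider "y = x" | k where "y = x + axis k 1" | k where "y = x - axis k 1" | "y \<noteq> x" "\<not> adj x y"
    by (auto simp: adj_iff)
  thus ?thesis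
  proof cases
    case 1
    thus ?thesis by (simp add: lap_def axis_nz)
  next
    case 2
    have "y \<noteq> x" using 2 axis_nz by auto
    moreover have "adj x y" using 2 by (auto simp: adj_iff)
    moreover have "y + axis i 1 \<noteq> x" for i using 2 axis_add_axis[of k i] by (auto simp: add.assoc)
    moreover have "y - axis i 1 = x \<longleftrightarrow> i = k" for i
      using 2 axis_one_inj[of i k] by (auto simp: algebra_simps)
    ultimately show ?thesis by (simp add: lap_def)
  next
    case 3
    have "y \<noteq> x" using 3 axis_nz by auto
    moreover have "adj x y" using 3 by (auto simp: adj_iff)
    moreover have "y - axis i 1 \<noteq> x" for i
      using 3 axis_add_axis[of k i] by (auto simp: algebra_simps)
    moreover have "y + axis i 1 = x \<longleftrightarrow> i = k" for i
      using 3 axis_one_inj[of i k] by (auto simp: algebra_simps)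
    ultimately show ?thesis by (simp add: lap_def)
  next
    case 4
    have "y - axis i 1 \<noteq> x" "y + axis i 1 \<noteq> x" for i
      using 4 by (auto simp: adj_iff)
    thus ?thesis using 4 by (simp add: lap_def)
  qed
qed

text \<open>The truncation at 0 makes the selection of a site that is not full contribute
  nothing.\<close>

definition odometer :: "(nat \<Rightarrow> 'd::finite config) \<Rightarrow> (nat \<Rightarrow> 'd site) \<Rightarrow> nat \<Rightarrow> 'd config" where
  "odometer \<mu> xs k x = (\<Sum>j<k. if xs j = x then max (\<mu> j x - 1) 0 else 0)"

lemma odometer_0: "odometer \<mu> xs 0 x = 0"
  by (simp add: odometer_def)

lemma odometer_Suc:
  "odometer \<mu> xs (Suc k) x = odometer \<mu> xs k x + (if x = xs k then max (\<mu> k (xs k) - 1) 0 else 0)"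
  by (simp add: odometer_def)

lemma odometer_mono: "k \<le> l \<Longrightarrow> odometer \<mu> xs k x \<le> odometer \<mu> xs l x"
  unfolding odometer_def by (intro sum_mono2) auto

lemma topple_eq:
  "topple x \<mu> y = \<mu> y + lap (\<lambda>z. if z = x then max (\<mu> x - 1) 0 else 0) y"
  by (auto simp: topple_def lap_delta)

lemma config_eq_odometer:
  assumes "toppling_seq m \<mu> xs"
  shows "\<mu> k y = point_mass m y + lap (odometer \<mu> xs k) y"
proof (induction k)
  case 0
  show ?case using assms by (simp add: toppling_seq_def odometer_0[abs_def])
next
  case (Suc k)
  have "\<mu> (Suc k) y = \<mu> k y + lap (\<lambda>z. if z = xs k then max (\<mu> k (xs k) - 1) 0 else 0) y"
    using assms by (simp add: toppling_seq_def topple_eq)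
  moreover have "lap (odometer \<mu> xs (Suc k)) y = lap (odometer \<mu> xs k) y + lap (\<lambda>z. if z = xs k then max (\<mu> k (xs k) - 1) 0 else 0) y"
    by (simp add: odometer_Suc[abs_def] lap_add)
  ultimately show ?case using Suc by simp
qed

text \<open>Only the value at the toppled site x grows, and there the new mass is exactly 1: hence
  u(x) equals the point mass minus 1 plus the mean of u over the neighbours. The mean is at most
  that of w by induction, and w(x) is at least the same expression formed with w.\<close>

lemma least_action:
  assumes seq: "toppling_seq m \<mu> xs"
    and w0: "\<And>x. w x \<ge> 0" and sup: "\<And>x. point_mass m x + lap w x \<le> 1"
  shows "odometer \<mu> xs k x \<le> w x"
proof (induction k arbitrary: x)
  case 0
  show ?case using w0 by (simp add: odometer_0)
next
  case (Suc k)
  show ?case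
  proof (cases "x = xs k \<and> \<mu> k x > 1")
    case False
    hence "odometer \<mu> xs (Suc k) x = odometer \<mu> xs k x" by (auto simp: odometer_Suc)
    thus ?thesis using Suc by simp
  next
    case True
    let ?u = "odometer \<mu> xs (Suc k)"
    have "\<mu> (Suc k) x = 1" using seq True by (auto simp: toppling_seq_def topple_def)
    hence "1 = point_mass m x + lap ?u x" using config_eq_odometer[OF seq, of "Suc k" x] by simp
    moreover have "lap ?u x + ?u x \<le> lap w x + w x"
    proof -
      have "?u (x + axis i 1) \<le> w (x + axis i 1)" "?u (x - axis i 1) \<le> w (x - axis i 1)" for i
        using True Suc axis_nz by (auto simp: odometer_Suc)
      hence "(\<Sum>i\<in>UNIV. ?u (x + axis i 1) + ?u (x - axis i 1)) \<le> (\<Sum>i\<in>UNIV. w (x + axis i 1) + w (x - axis i 1))"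
        by (intro sum_mono add_mono)
      thus ?thesis by (simp add: lap_eq_mean divide_right_mono)
    qed
    ultimately show ?thesis using sup[of x] by linarith
  qed
qed

lemma config_nonneg:
  assumes "toppling_seq m \<mu> xs" "m \<ge> 0"
  shows "\<mu> k y \<ge> 0"
proof (induction k arbitrary: y)
  case 0
  show ?case using assms by (simp add: toppling_seq_def point_mass_def)
next
  case (Suc k)
  show ?case using assms Suc by (auto simp: toppling_seq_def topple_def)
qed

lemma full_stays_full:
  assumes "toppling_seq m \<mu> xs" "\<mu> k y \<ge> 1" "k \<le> l"
  shows "\<mu> l y \<ge> 1"
  using assms(3)
proof (induction l rule: dec_induct)
  case (step l)
  have "\<mu> (Suc l) y = topple (xs l) (\<mu> l) y" using assms by (simp add: toppling_seq_def)
  thus ?case using step.IH by (auto simp: topple_def intro!: add_increasing2)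
qed (use assms in auto)

text \<open>If the limit exceeded 1, the mass would stay above 1 from some stage on; but the site is
  selected once more after that, which leaves it with mass exactly 1.\<close>

lemma limit_le_1:
  assumes seq: "toppling_seq m \<mu> xs" and lim: "(\<lambda>k. \<mu> k y) \<longlonglongrightarrow> \<nu>"
  shows "\<nu> \<le> 1"
proof (rule ccontr)
  assume "\<not> \<nu> \<le> 1"
  hence "eventually (\<lambda>k. \<mu> k y > 1) sequentially" using order_tendstoD(1)[OF lim, of 1] by simp
  then obtain k where k: "\<And>j. j \<ge> k \<Longrightarrow> \<mu> j y > 1" by (auto simp: eventually_sequentially)
  have "\<mu> k y \<ge> 1" using k[of k] by simp
  then obtain j where j: "j \<ge> k" "xs j = y" using seq unfolding toppling_seq_def by blast
  have "\<mu> (Suc j) y = 1" using seq j k[of j] by (auto simp: toppling_seq_def topple_def)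
  thus False using k[of "Suc j"] j by simp
qed

lemma limit_odometer:
  fixes \<nu> :: "'d::finite config"
  assumes seq: "toppling_seq m \<mu> xs" and m: "m \<ge> 0"
    and lim: "\<And>y. (\<lambda>k. \<mu> k y) \<longlonglongrightarrow> \<nu> y"
    and w0: "\<And>x. w x \<ge> 0" and sup: "\<And>x. point_mass m x + lap w x \<le> 1"
  obtains u where "\<And>x. 0 \<le> u x" "\<And>x. u x \<le> w x" "\<And>x. point_mass m x + lap u x = \<nu> x"
    "\<And>x. 0 < u x \<Longrightarrow> \<nu> x = 1"
proof -
  let ?u = "odometer \<mu> xs"
  have conv: "convergent (\<lambda>k. ?u k x)" for x
  proof (rule Bseq_mono_convergent)
    show "Bseq (\<lambda>k. ?u k x)"
    proof (rule BseqI')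
      fix k
      have "0 \<le> ?u k x" using odometer_mono[of 0 k \<mu> xs x] by (simp add: odometer_0)
      thus "norm (?u k x) \<le> w x" using least_action[OF seq w0 sup] by simp
    qed
  qed (auto intro: odometer_mono)
  define u where "u x = lim (\<lambda>k. ?u k x)" for x
  have u: "(\<lambda>k. ?u k x) \<longlonglongrightarrow> u x" for x
    unfolding u_def using conv[of x] by (simp add: convergent_LIMSEQ_iff)
  have ge: "?u k x \<le> u x" for k x
    by (rule incseq_le[OF _ u]) (auto simp: incseq_def intro: odometer_mono)
  have "0 \<le> u x" for x using ge[of 0 x] by (simp add: odometer_0)
  moreover have "u x \<le> w x" for x
    by (rule LIMSEQ_le_const2[OF u]) (use least_action[OF seq w0 sup] in auto)
  moreover have "point_mass m x + lap u x = \<nu> x" for x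
  proof (rule LIMSEQ_unique)
    show "(\<lambda>k. point_mass m x + lap (?u k) x) \<longlonglongrightarrow> point_mass m x + lap u x"
      unfolding lap_def by (intro tendsto_intros u) auto
    show "(\<lambda>k. point_mass m x + lap (?u k) x) \<longlonglongrightarrow> \<nu> x"
      using lim[of x] by (simp only: config_eq_odometer[OF seq])
  qed
  moreover have "\<nu> x = 1" if "0 < u x" for x
  proof -
    have "eventually (\<lambda>k. 0 < ?u k x) sequentially" by (rule order_tendstoD(1)[OF u that])
    then obtain k where "0 < ?u k x" by (auto simp: eventually_sequentially)
    have "\<exists>j. \<mu> j x \<ge> 1"
    proof (rule ccontr)
      assume "\<nexists>j. \<mu> j x \<ge> 1"
      hence "\<mu> j x < 1" for j by (simp add: not_le)
      hence "?u k x \<le> 0" unfolding odometer_def by (intro sum_nonpos) (simp add: less_imp_le)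
      thus False using \<open>0 < ?u k x\<close> by simp
    qed
    then obtain j where j: "\<mu> j x \<ge> 1" by blast
    have "1 \<le> \<nu> x"
      by (rule LIMSEQ_le_const[OF lim]) (use full_stays_full[OF seq j] in blast)
    thus ?thesis using limit_le_1[OF seq lim, of x] by simp
  qed
  ultimately show ?thesis by (rule that)
qed

text \<open>Summation by parts for u and for -u. Vanishing of u at both ends of each edge leaving F
  means that no mass crosses the boundary of F.\<close>

lemma sandpile_mass:
  fixes \<nu> u :: "'d::finite config"
  assumes F: "finite F" "0 \<in> F"
    and nu: "\<And>x. point_mass m x + lap u x = \<nu> x"
    and out: "\<And>x i. x \<in> F \<Longrightarrow> x + axis i 1 \<notin> F \<Longrightarrow> u x = 0 \<and> u (x + axis i 1) = 0"
      "\<And>x i. x \<in> F \<Longrightarrow> x - axis i 1 \<notin> F \<Longrightarrow> u x = 0 \<and> u (x - axis i 1) = 0"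
  shows "(\<Sum>x\<in>F. \<nu> x) = m"
proof -
  have "(\<Sum>x\<in>F. lap u x) \<le> 0"
    by (rule sum_lap_le_0[OF F(1)]) (use out in auto)
  moreover have "(\<Sum>x\<in>F. lap (\<lambda>x. - 1 * u x) x) \<le> 0"
    by (rule sum_lap_le_0[OF F(1)]) (use out in auto)
  hence "(\<Sum>x\<in>F. lap u x) \<ge> 0"
    unfolding lap_cmult by (simp add: sum_negf)
  moreover have "(\<Sum>x\<in>F. \<nu> x) = (\<Sum>x\<in>F. point_mass m x) + (\<Sum>x\<in>F. lap u x)"
    by (simp add: sum.distrib flip: nu)
  moreover have "(\<Sum>x\<in>F. point_mass m x) = m" using F by (simp add: point_mass_def sum.delta)
  ultimately show ?thesis by linarith
qed

section \<open>Barriers\<close>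

text \<open>Its derivative vanishes exactly at \<open>\<eta>\<^sup>2\<close>, and it is convex.\<close>

definition profile :: "nat \<Rightarrow> real \<Rightarrow> real \<Rightarrow> real" where
  "profile n \<eta> t = t + \<eta> ^ n * pot (real n / 2) t"

lemma powr_half_nat: "t > 0 \<Longrightarrow> t powr (real n / 2) = sqrt t ^ n"
proof -
  assume t: "t > 0"
  have "t powr (real n / 2) = (t powr (1 / 2)) powr real n" by (simp only: powr_powr) simp
  also have "\<dots> = sqrt t ^ n" using t by (simp add: powr_half_sqrt powr_realpow)
  finally show ?thesis .
qed

lemma powr_neg_half_nat: "t > 0 \<Longrightarrow> t powr - (real n / 2) = 1 / sqrt t ^ n"
  using powr_minus_divide[of t "real n / 2"] by (simp add: powr_half_nat)

text \<open>The derivative 1 - \<eta>^n t^(-n/2) vanishes at \<eta>^2, so only the second-order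
  remainder is left. In terms of \<eta> / sqrt \<xi> it is easily compared with its value at \<xi> =
  \<eta>^2: larger below \<eta>^2, smaller above.\<close>

lemma profile_taylor:
  assumes "\<eta> > 0" "t > 0"
  obtains \<xi> where "min t (\<eta>^2) \<le> \<xi>" "\<xi> \<le> max t (\<eta>^2)"
    "profile n \<eta> t - profile n \<eta> (\<eta>^2) = real n / 4 * ((\<eta> / sqrt \<xi>) ^ n / \<xi>) * (t - \<eta>^2)^2"
proof (cases "t = \<eta>^2")
  case True
  thus ?thesis using that[of t] by simp
next
  case False
  define p where "p = real n / 2"
  define diff where "diff m = (case m of 0 \<Rightarrow> profile n \<eta> | Suc 0 \<Rightarrow> (\<lambda>t. 1 + \<eta> ^ n * - (t powr - p))
     | _ \<Rightarrow> (\<lambda>t. \<eta> ^ n * (p * t powr (- p - 1))))" for m :: nat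
  have "\<exists>\<xi>. (if t < \<eta>^2 then t < \<xi> \<and> \<xi> < \<eta>^2 else \<eta>^2 < \<xi> \<and> \<xi> < t) \<and>
    profile n \<eta> t = (\<Sum>m<2. (diff m (\<eta>^2) / fact m) * (t - \<eta>^2)^m) + (diff 2 \<xi> / fact 2) * (t - \<eta>^2)^2"
  proof (rule Taylor[where a = "min t (\<eta>^2)" and b = "max t (\<eta>^2)"])
    show "\<forall>m s. m < 2 \<and> min t (\<eta>^2) \<le> s \<and> s \<le> max t (\<eta>^2) \<longrightarrow> DERIV (diff m) s :> diff (Suc m) s"
    proof (intro allI impI)
      fix m :: nat and s assume m: "m < 2 \<and> min t (\<eta>^2) \<le> s \<and> s \<le> max t (\<eta>^2)"
      have "0 < min t (\<eta>^2)" using assms by simp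
      hence s: "s > 0" using m by linarith
      from m consider "m = 0" | "m = 1" by linarith
      thus "DERIV (diff m) s :> diff (Suc m) s"
      proof cases
        case 1
        have "((\<lambda>t. t + \<eta> ^ n * pot p t) has_real_derivative 1 + \<eta> ^ n * - (s powr - p)) (at s)"
          by (intro DERIV_add DERIV_ident DERIV_cmult DERIV_pot s)
        thus ?thesis using 1 by (simp add: diff_def profile_def[abs_def] p_def)
      next
        case 2
        have "((\<lambda>t. 1 + \<eta> ^ n * (-1 * t powr - p)) has_real_derivative 0 + \<eta> ^ n * (-1 * - p * s powr (- p - 1))) (at s)"
          by (intro DERIV_add DERIV_const DERIV_cmult DERIV_powr_const s)
        thus ?thesis using 2 by (simp add: diff_def)
      qed
    qed
  qed (use False in \<open>auto simp: diff_def\<close>)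
  then obtain \<xi> where 1: "if t < \<eta>^2 then t < \<xi> \<and> \<xi> < \<eta>^2 else \<eta>^2 < \<xi> \<and> \<xi> < t" and
    2: "profile n \<eta> t = (\<Sum>m<2. (diff m (\<eta>^2) / fact m) * (t - \<eta>^2)^m) + (diff 2 \<xi> / fact 2) * (t - \<eta>^2)^2"
    by blast
  have b: "min t (\<eta>^2) \<le> \<xi>" "\<xi> \<le> max t (\<eta>^2)" using 1 by (auto split: if_splits)
  have "0 < min t (\<eta>^2)" using assms by simp
  hence \<xi>0: "\<xi> > 0" using b by linarith
  have "(\<eta>^2) powr - p = 1 / \<eta> ^ n" unfolding p_def using assms by (subst powr_neg_half_nat) auto
  hence "diff 1 (\<eta>^2) = 0" using assms by (simp add: diff_def)
  moreover have "diff 0 (\<eta>^2) = profile n \<eta> (\<eta>^2)" by (simp add: diff_def)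
  moreover have "diff 2 \<xi> = real n / 2 * ((\<eta> / sqrt \<xi>) ^ n / \<xi>)"
  proof -
    have "\<xi> powr (- p - 1) = \<xi> powr - p / \<xi>" using \<xi>0 by (simp add: powr_diff)
    also have "\<dots> = 1 / sqrt \<xi> ^ n / \<xi>" unfolding p_def using \<xi>0 by (simp only: powr_neg_half_nat)
    finally show ?thesis by (simp add: diff_def numeral_2_eq_2 p_def power_divide mult_ac)
  qed
  ultimately have "profile n \<eta> t - profile n \<eta> (\<eta>^2) = real n / 4 * ((\<eta> / sqrt \<xi>) ^ n / \<xi>) * (t - \<eta>^2)^2"
    using 2 by (simp add: numeral_2_eq_2)
  with b show ?thesis by (rule that)
qed

lemma profile_below:
  assumes "\<eta> > 0" "0 < t" "t \<le> \<eta>^2"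
  shows "real n / 4 * ((\<eta>^2 - t)^2 / \<eta>^2) \<le> profile n \<eta> t - profile n \<eta> (\<eta>^2)"
proof -
  obtain \<xi> where \<xi>: "min t (\<eta>^2) \<le> \<xi>" "\<xi> \<le> max t (\<eta>^2)"
    and eq: "profile n \<eta> t - profile n \<eta> (\<eta>^2) = real n / 4 * ((\<eta> / sqrt \<xi>) ^ n / \<xi>) * (t - \<eta>^2)^2"
    by (rule profile_taylor[OF assms(1,2)])
  have b: "0 < \<xi>" "\<xi> \<le> \<eta>^2" using \<xi> assms by auto
  have "sqrt \<xi> \<le> \<eta>" using b assms by (intro real_le_lsqrt) auto
  hence "1 \<le> (\<eta> / sqrt \<xi>) ^ n" using b by (intro one_le_power) simp
  hence "1 / \<eta>^2 \<le> (\<eta> / sqrt \<xi>) ^ n / \<xi>" using b by (intro frac_le) auto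
  hence "real n / 4 * (1 / \<eta>^2) * (t - \<eta>^2)^2 \<le> real n / 4 * ((\<eta> / sqrt \<xi>) ^ n / \<xi>) * (t - \<eta>^2)^2"
    by (intro mult_right_mono mult_left_mono) auto
  thus ?thesis unfolding eq by (simp add: power2_commute)
qed

lemma profile_above:
  assumes "\<eta> > 0" "\<eta>^2 \<le> t"
  shows "0 \<le> profile n \<eta> t - profile n \<eta> (\<eta>^2)"
    "profile n \<eta> t - profile n \<eta> (\<eta>^2) \<le> real n / 4 * ((t - \<eta>^2)^2 / \<eta>^2)"
proof -
  have \<eta>2: "\<eta>^2 > 0" using assms by simp
  have t: "t > 0" using assms \<eta>2 by linarith
  obtain \<xi> where \<xi>: "min t (\<eta>^2) \<le> \<xi>" "\<xi> \<le> max t (\<eta>^2)"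
    and eq: "profile n \<eta> t - profile n \<eta> (\<eta>^2) = real n / 4 * ((\<eta> / sqrt \<xi>) ^ n / \<xi>) * (t - \<eta>^2)^2"
    by (rule profile_taylor[OF assms(1) t])
  have b: "\<eta>^2 \<le> \<xi>" using \<xi> assms by auto
  have b0: "0 < \<xi>" using b \<eta>2 by linarith
  show "0 \<le> profile n \<eta> t - profile n \<eta> (\<eta>^2)" unfolding eq using b0 assms by simp
  have "\<eta> \<le> sqrt \<xi>" using b assms by (intro real_le_rsqrt) auto
  hence "(\<eta> / sqrt \<xi>) ^ n \<le> 1" using b0 assms by (intro power_le_one) auto
  hence "(\<eta> / sqrt \<xi>) ^ n / \<xi> \<le> 1 / \<eta>^2" using b b0 \<eta>2 assms by (intro frac_le) auto
  hence "real n / 4 * ((\<eta> / sqrt \<xi>) ^ n / \<xi>) * (t - \<eta>^2)^2 \<le> real n / 4 * (1 / \<eta>^2) * (t - \<eta>^2)^2"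
    by (intro mult_right_mono mult_left_mono) auto
  thus "profile n \<eta> t - profile n \<eta> (\<eta>^2) \<le> real n / 4 * ((t - \<eta>^2)^2 / \<eta>^2)"
    unfolding eq by simp
qed

lemma profile_nonneg:
  assumes "\<eta> > 0" "0 < t"
  shows "0 \<le> profile n \<eta> t - profile n \<eta> (\<eta>^2)"
proof (cases "t \<le> \<eta>^2")
  case True
  have "0 \<le> real n / 4 * ((\<eta>^2 - t)^2 / \<eta>^2)" by simp
  thus ?thesis using profile_below[OF assms True, of n] by linarith
qed (use profile_above(1)[OF assms(1), of t n] in auto)

text \<open>Within distance 1 of the sphere, Bernoulli's inequality and \<eta> \<ge> 3(n + 2) let
  the second derivative grow by a factor of at most 3/2. The constant n/4 becomes 3n/8, still below
  the n/2 beyond which the estimate just outside the support would fail.\<close>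

lemma profile_near:
  assumes "\<eta> \<ge> 3 * (real n + 2)" "(\<eta> - 1)^2 \<le> t" "t \<le> \<eta>^2"
  shows "profile n \<eta> t - profile n \<eta> (\<eta>^2) \<le> 3 * real n / 8 * ((\<eta>^2 - t)^2 / \<eta>^2)"
proof -
  have \<eta>: "\<eta> > 1" using assms(1) by (smt (verit) of_nat_0_le_iff)
  have t: "t > 0" using assms(2) \<eta> by (smt (verit) zero_less_power)
  obtain \<xi> where \<xi>: "min t (\<eta>^2) \<le> \<xi>" "\<xi> \<le> max t (\<eta>^2)"
    and eq: "profile n \<eta> t - profile n \<eta> (\<eta>^2) = real n / 4 * ((\<eta> / sqrt \<xi>) ^ n / \<xi>) * (t - \<eta>^2)^2"
    by (rule profile_taylor[OF _ t]) (use \<eta> in auto)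
  have b: "(\<eta> - 1)^2 \<le> \<xi>" using \<xi> assms by auto
  have "0 < min t (\<eta>^2)" using t \<eta> by simp
  hence b0: "0 < \<xi>" using \<xi>(1) by linarith
  have s: "\<eta> - 1 \<le> sqrt \<xi>" by (rule real_le_rsqrt[OF b])
  have "1 - real (n + 2) * (1 / \<eta>) \<le> (1 - 1 / \<eta>) ^ (n + 2)"
    using Bernoulli_inequality[of "- (1 / \<eta>)" "n + 2"] \<eta> by simp
  moreover have "real (n + 2) * (1 / \<eta>) \<le> 1 / 3" using assms(1) \<eta> by (simp add: field_simps)
  moreover have "(1 - 1 / \<eta>) ^ (n + 2) \<le> (sqrt \<xi> / \<eta>) ^ (n + 2)"
  proof (intro power_mono)
    have "1 - 1 / \<eta> = (\<eta> - 1) / \<eta>" using \<eta> by (simp add: diff_divide_distrib)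
    also have "\<dots> \<le> sqrt \<xi> / \<eta>" using s \<eta> by (intro divide_right_mono) auto
    finally show "1 - 1 / \<eta> \<le> sqrt \<xi> / \<eta>" .
  qed (use \<eta> in auto)
  ultimately have X: "2 / 3 \<le> (sqrt \<xi> / \<eta>) ^ (n + 2)" by linarith
  have "(\<eta> / sqrt \<xi>) ^ n / \<xi> = (1 / \<eta>^2) * (1 / (sqrt \<xi> / \<eta>) ^ (n + 2))"
  proof -
    have "sqrt \<xi> ^ (n + 2) = sqrt \<xi> ^ n * \<xi>" "\<eta> ^ (n + 2) = \<eta> ^ n * \<eta>^2"
      using b0 by (simp_all only: power_add real_sqrt_pow2 less_imp_le)
    moreover have "a / s / b = 1 / c * (1 / (s * b / (a * c)))" if "c \<noteq> 0" for a s b c :: real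
      using that by simp
    from this[of "\<eta>^2"] \<eta> have "a / s / b = 1 / \<eta>^2 * (1 / (s * b / (a * \<eta>^2)))" for a s b by simp
    ultimately show ?thesis by (simp only: power_divide)
  qed
  also have "\<dots> \<le> (1 / \<eta>^2) * (1 / (2 / 3))"
    using X by (intro mult_left_mono frac_le) auto
  finally have "(\<eta> / sqrt \<xi>) ^ n / \<xi> \<le> 3 / 2 * (1 / \<eta>^2)" by simp
  hence "real n / 4 * ((\<eta> / sqrt \<xi>) ^ n / \<xi>) * (t - \<eta>^2)^2 \<le> real n / 4 * (3 / 2 * (1 / \<eta>^2)) * (t - \<eta>^2)^2"
    by (intro mult_right_mono mult_left_mono) auto
  thus ?thesis unfolding eq by (simp add: power2_commute)
qed

text \<open>Between the radii \<rho>/16 and \<rho>/8 the potential drops by at least (8/\<rho>)^n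
  (1/64 - 1/256) \<rho>^2, and 8^n \<ge> 64 for n \<ge> 2. This drop, times the discrepancy \<beta>
  of the coefficients, has to beat the error at the glued shell.\<close>

lemma pot_gap:
  assumes "\<rho> > 0" "n \<ge> 2" "A \<ge> 0" "2 * A * (\<rho> ^ n / \<rho>) \<le> \<beta>"
  shows "3 / 2 * A * \<rho> \<le> \<beta> * (pot (real n / 2) ((\<rho> / 16)^2) - pot (real n / 2) ((\<rho> / 8)^2))"
proof -
  let ?p = "real n / 2"
  have e: "((\<rho> / 8)^2) powr - ?p = 8 ^ n / \<rho> ^ n"
  proof -
    have "((\<rho> / 8)^2) powr - ?p = 1 / sqrt ((\<rho> / 8)^2) ^ n"
      by (rule powr_neg_half_nat) (use assms(1) in simp)
    also have "sqrt ((\<rho> / 8)^2) = \<rho> / 8" using assms(1) by (simp only: real_sqrt_abs)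
    finally show ?thesis by (simp add: power_divide)
  qed
  have "(\<rho> / 16)^2 \<le> (\<rho> / 8)^2" using assms(1) by (intro power_mono) auto
  hence "pot ?p ((\<rho> / 8)^2) + ((\<rho> / 8)^2) powr - ?p * (\<rho> / 8)^2 \<le> pot ?p ((\<rho> / 16)^2) + ((\<rho> / 8)^2) powr - ?p * (\<rho> / 16)^2"
    using assms(1) by (intro pot_plus_linear_antimono) auto
  hence gap: "8 ^ n / \<rho> ^ n * (3 / 256 * \<rho>^2) \<le> pot ?p ((\<rho> / 16)^2) - pot ?p ((\<rho> / 8)^2)"
    unfolding e by (simp add: power_divide algebra_simps)
  have 8: "(64::real) \<le> 8 ^ n" using power_increasing[OF assms(2), of "8::real"] by simp
  have "3 / 2 * A * \<rho> = 2 * A * (\<rho> ^ n / \<rho>) * (64 / \<rho> ^ n * (3 / 256 * \<rho>^2))"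
    using assms(1) by (simp add: power2_eq_square)
  also have "\<dots> \<le> 2 * A * (\<rho> ^ n / \<rho>) * (8 ^ n / \<rho> ^ n * (3 / 256 * \<rho>^2))"
    using assms 8 by (intro mult_left_mono mult_right_mono divide_right_mono) auto
  also have "\<dots> \<le> \<beta> * (pot ?p ((\<rho> / 16)^2) - pot ?p ((\<rho> / 8)^2))"
    using assms gap by (intro mult_mono) (auto intro: order_trans[OF _ assms(4)] order_trans[OF _ gap])
  finally show ?thesis .
qed

section \<open>Error terms and mass balance for the gluing\<close>

lemma sq_powr_eq:
  fixes x :: "'d::finite site"
  shows "sq x powr (- (real CARD('d) / 2) - 1) = 1 / sqrt (sq x) ^ (CARD('d) + 2)"
proof -
  have "- (real CARD('d) / 2) - 1 = - (real (CARD('d) + 2) / 2)" by (simp add: field_simps)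
  thus ?thesis by (simp only: powr_neg_half_nat[OF sq_pos])
qed

text \<open>At distance \<rho>/16 or more the Laplacian of \<open>Pot\<close> is of order
  \<rho>^(-d-2); a coefficient of order \<rho>^d leaves \<rho>^(-2), within the reserve
  A/\<rho>.\<close>

lemma lap_Pot_outer:
  fixes x :: "'d::finite site"
  assumes C: "\<And>x :: 'd site. \<bar>lap Pot x\<bar> \<le> C * sq x powr (- (real CARD('d) / 2) - 1)" "C > 0"
    and \<rho>: "\<rho> \<ge> 1" "sqrt (sq x) \<ge> \<rho> / 16" and l: "0 \<le> l" "l \<le> 2 ^ CARD('d) * \<rho> ^ CARD('d)"
    and A: "A \<ge> 2 ^ CARD('d) * C * 16 ^ (CARD('d) + 2)"
  shows "l * \<bar>lap Pot x\<bar> \<le> A / \<rho>"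
proof -
  have "sq x powr (- (real CARD('d) / 2) - 1) \<le> 1 / (\<rho> / 16) ^ (CARD('d) + 2)"
    unfolding sq_powr_eq using \<rho> by (intro divide_left_mono power_mono mult_pos_pos zero_less_power) auto
  also have "\<dots> = 16 ^ (CARD('d) + 2) / \<rho> ^ (CARD('d) + 2)" by (simp add: power_divide)
  finally have "\<bar>lap Pot x\<bar> \<le> C * (16 ^ (CARD('d) + 2) / \<rho> ^ (CARD('d) + 2))"
    using C(1)[of x] mult_left_mono[of "sq x powr (- (real CARD('d) / 2) - 1)" "16 ^ (CARD('d) + 2) / \<rho> ^ (CARD('d) + 2)" C] C(2)
    by linarith
  hence "l * \<bar>lap Pot x\<bar> \<le> (2 ^ CARD('d) * \<rho> ^ CARD('d)) * (C * (16 ^ (CARD('d) + 2) / \<rho> ^ (CARD('d) + 2)))"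
    using l C \<rho> by (intro mult_mono) auto
  also have "\<dots> = 2 ^ CARD('d) * C * 16 ^ (CARD('d) + 2) / \<rho>^2"
    using \<rho> by (simp add: power_add power2_eq_square)
  also have "\<dots> \<le> A / \<rho>^2" using A by (intro divide_right_mono) auto
  also have "\<dots> \<le> A / \<rho>"
  proof -
    have "0 \<le> A" using A C by (smt (verit) mult_pos_pos zero_less_power)
    thus ?thesis using \<rho> by (intro divide_left_mono) (auto simp: power2_eq_square)
  qed
  finally show ?thesis .
qed

lemma sq_le_of_sqrt: "sqrt (sq x) \<le> a \<Longrightarrow> sq x \<le> a^2"
  by (rule sqrt_le_D)

lemma sq_ge_of_sqrt: "a \<le> sqrt (sq x) \<Longrightarrow> 0 \<le> a \<Longrightarrow> a^2 \<le> sq x"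
  using power_mono[of a "sqrt (sq x)" 2] sq_ge_2[of x] by simp

lemma finite_sqrt_sq_less: "finite {x :: 'd::finite site. sqrt (sq x) < a}"
proof (rule finite_subset)
  show "{x :: 'd site. sqrt (sq x) < a} \<subseteq> {x. sq x < a^2 + 1}"
  proof safe
    fix x :: "'d site" assume "sqrt (sq x) < a"
    hence "sq x \<le> a^2" by (intro sq_le_of_sqrt) simp
    thus "sq x < a^2 + 1" by linarith
  qed
qed (rule finite_sq_less)

lemma sq_less_of_sqrt:
  assumes "sqrt (sq x) \<le> \<rho> / 8" "\<rho> > 0" shows "sq x < \<rho>^2"
proof -
  have "sq x \<le> (\<rho> / 8)^2" using assms by (intro sq_le_of_sqrt)
  also have "\<dots> < \<rho>^2" using assms by (intro power_strict_mono) auto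
  finally show ?thesis .
qed

lemma square_gap:
  assumes "(\<eta>::real) > 0" "16 * t \<le> \<eta>^2"
  shows "225 / 256 * \<eta>^2 \<le> (\<eta>^2 - t)^2 / \<eta>^2"
proof -
  have "15 / 16 * \<eta>^2 \<le> \<eta>^2 - t" using assms(2) by linarith
  hence "(15 / 16 * \<eta>^2)^2 \<le> (\<eta>^2 - t)^2" by (intro power_mono) auto
  hence "(15 / 16 * \<eta>^2)^2 / \<eta>^2 \<le> (\<eta>^2 - t)^2 / \<eta>^2" by (intro divide_right_mono) auto
  moreover have "(15 / 16 * \<eta>^2)^2 / \<eta>^2 = 225 / 256 * \<eta>^2" using assms(1) by (simp add: power2_eq_square)
  ultimately show ?thesis by linarith
qed

lemma scaled_error_bound:
  assumes "\<bar>e\<bar> \<le> K * (\<rho>^2 / \<rho> ^ (n + 1))" "(\<rho>::real) > 0"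
  shows "\<bar>\<rho> ^ n * e\<bar> \<le> K * \<rho>"
proof -
  have "\<bar>\<rho> ^ n * e\<bar> \<le> \<rho> ^ n * (K * (\<rho>^2 / \<rho> ^ (n + 1)))"
    unfolding abs_mult using assms by (intro mult_mono) auto
  also have "\<dots> = K * \<rho>" using assms(2) by (simp add: power2_eq_square)
  finally show ?thesis .
qed

text \<open>In units x = 4A/\<rho>: lowering the coefficient costs the factor 1 - x/4, enlarging the
  radius by 4A gains at least 1 + x, and the product is at least 1 + x/2 because x \<le> 1. The
  surplus pays for the gluing.\<close>

lemma barrier_mass_gain:
  fixes \<rho> A :: real
  assumes "\<rho> > 0" "A > 0" "\<rho> \<ge> 4 * A" "n \<ge> (1::nat)"
  shows "2 * A * (\<rho> ^ n / \<rho>) \<le> (1 - A / \<rho>) * (\<rho> + 4 * A) ^ n - \<rho> ^ n"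
proof -
  define x where "x = 4 * A / \<rho>"
  have x: "0 < x" "x \<le> 1" using assms by (auto simp: x_def)
  have "1 + x \<le> (1 + x) ^ n" using self_le_power[of "1 + x" n] x assms(4) by simp
  hence "(1 - x / 4) * (1 + x) \<le> (1 - x / 4) * (1 + x) ^ n" using x by (intro mult_left_mono) auto
  moreover have "1 + x / 2 \<le> (1 - x / 4) * (1 + x)"
  proof -
    have "(1 - x / 4) * (1 + x) = 1 + 3 / 4 * x - x * x / 4" by (simp add: field_simps)
    moreover have "x * x \<le> x * 1" using x by (intro mult_left_mono) auto
    ultimately show ?thesis by linarith
  qed
  ultimately have main: "\<rho> ^ n * (1 + x / 2) \<le> \<rho> ^ n * ((1 - x / 4) * (1 + x) ^ n)"
    using assms by (intro mult_left_mono) auto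
  have "\<rho> + 4 * A = \<rho> * (1 + x)" using assms by (simp add: x_def distrib_left)
  hence e1: "(\<rho> + 4 * A) ^ n = \<rho> ^ n * (1 + x) ^ n" by (simp only: power_mult_distrib)
  have e2: "A / \<rho> = x / 4" and e3: "2 * A * (\<rho> ^ n / \<rho>) = \<rho> ^ n * (x / 2)" by (auto simp: x_def)
  show ?thesis unfolding e1 e2 e3 using main by (simp add: algebra_simps)
qed

lemma barrier_mass_loss:
  fixes \<rho> A :: real
  assumes "\<rho> > 0" "A > 0" "\<rho> \<ge> 4 * A" "n \<ge> (1::nat)"
  shows "2 * A * (\<rho> ^ n / \<rho>) \<le> \<rho> ^ n - (1 + A / \<rho>) * (\<rho> - 4 * A) ^ n"
proof -
  define x where "x = 4 * A / \<rho>"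
  have x: "0 < x" "x \<le> 1" using assms by (auto simp: x_def)
  have "(1 - x) ^ n \<le> (1 - x) ^ 1" using x assms(4) by (intro power_decreasing) auto
  hence "(1 + x / 4) * (1 - x) ^ n \<le> (1 + x / 4) * (1 - x)" using x by (intro mult_left_mono) auto
  moreover have "(1 + x / 4) * (1 - x) \<le> 1 - x / 2"
  proof -
    have "(1 + x / 4) * (1 - x) = 1 - 3 / 4 * x - x * x / 4" by (simp add: field_simps)
    moreover have "0 \<le> x * x" by simp
    ultimately show ?thesis using x by linarith
  qed
  ultimately have main: "\<rho> ^ n * ((1 + x / 4) * (1 - x) ^ n) \<le> \<rho> ^ n * (1 - x / 2)"
    using assms by (intro mult_left_mono) auto
  have "\<rho> - 4 * A = \<rho> * (1 - x)" using assms by (simp add: x_def right_diff_distrib)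
  hence e1: "(\<rho> - 4 * A) ^ n = \<rho> ^ n * (1 - x) ^ n" by (simp only: power_mult_distrib)
  have e2: "A / \<rho> = x / 4" and e3: "2 * A * (\<rho> ^ n / \<rho>) = \<rho> ^ n * (x / 2)" by (auto simp: x_def)
  show ?thesis unfolding e1 e2 e3 using main by (simp add: algebra_simps)
qed

lemma lap_affine:
  "lap (\<lambda>x. a * sq x + b * g x + c) x = a + b * lap g x"
  by (simp add: lap_add lap_cmult lap_sq)

text \<open>The outer piece \<open>w2\<close> is a multiple of the profile at radius \<eta> = \<rho>
  + 4A; the inner piece \<open>w1\<close> has the coefficient \<rho>^d that cancels the point mass.
  As \<beta> > 0 and \<open>Pot\<close> decreases, \<open>w1 - w2\<close> increases with the radius
  apart from the error E, so the minimum passes from \<open>w1\<close> to \<open>w2\<close> between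
  \<rho>/16 and \<rho>/8. The gap A/\<rho> between \<alpha> and 1 absorbs the errors of both
  Laplacians.\<close>

lemma upper_barrier:
  fixes E :: "'d::finite site \<Rightarrow> real"
  assumes d2: "CARD('d) \<ge> 2"
    and C: "\<And>x :: 'd site. \<bar>lap Pot x\<bar> \<le> C * sq x powr (- (real CARD('d) / 2) - 1)" "C > 0"
    and lapE: "\<And>x. sq x < L \<Longrightarrow> \<bar>lap (\<lambda>x. Pot x + E x) x + (if x = 0 then \<kappa> else 0)\<bar> \<le> K / \<rho> ^ (CARD('d) + 1)"
    and E: "\<And>x. sqrt (sq x) \<ge> 1 / 32 * \<rho> \<Longrightarrow> \<bar>E x\<bar> \<le> K * (\<rho>^2 / \<rho> ^ (CARD('d) + 1))"
    and \<kappa>: "\<kappa> \<ge> 0" and K: "K > 0" and L: "L \<ge> \<rho>^2"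
    and A: "A \<ge> 2 * K" "A \<ge> 2 ^ CARD('d) * C * 16 ^ (CARD('d) + 2)"
    and \<rho>: "\<rho> \<ge> 64" "\<rho> \<ge> 4 * A" "\<rho> \<ge> 3 * (real CARD('d) + 2)"
  shows "\<exists>w :: 'd site \<Rightarrow> real. (\<forall>x. 0 \<le> w x) \<and> (\<forall>x. point_mass (\<kappa> * \<rho> ^ CARD('d)) x + lap w x \<le> 1) \<and>
    (\<forall>x. sqrt (sq x) \<ge> \<rho> + 4 * A \<longrightarrow> w x = 0)"
proof -
  let ?n = "CARD('d)"
  let ?d = "real ?n"
  let ?a = "pot (?d / 2) ((\<rho> / 16)^2)" and ?b = "pot (?d / 2) ((\<rho> / 8)^2)"
  define r where "r x = sqrt (sq x)" for x :: "'d site"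
  define \<alpha> where "\<alpha> = 1 - A / \<rho>"
  define \<eta> where "\<eta> = \<rho> + 4 * A"
  define l where "l = \<eta> ^ ?n"
  define \<beta> where "\<beta> = \<alpha> * l - \<rho> ^ ?n"
  define c2 where "c2 = - \<alpha> * profile ?n \<eta> (\<eta>^2)"
  \<comment> \<open>Makes \<open>w1 - w2\<close> equal to \<beta> (a - Pot) plus an error minus
    K\<rho>, a being the potential at radius \<rho>/16: nonpositive between \<rho>/32 and \<rho>/16,
    and nonnegative from \<rho>/8 on by \<open>pot_gap\<close> and A \<ge> 2K.\<close>
  define c1 where "c1 = c2 + \<beta> * ?a - K * \<rho>"
  define w1 where "w1 x = \<alpha> * sq x + \<rho> ^ ?n * (Pot x + E x) + c1" for x
  define w2 where "w2 x = \<alpha> * sq x + (\<alpha> * l) * Pot x + c2" for x :: "'d site"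
  define w where "w x = (if r x \<ge> \<eta> then 0 else if r x < \<rho> / 16 then w1 x
    else if r x \<le> \<rho> / 8 then min (w1 x) (w2 x) else w2 x)" for x
  have A0: "A > 0" using A(1) K by linarith
  have \<rho>0: "\<rho> > 0" using \<rho> by linarith
  have A\<rho>: "A / \<rho> \<le> 1 / 4" "0 < A / \<rho>" using \<rho> A0 \<rho>0 by (auto simp: divide_le_eq)
  have \<alpha>: "3 / 4 \<le> \<alpha>" "\<alpha> \<le> 1" using A\<rho> by (auto simp: \<alpha>_def)
  have \<eta>: "\<eta> > \<rho>" "\<eta> \<le> 2 * \<rho>" "\<eta> > 0" "\<eta> \<ge> 3 * (?d + 2)" "\<eta> \<ge> 64" using \<rho> A0 unfolding \<eta>_def by linarith+
  have \<beta>: "2 * A * (\<rho> ^ ?n / \<rho>) \<le> \<beta>"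
    unfolding \<beta>_def \<alpha>_def l_def \<eta>_def using \<rho>0 A0 \<rho>(2) d2 by (intro barrier_mass_gain) auto
  have "0 \<le> 2 * A * (\<rho> ^ ?n / \<rho>)" using A0 \<rho>0 by simp
  hence \<beta>0: "\<beta> \<ge> 0" using \<beta> by linarith
  have l0: "0 \<le> \<alpha> * l" "\<alpha> * l \<le> 2 ^ ?n * \<rho> ^ ?n"
  proof -
    have "l \<le> (2 * \<rho>) ^ ?n" unfolding l_def using \<eta> by (intro power_mono) auto
    moreover have "\<alpha> * l \<le> 1 * l" using \<alpha> \<eta> by (intro mult_right_mono) (auto simp: l_def)
    ultimately show "\<alpha> * l \<le> 2 ^ ?n * \<rho> ^ ?n" by (simp add: power_mult_distrib)
    show "0 \<le> \<alpha> * l" using \<alpha> \<eta> by (simp add: l_def)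
  qed
  have w2_profile: "w2 x = \<alpha> * (profile ?n \<eta> (sq x) - profile ?n \<eta> (\<eta>^2))" for x
    by (simp add: w2_def c2_def profile_def Pot_def l_def algebra_simps)
  have w2_nonneg: "0 \<le> w2 x" for x
    unfolding w2_profile using \<alpha> \<eta> by (intro mult_nonneg_nonneg profile_nonneg) auto
  have E\<rho>: "\<bar>\<rho> ^ ?n * E x\<bar> \<le> K * \<rho>" if "r x \<ge> \<rho> / 32" for x
    by (rule scaled_error_bound[OF E \<rho>0]) (use that in \<open>simp add: r_def\<close>)
  have diff: "w1 x - w2 x = \<rho> ^ ?n * E x - \<beta> * Pot x + \<beta> * ?a - K * \<rho>" for x
    by (simp add: w1_def w2_def c1_def \<beta>_def algebra_simps)
  have inner: "w1 x \<le> w2 x" if "\<rho> / 32 \<le> r x" "r x \<le> \<rho> / 16" for x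
  proof -
    have "sq x \<le> (\<rho> / 16)^2" using that by (intro sq_le_of_sqrt) (simp add: r_def)
    hence "?a \<le> Pot x" unfolding Pot_def by (intro pot_antimono) auto
    hence "\<beta> * ?a \<le> \<beta> * Pot x" using \<beta>0 by (intro mult_left_mono)
    thus ?thesis using diff[of x] E\<rho>[OF that(1)] by linarith
  qed
  have outer: "w2 x \<le> w1 x" if "\<rho> / 8 \<le> r x" for x
  proof -
    have "(\<rho> / 8)^2 \<le> sq x" using that \<rho>0 by (intro sq_ge_of_sqrt) (auto simp: r_def)
    hence "Pot x \<le> ?b" unfolding Pot_def using \<rho>0 by (intro pot_antimono) auto
    hence "\<beta> * Pot x \<le> \<beta> * ?b" using \<beta>0 by (intro mult_left_mono)
    moreover have "3 / 2 * A * \<rho> \<le> \<beta> * (?a - ?b)"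
      by (rule pot_gap) (use \<rho>0 d2 A0 \<beta> in auto)
    hence "3 / 2 * A * \<rho> \<le> \<beta> * ?a - \<beta> * ?b" by (simp only: right_diff_distrib)
    moreover have "2 * (K * \<rho>) \<le> 3 / 2 * A * \<rho>"
      using mult_right_mono[OF A(1), of \<rho>] A0 \<rho>0 K by (simp add: algebra_simps)
    ultimately show ?thesis using diff[of x] E\<rho>[of x] that \<rho>0 by linarith
  qed
  have lap_w1: "point_mass (\<kappa> * \<rho> ^ ?n) x + lap w1 x \<le> 1" if "sq x < L" for x
  proof -
    let ?X = "lap (\<lambda>x. Pot x + E x) x + (if x = 0 then \<kappa> else 0)"
    have "\<rho> ^ ?n * ?X \<le> \<rho> ^ ?n * (K / \<rho> ^ (?n + 1))"
      using lapE[OF that] \<rho>0 by (intro mult_left_mono) auto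
    also have "\<dots> = K / \<rho>" using \<rho>0 by simp
    also have "\<dots> \<le> A / \<rho>" using A(1) K \<rho>0 by (intro divide_right_mono) auto
    finally have "\<rho> ^ ?n * ?X \<le> A / \<rho>" .
    moreover have "point_mass (\<kappa> * \<rho> ^ ?n) x + lap w1 x = \<alpha> + \<rho> ^ ?n * ?X"
      unfolding w1_def[abs_def] lap_affine by (simp add: point_mass_def algebra_simps)
    ultimately show ?thesis by (simp add: \<alpha>_def)
  qed
  have lap_w2: "lap w2 x \<le> 1" if "r x \<ge> \<rho> / 16" for x
  proof -
    have "(\<alpha> * l) * \<bar>lap Pot x\<bar> \<le> A / \<rho>"
      using that \<rho> l0 A(2) by (intro lap_Pot_outer[OF C]) (auto simp: r_def)
    moreover have "(\<alpha> * l) * lap Pot x \<le> (\<alpha> * l) * \<bar>lap Pot x\<bar>" using l0 by (intro mult_left_mono) auto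
    moreover have "lap w2 x = \<alpha> + (\<alpha> * l) * lap Pot x"
      unfolding w2_def[abs_def] lap_affine by simp
    ultimately show ?thesis using \<alpha>_def by linarith
  qed
  have nb: "r (x + axis i 1) \<le> r x + 1" "r (x - axis i 1) \<le> r x + 1" "r x - 1 \<le> r (x + axis i 1)" "r x - 1 \<le> r (x - axis i 1)" for x i
    unfolding r_def by (rule sqrt_sq_neighbour)+
  have r0: "r 0 < \<rho> / 16"
  proof -
    have "r 0 < sqrt 4" unfolding r_def sq_0 by (simp only: real_sqrt_less_iff)
    also have "sqrt 4 = (2::real)" by simp
    finally show ?thesis using \<rho> by linarith
  qed
  \<comment> \<open>Near the origin E has no pointwise bound. But \<open>w1 - sq\<close> is
    superharmonic on this ball, and on the layer outside it is at least \<open>w2 - sq\<close>,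
    which is nonnegative: the profile there is a fixed fraction of \<eta>^2, while \<open>sq\<close>
    is at most \<eta>^2/16.\<close>
  have w1_nonneg: "0 \<le> w1 x" if "r x \<le> \<rho> / 8" for x
  proof -
    let ?\<Omega> = "{x :: 'd site. r x \<le> \<rho> / 8}"
    have fin: "finite ?\<Omega>"
      by (rule finite_subset[OF _ finite_sqrt_sq_less[of "\<rho> / 8 + 1"]]) (auto simp: r_def)
    have bd: "0 \<le> w1 y - sq y" if y: "\<rho> / 8 \<le> r y" "r y \<le> \<rho> / 4" for y
    proof -
      have sy: "sq y \<le> (\<rho> / 4)^2" using y by (intro sq_le_of_sqrt) (simp add: r_def)
      have S: "16 * (\<rho> / 4)^2 \<le> \<eta>^2"
      proof -
        have "16 * (\<rho> / 4)^2 = \<rho>^2" by (simp add: power_divide)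
        also have "\<dots> \<le> \<eta>^2" using \<eta> \<rho>0 by (intro power_mono) auto
        finally show ?thesis .
      qed
      have sS: "16 * sq y \<le> \<eta>^2" using sy S by linarith
      have q: "225 / 256 * \<eta>^2 \<le> (\<eta>^2 - sq y)^2 / \<eta>^2"
        by (rule square_gap[OF \<eta>(3) sS])
      have "sq y \<le> \<eta>^2" using sS sq_ge_2[of y] by linarith
      have "1 / 2 * (225 / 256 * \<eta>^2) \<le> ?d / 4 * ((\<eta>^2 - sq y)^2 / \<eta>^2)"
        using d2 q by (intro mult_mono) auto
      also have "\<dots> \<le> profile ?n \<eta> (sq y) - profile ?n \<eta> (\<eta>^2)"
        by (rule profile_below) (use \<eta> \<open>sq y \<le> \<eta>^2\<close> in auto)
      finally have "3 / 4 * (1 / 2 * (225 / 256 * \<eta>^2)) \<le> w2 y"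
        unfolding w2_profile using \<alpha> by (intro mult_mono) auto
      thus ?thesis using outer[OF y(1)] sS sq_ge_2[of y] by linarith
    qed
    have "0 \<le> w1 x - sq x"
    proof (rule min_principle[OF fin, where v = "\<lambda>x. w1 x - sq x"])
      fix x assume x: "x \<in> ?\<Omega>"
      have sqL: "sq x < L" using sq_less_of_sqrt[of x \<rho>] x L \<rho>0 by (simp add: r_def)
      have "0 \<le> point_mass (\<kappa> * \<rho> ^ ?n) x" using \<kappa> \<rho>0 by (simp add: point_mass_def)
      thus "lap (\<lambda>x. w1 x - sq x) x \<le> 0"
        using lap_w1[OF sqL] unfolding lap_diff lap_sq by linarith
    next
      fix x i assume x: "x \<in> ?\<Omega>" "x + axis i 1 \<notin> ?\<Omega>"
      show "0 \<le> w1 (x + axis i 1) - sq (x + axis i 1)"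
        using x nb(1)[of x i] \<rho> by (intro bd) auto
    next
      fix x i assume x: "x \<in> ?\<Omega>" "x - axis i 1 \<notin> ?\<Omega>"
      show "0 \<le> w1 (x - axis i 1) - sq (x - axis i 1)"
        using x nb(2)[of x i] \<rho> by (intro bd) auto
    qed (use that in simp)
    thus ?thesis using sq_ge_2[of x] by linarith
  qed
  have w_nonneg: "0 \<le> w x" for x
    using w1_nonneg[of x] w2_nonneg[of x] \<rho>0 by (auto simp: w_def)
  \<comment> \<open>The ranges here and in \<open>dom2\<close> exceed the regions where w equals the
    respective piece, so that they contain the neighbours as well; \<rho> \<ge> 64 leaves room for
    the unit step.\<close>
  have dom1: "w y \<le> w1 y" if "r y \<le> \<rho> / 4" for y
    using that outer[of y] \<eta> \<rho>0 by (auto simp: w_def)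
  have dom2: "w y \<le> w2 y" if "r y \<ge> \<rho> / 32" for y
    using that inner[of y] w2_nonneg[of y] by (auto simp: w_def)
  have bd: "w y \<le> 3 * ?d / 8 * ((max 0 (\<eta>^2 - sq y))^2 / \<eta>^2)" if y: "\<eta> - 1 \<le> r y" for y
  proof (cases "r y \<ge> \<eta>")
    case True
    thus ?thesis by (simp add: w_def)
  next
    case False
    hence s1: "sq y \<le> \<eta>^2" by (intro sq_le_of_sqrt) (simp add: r_def)
    have s2: "(\<eta> - 1)^2 \<le> sq y" using y \<eta> by (intro sq_ge_of_sqrt) (auto simp: r_def)
    have "r y \<ge> \<rho> / 32" using y \<eta> \<rho> by linarith
    hence "w y \<le> w2 y" by (rule dom2)
    also have "\<dots> \<le> 1 * (profile ?n \<eta> (sq y) - profile ?n \<eta> (\<eta>^2))"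
      unfolding w2_profile using \<alpha> \<eta> by (intro mult_right_mono profile_nonneg) auto
    also have "\<dots> \<le> 3 * ?d / 8 * ((\<eta>^2 - sq y)^2 / \<eta>^2)"
      using profile_near[OF \<eta>(4) s2 s1] by simp
    finally show ?thesis using s1 by simp
  qed
  \<comment> \<open>Just outside the ball only the neighbours of \<open>x\<close> towards the origin carry mass, at most about
    \<open>d x\<^sub>i^2 / \<eta>^2\<close> each.  Their mean is close to \<open>1/2\<close>, which leaves room for \<open>w = 0\<close> at \<open>x\<close>.\<close>
  have shell: "lap w x \<le> 1" if x: "r x \<ge> \<eta>" for x
  proof (cases "r x \<ge> \<eta> + 1")
    case True
    have "w (x + axis i 1) = 0" "w (x - axis i 1) = 0" "w x = 0" for i
      using nb[of x i] True by (auto simp: w_def)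
    thus ?thesis by (simp add: lap_def)
  next
    case False
    define c where "c = 3 * ?d / 8"
    \<comment> \<open>As \<open>sq x\<close> \<ge> \<eta>^2, the two depths below \<eta>^2 are at
      most -2 x_i and 2 x_i. Only one is positive, so the squared positive parts add up to at most 4
      x_i^2, which sums to a multiple of |x|^2.\<close>
    have pair: "w (x + axis i 1) + w (x - axis i 1) \<le> c * (4 * (real_of_int (x $ i))^2 / \<eta>^2)" for i
    proof -
      let ?a = "real_of_int (x $ i)"
      have S: "\<eta>^2 \<le> sq x" using x \<eta> by (intro sq_ge_of_sqrt) (auto simp: r_def)
      have "(max 0 (\<eta>^2 - sq (x + axis i 1)))^2 \<le> (max 0 (- 2 * ?a))^2"
        using S by (intro power_mono max.mono) (auto simp: sq_plus)
      moreover have "(max 0 (\<eta>^2 - sq (x - axis i 1)))^2 \<le> (max 0 (2 * ?a))^2"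
        using S by (intro power_mono max.mono) (auto simp: sq_minus)
      moreover have "(max 0 (- 2 * ?a))^2 + (max 0 (2 * ?a))^2 = 4 * ?a^2"
        by (cases "?a \<ge> 0") (auto simp: max_def power_mult_distrib)
      ultimately have "(max 0 (\<eta>^2 - sq (x + axis i 1)))^2 + (max 0 (\<eta>^2 - sq (x - axis i 1)))^2 \<le> 4 * ?a^2"
        by linarith
      hence "c * (((max 0 (\<eta>^2 - sq (x + axis i 1)))^2 + (max 0 (\<eta>^2 - sq (x - axis i 1)))^2) / \<eta>^2) \<le> c * (4 * ?a^2 / \<eta>^2)"
        by (intro mult_left_mono divide_right_mono) (auto simp: c_def)
      moreover have "w (x + axis i 1) \<le> c * ((max 0 (\<eta>^2 - sq (x + axis i 1)))^2 / \<eta>^2)"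
        unfolding c_def by (rule bd) (use nb[of x i] x in linarith)
      moreover have "w (x - axis i 1) \<le> c * ((max 0 (\<eta>^2 - sq (x - axis i 1)))^2 / \<eta>^2)"
        unfolding c_def by (rule bd) (use nb[of x i] x in linarith)
      ultimately show ?thesis by (simp add: add_divide_distrib distrib_left)
    qed
    have "(\<Sum>i\<in>UNIV. w (x + axis i 1) + w (x - axis i 1)) \<le> (\<Sum>i\<in>UNIV. c * (4 * (real_of_int (x $ i))^2 / \<eta>^2))"
      by (intro sum_mono pair)
    also have "\<dots> = c * (4 * (sq x - 2) / \<eta>^2)"
      by (simp add: sq_def flip: sum_distrib_left sum_divide_distrib)
    also have "\<dots> \<le> c * (4 * (\<eta> + 1)^2 / \<eta>^2)"
    proof (intro mult_left_mono divide_right_mono)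
      have "sq x \<le> (\<eta> + 1)^2" using False by (intro sq_le_of_sqrt) (simp add: r_def)
      thus "sq x - 2 \<le> (\<eta> + 1)^2" by linarith
    qed (auto simp: c_def)
    also have "\<dots> \<le> 2 * ?d"
    proof -
      have "64 * \<eta> \<le> \<eta> * \<eta>" using \<eta>(3,5) by (intro mult_right_mono) auto
      hence "6 * \<eta> + 3 \<le> \<eta> * \<eta>" using \<eta>(5) by linarith
      hence "3 * (\<eta> + 1)^2 \<le> 4 * \<eta>^2" by (simp add: power2_eq_square algebra_simps)
      hence "3 * ((\<eta> + 1)^2 / \<eta>^2) \<le> 4" using \<eta> by (simp add: divide_le_eq)
      hence "?d / 2 * (3 * ((\<eta> + 1)^2 / \<eta>^2)) \<le> ?d / 2 * 4" by (intro mult_left_mono) auto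
      thus ?thesis by (simp add: c_def)
    qed
    finally have "lap w x \<le> 2 * ?d / (2 * ?d) - w x"
      unfolding lap_eq_mean by (intro diff_right_mono divide_right_mono) auto
    moreover have "w x = 0" using x by (simp add: w_def)
    ultimately show ?thesis by simp
  qed
  have super: "point_mass (\<kappa> * \<rho> ^ ?n) x + lap w x \<le> 1" for x
  proof -
    have L\<rho>: "sq x < L" if "r x \<le> \<rho> / 8"
      using sq_less_of_sqrt[OF that[unfolded r_def] \<rho>0] L by linarith
    have pm0: "point_mass (\<kappa> * \<rho> ^ ?n) x = 0" if "r x \<ge> \<rho> / 16"
      using that r0 by (auto simp: point_mass_def)
    consider "r x \<ge> \<eta>" | "w x = w1 x" "r x \<le> \<rho> / 8" | "w x = w2 x" "r x \<ge> \<rho> / 16"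
      by (cases "r x \<ge> \<eta>"; cases "r x < \<rho> / 16"; cases "r x \<le> \<rho> / 8"; cases "w1 x \<le> w2 x")
         (use \<rho>0 in \<open>auto simp: w_def\<close>)
    thus ?thesis
    proof cases
      case 1
      have "r x \<ge> \<rho> / 16" using 1 \<eta> \<rho>0 by linarith
      thus ?thesis using shell[OF 1] pm0 by simp
    next
      case 2
      have "lap w x \<le> lap w1 x"
      proof (rule lap_mono)
        fix i
        show "w (x + axis i 1) \<le> w1 (x + axis i 1)" by (rule dom1) (use 2 nb[of x i] \<rho> in linarith)
        show "w (x - axis i 1) \<le> w1 (x - axis i 1)" by (rule dom1) (use 2 nb[of x i] \<rho> in linarith)
      qed (rule 2)
      thus ?thesis using lap_w1[OF L\<rho>[OF 2(2)]] by linarith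
    next
      case 3
      have "lap w x \<le> lap w2 x"
      proof (rule lap_mono)
        fix i
        show "w (x + axis i 1) \<le> w2 (x + axis i 1)" by (rule dom2) (use 3 nb[of x i] \<rho> in linarith)
        show "w (x - axis i 1) \<le> w2 (x - axis i 1)" by (rule dom2) (use 3 nb[of x i] \<rho> in linarith)
      qed (rule 3)
      thus ?thesis using lap_w2[OF 3(2)] pm0[OF 3(2)] by linarith
    qed
  qed
  show ?thesis
    using w_nonneg super by (intro exI[of _ w]) (auto simp: w_def r_def \<eta>_def)
qed

text \<open>Mirror image of \<open>upper_barrier\<close>: \<alpha> exceeds 1, \<eta> = \<rho> - 4A
  lies inside, and the pieces are joined by a maximum. In place of a truncation, the subsolution is
  pushed below 0 on a boundary layer and compared with u by the minimum principle.\<close>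

lemma lower_barrier:
  fixes E u :: "'d::finite site \<Rightarrow> real"
  assumes d2: "CARD('d) \<ge> 2"
    and C: "\<And>x :: 'd site. \<bar>lap Pot x\<bar> \<le> C * sq x powr (- (real CARD('d) / 2) - 1)" "C > 0"
    and lapE: "\<And>x. sq x < L \<Longrightarrow> \<bar>lap (\<lambda>x. Pot x + E x) x + (if x = 0 then \<kappa> else 0)\<bar> \<le> K / \<rho> ^ (CARD('d) + 1)"
    and E: "\<And>x. sqrt (sq x) \<ge> 1 / 32 * \<rho> \<Longrightarrow> \<bar>E x\<bar> \<le> K * (\<rho>^2 / \<rho> ^ (CARD('d) + 1))"
    and \<kappa>: "\<kappa> \<ge> 0" and K: "K > 0" and L: "L \<ge> \<rho>^2"
    and A: "A \<ge> 2 * K" "A \<ge> 2 ^ CARD('d) * C * 16 ^ (CARD('d) + 2)"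
    and \<rho>: "\<rho> \<ge> 64" "\<rho> \<ge> 8 * A"
    and u: "\<And>x. 0 \<le> u x" "\<And>x. point_mass (\<kappa> * \<rho> ^ CARD('d)) x + lap u x \<le> 1"
    and x: "sqrt (sq x) < \<rho> - 4 * A - 3"
  shows "0 < u x"
proof -
  let ?n = "CARD('d)"
  let ?d = "real ?n"
  let ?a = "pot (?d / 2) ((\<rho> / 16)^2)" and ?b = "pot (?d / 2) ((\<rho> / 8)^2)"
  define r where "r x = sqrt (sq x)" for x :: "'d site"
  define \<alpha> where "\<alpha> = 1 + A / \<rho>"
  define \<eta> where "\<eta> = \<rho> - 4 * A"
  define l where "l = \<eta> ^ ?n"
  define \<beta> where "\<beta> = \<rho> ^ ?n - \<alpha> * l"
  \<comment> \<open>On the layer between \<eta> and \<eta> + 1 one has \<open>sq\<close> - \<eta>^2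
    \<le> 3\<eta>, so the profile exceeds its minimum by at most 9d/4; subtracting this makes
    \<open>w2\<close> nonpositive there. The price is that positivity starts only below \<eta> - 3,
    where \<eta>^2 - \<open>sq\<close> exceeds 3\<eta>.\<close>
  define c2 where "c2 = - \<alpha> * (profile ?n \<eta> (\<eta>^2) + 9 * ?d / 4)"
  define c1 where "c1 = c2 - \<beta> * ?a + K * \<rho>"
  define w1 where "w1 x = \<alpha> * sq x + \<rho> ^ ?n * (Pot x + E x) + c1" for x
  define w2 where "w2 x = \<alpha> * sq x + (\<alpha> * l) * Pot x + c2" for x :: "'d site"
  define w where "w x = (if r x < \<rho> / 16 then w1 x
    else if r x \<le> \<rho> / 8 then max (w1 x) (w2 x) else w2 x)" for x
  have A0: "A > 0" using A(1) K by linarith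
  have \<rho>0: "\<rho> > 0" using \<rho> by linarith
  have A\<rho>: "A / \<rho> \<le> 1 / 4" "0 < A / \<rho>" using \<rho> A0 \<rho>0 by (auto simp: divide_le_eq)
  have \<alpha>: "1 \<le> \<alpha>" "\<alpha> \<le> 2" using A\<rho> unfolding \<alpha>_def by linarith+
  have \<eta>: "\<eta> < \<rho>" "\<eta> \<ge> \<rho> / 2" "\<eta> > 0" "\<eta> \<ge> 32" using \<rho> A0 unfolding \<eta>_def by linarith+
  have \<beta>: "2 * A * (\<rho> ^ ?n / \<rho>) \<le> \<beta>"
    unfolding \<beta>_def \<alpha>_def l_def \<eta>_def using \<rho>0 A0 \<rho>(2) d2 by (intro barrier_mass_loss) auto
  have "0 \<le> 2 * A * (\<rho> ^ ?n / \<rho>)" using A0 \<rho>0 by simp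
  hence \<beta>0: "\<beta> \<ge> 0" using \<beta> by linarith
  have l0: "0 \<le> \<alpha> * l" "\<alpha> * l \<le> 2 ^ ?n * \<rho> ^ ?n"
  proof -
    have "\<alpha> * l \<le> 1 * \<rho> ^ ?n" using \<beta>0 by (simp add: \<beta>_def)
    also have "\<dots> \<le> 2 ^ ?n * \<rho> ^ ?n" using \<rho>0 by (intro mult_right_mono) auto
    finally show "\<alpha> * l \<le> 2 ^ ?n * \<rho> ^ ?n" .
    show "0 \<le> \<alpha> * l" using \<alpha> \<eta> by (simp add: l_def)
  qed
  have w2_profile: "w2 x = \<alpha> * (profile ?n \<eta> (sq x) - profile ?n \<eta> (\<eta>^2) - 9 * ?d / 4)" for x
    by (simp add: w2_def c2_def profile_def Pot_def l_def algebra_simps)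
  have E\<rho>: "\<bar>\<rho> ^ ?n * E x\<bar> \<le> K * \<rho>" if "r x \<ge> \<rho> / 32" for x
    by (rule scaled_error_bound[OF E \<rho>0]) (use that in \<open>simp add: r_def\<close>)
  have diff: "w1 x - w2 x = \<rho> ^ ?n * E x + \<beta> * Pot x - \<beta> * ?a + K * \<rho>" for x
    by (simp add: w1_def w2_def c1_def \<beta>_def algebra_simps)
  have inner: "w2 x \<le> w1 x" if "\<rho> / 32 \<le> r x" "r x \<le> \<rho> / 16" for x
  proof -
    have "sq x \<le> (\<rho> / 16)^2" using that by (intro sq_le_of_sqrt) (simp add: r_def)
    hence "?a \<le> Pot x" unfolding Pot_def by (intro pot_antimono) auto
    hence "\<beta> * ?a \<le> \<beta> * Pot x" using \<beta>0 by (intro mult_left_mono)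
    thus ?thesis using diff[of x] E\<rho>[OF that(1)] by linarith
  qed
  have outer: "w1 x \<le> w2 x" if "\<rho> / 8 \<le> r x" for x
  proof -
    have "(\<rho> / 8)^2 \<le> sq x" using that \<rho>0 by (intro sq_ge_of_sqrt) (auto simp: r_def)
    hence "Pot x \<le> ?b" unfolding Pot_def using \<rho>0 by (intro pot_antimono) auto
    hence "\<beta> * Pot x \<le> \<beta> * ?b" using \<beta>0 by (intro mult_left_mono)
    moreover have "3 / 2 * A * \<rho> \<le> \<beta> * (?a - ?b)"
      by (rule pot_gap) (use \<rho>0 d2 A0 \<beta> in auto)
    hence "3 / 2 * A * \<rho> \<le> \<beta> * ?a - \<beta> * ?b" by (simp only: right_diff_distrib)
    moreover have "2 * (K * \<rho>) \<le> 3 / 2 * A * \<rho>"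
      using mult_right_mono[OF A(1), of \<rho>] A0 \<rho>0 K by (simp add: algebra_simps)
    ultimately show ?thesis using diff[of x] E\<rho>[of x] that \<rho>0 by linarith
  qed
  have lap_w1: "1 \<le> point_mass (\<kappa> * \<rho> ^ ?n) x + lap w1 x" if "sq x < L" for x
  proof -
    let ?X = "lap (\<lambda>x. Pot x + E x) x + (if x = 0 then \<kappa> else 0)"
    have "\<rho> ^ ?n * - ?X \<le> \<rho> ^ ?n * (K / \<rho> ^ (?n + 1))"
      using lapE[OF that] \<rho>0 by (intro mult_left_mono) auto
    also have "\<dots> = K / \<rho>" using \<rho>0 by simp
    also have "\<dots> \<le> A / \<rho>" using A(1) K \<rho>0 by (intro divide_right_mono) auto
    finally have "\<rho> ^ ?n * - ?X \<le> A / \<rho>" .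
    hence "- (\<rho> ^ ?n * ?X) \<le> A / \<rho>" by (simp only: mult_minus_right)
    moreover have "point_mass (\<kappa> * \<rho> ^ ?n) x + lap w1 x = \<alpha> + \<rho> ^ ?n * ?X"
      unfolding w1_def[abs_def] lap_affine by (simp add: point_mass_def algebra_simps)
    ultimately show ?thesis using \<alpha>_def by linarith
  qed
  have lap_w2: "1 \<le> lap w2 x" if "r x \<ge> \<rho> / 16" for x
  proof -
    have "(\<alpha> * l) * \<bar>lap Pot x\<bar> \<le> A / \<rho>"
      using that \<rho> l0 A(2) by (intro lap_Pot_outer[OF C]) (auto simp: r_def)
    moreover have "(\<alpha> * l) * - lap Pot x \<le> (\<alpha> * l) * \<bar>lap Pot x\<bar>" using l0 by (intro mult_left_mono) auto
    hence "- ((\<alpha> * l) * lap Pot x) \<le> (\<alpha> * l) * \<bar>lap Pot x\<bar>" by (simp only: mult_minus_right)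
    moreover have "lap w2 x = \<alpha> + (\<alpha> * l) * lap Pot x"
      unfolding w2_def[abs_def] lap_affine by simp
    ultimately show ?thesis using \<alpha>_def by linarith
  qed
  have nb: "r (x + axis i 1) \<le> r x + 1" "r (x - axis i 1) \<le> r x + 1" "r x - 1 \<le> r (x + axis i 1)" "r x - 1 \<le> r (x - axis i 1)" for x i
    unfolding r_def by (rule sqrt_sq_neighbour)+
  have pm: "0 \<le> point_mass (\<kappa> * \<rho> ^ ?n) x" for x using \<kappa> \<rho>0 by (simp add: point_mass_def)
  have dom1: "w1 y \<le> w y" if "r y \<le> \<rho> / 4" for y
    using that outer[of y] \<rho>0 by (auto simp: w_def)
  have dom2: "w2 y \<le> w y" if "r y \<ge> \<rho> / 32" for y
    using that inner[of y] by (auto simp: w_def)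
  have sub: "1 \<le> point_mass (\<kappa> * \<rho> ^ ?n) x + lap w x" for x
  proof -
    have L\<rho>: "sq x < L" if "r x \<le> \<rho> / 8"
      using sq_less_of_sqrt[OF that[unfolded r_def] \<rho>0] L by linarith
    consider "w x = w1 x" "r x \<le> \<rho> / 8" | "w x = w2 x" "r x \<ge> \<rho> / 16"
      by (cases "r x < \<rho> / 16"; cases "r x \<le> \<rho> / 8"; cases "w1 x \<le> w2 x")
         (use \<rho>0 in \<open>auto simp: w_def\<close>)
    thus ?thesis
    proof cases
      case 1
      have "lap w1 x \<le> lap w x"
      proof (rule lap_mono)
        fix i
        show "w1 (x + axis i 1) \<le> w (x + axis i 1)" by (rule dom1) (use 1 nb[of x i] \<rho> in linarith)
        show "w1 (x - axis i 1) \<le> w (x - axis i 1)" by (rule dom1) (use 1 nb[of x i] \<rho> in linarith)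
      qed (use 1 in simp)
      thus ?thesis using lap_w1[OF L\<rho>[OF 1(2)]] by linarith
    next
      case 2
      have "lap w2 x \<le> lap w x"
      proof (rule lap_mono)
        fix i
        show "w2 (x + axis i 1) \<le> w (x + axis i 1)" by (rule dom2) (use 2 nb[of x i] \<rho> in linarith)
        show "w2 (x - axis i 1) \<le> w (x - axis i 1)" by (rule dom2) (use 2 nb[of x i] \<rho> in linarith)
      qed (use 2 in simp)
      thus ?thesis using lap_w2[OF 2(2)] pm[of x] by linarith
    qed
  qed
  have boundary: "0 \<le> u y - w y" if y: "\<eta> \<le> r y" "r y \<le> \<eta> + 1" for y
  proof -
    have S: "\<eta>^2 \<le> sq y" using y \<eta> by (intro sq_ge_of_sqrt) (auto simp: r_def)
    have "sq y \<le> (\<eta> + 1)^2" using y by (intro sq_le_of_sqrt) (simp add: r_def)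
    hence "sq y - \<eta>^2 \<le> 3 * \<eta>" using \<eta> by (simp add: power2_sum)
    hence "(sq y - \<eta>^2)^2 \<le> (3 * \<eta>)^2" using S by (intro power_mono) auto
    hence "(sq y - \<eta>^2)^2 / \<eta>^2 \<le> 9" using \<eta> by (simp add: power_mult_distrib divide_le_eq)
    hence "?d / 4 * ((sq y - \<eta>^2)^2 / \<eta>^2) \<le> ?d / 4 * 9" by (intro mult_left_mono) auto
    hence "profile ?n \<eta> (sq y) - profile ?n \<eta> (\<eta>^2) - 9 * ?d / 4 \<le> 0"
      using profile_above(2)[OF \<eta>(3) S, of ?n] by linarith
    hence "w2 y \<le> 0" unfolding w2_profile using \<alpha> by (intro mult_nonneg_nonpos) auto
    moreover have "w y = w2 y" using y \<eta> \<rho> by (auto simp: w_def)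
    ultimately show ?thesis using u(1)[of y] by linarith
  qed
  have comparison: "w y \<le> u y" if "r y < \<eta>" for y
  proof -
    let ?\<Omega> = "{x :: 'd site. r x < \<eta>}"
    have "0 \<le> u y - w y"
    proof (rule min_principle[where v = "\<lambda>x. u x - w x" and \<Omega> = ?\<Omega>])
      show "finite ?\<Omega>" unfolding r_def by (rule finite_sqrt_sq_less)
      show "lap (\<lambda>x. u x - w x) x \<le> 0" for x
        unfolding lap_diff using u(2)[of x] sub[of x] by linarith
      show "0 \<le> u (x + axis i 1) - w (x + axis i 1)" if "x \<in> ?\<Omega>" "x + axis i 1 \<notin> ?\<Omega>" for x i
        using that nb(1)[of x i] by (intro boundary) auto
      show "0 \<le> u (x - axis i 1) - w (x - axis i 1)" if "x \<in> ?\<Omega>" "x - axis i 1 \<notin> ?\<Omega>" for x i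
        using that nb(2)[of x i] by (intro boundary) auto
    qed (use that in simp)
    thus ?thesis by simp
  qed
  have lower: "?d / 4 * ((\<eta>^2 - sq y)^2 / \<eta>^2 - 9) \<le> u y" if y: "\<rho> / 16 \<le> r y" "r y < \<eta> - 3" for y
  proof -
    have s: "sq y \<le> (\<eta> - 3)^2" using y by (intro sq_le_of_sqrt) (simp add: r_def)
    also have "\<dots> \<le> \<eta>^2" using \<eta> by (intro power_mono) auto
    finally have s1: "sq y \<le> \<eta>^2" .
    have "3 * \<eta> \<le> \<eta>^2 - sq y" using s \<eta> by (simp add: power2_diff)
    hence "(3 * \<eta>)^2 \<le> (\<eta>^2 - sq y)^2" using \<eta> by (intro power_mono) auto
    hence 9: "0 \<le> (\<eta>^2 - sq y)^2 / \<eta>^2 - 9" using \<eta> by (simp add: power_mult_distrib le_divide_eq)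
    have "?d / 4 * ((\<eta>^2 - sq y)^2 / \<eta>^2 - 9) = ?d / 4 * ((\<eta>^2 - sq y)^2 / \<eta>^2) - 9 * ?d / 4"
      by (simp only: right_diff_distrib)
    also have "\<dots> \<le> profile ?n \<eta> (sq y) - profile ?n \<eta> (\<eta>^2) - 9 * ?d / 4"
      using profile_below[OF \<eta>(3) sq_pos s1, of ?n] by linarith
    finally have 1: "?d / 4 * ((\<eta>^2 - sq y)^2 / \<eta>^2 - 9) \<le> profile ?n \<eta> (sq y) - profile ?n \<eta> (\<eta>^2) - 9 * ?d / 4" .
    moreover have "0 \<le> ?d / 4 * ((\<eta>^2 - sq y)^2 / \<eta>^2 - 9)" using 9 by simp
    ultimately have "1 * (?d / 4 * ((\<eta>^2 - sq y)^2 / \<eta>^2 - 9)) \<le> w2 y"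
      unfolding w2_profile using \<alpha> by (intro mult_mono) auto
    also have "w2 y \<le> w y" using y \<rho>0 by (intro dom2) simp
    also have "w y \<le> u y" using y by (intro comparison) simp
    finally show ?thesis by simp
  qed
  show "0 < u x"
  proof (cases "r x < \<rho> / 16")
    case False
    have x3: "r x < \<eta> - 3" using x by (simp add: r_def \<eta>_def)
    have r1: "r x > 1"
      using real_sqrt_less_mono[of 1 "sq x"] sq_ge_2[of x] by (simp add: r_def)
    have "3 * \<eta> < \<eta>^2 - sq x"
    proof -
      have "sq x = (r x)^2" using sq_ge_2[of x] by (simp add: r_def)
      moreover have "(r x)^2 < (\<eta> - 3)^2 " using x3 r1 by (intro power_strict_mono) auto
      moreover have "(\<eta> - 3)^2 = \<eta>^2 - 6 * \<eta> + 9" by (simp add: power2_diff)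
      ultimately show ?thesis using \<eta> by linarith
    qed
    hence "(3 * \<eta>)^2 < (\<eta>^2 - sq x)^2" using \<eta> by (intro power_strict_mono) auto
    hence "0 < (\<eta>^2 - sq x)^2 / \<eta>^2 - 9" using \<eta> by (simp add: power_mult_distrib less_divide_eq)
    hence "0 < ?d / 4 * ((\<eta>^2 - sq x)^2 / \<eta>^2 - 9)" by simp
    thus ?thesis using lower[of x] False x3 by simp
  next
    case True
    \<comment> \<open>The sign of \<open>w1\<close> near the origin is unknown. Instead
      \<open>u - sq\<close> is superharmonic and, by \<open>lower\<close>, nonnegative on the layer
      outside this ball, so that u \<ge> \<open>sq\<close> > 0 inside.\<close>
    let ?\<Omega> = "{x :: 'd site. r x < \<rho> / 16}"
    have bd: "0 \<le> u y - sq y" if y: "\<rho> / 16 \<le> r y" "r y \<le> \<rho> / 8" for y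
    proof -
      have "sq y \<le> (\<rho> / 8)^2" using y by (intro sq_le_of_sqrt) (simp add: r_def)
      also have "16 * (\<rho> / 8)^2 = (\<rho> / 2)^2" by (simp add: power_divide)
      hence "(\<rho> / 8)^2 = (\<rho> / 2)^2 / 16" by simp
      also have "(\<rho> / 2)^2 / 16 \<le> \<eta>^2 / 16" using \<eta> \<rho>0 by (intro divide_right_mono power_mono) auto
      finally have sS: "16 * sq y \<le> \<eta>^2" by simp
      have q: "225 / 256 * \<eta>^2 \<le> (\<eta>^2 - sq y)^2 / \<eta>^2"
        by (rule square_gap[OF \<eta>(3) sS])
      have "32^2 \<le> \<eta>^2" using \<eta> by (intro power_mono) auto
      hence \<eta>2: "1024 \<le> \<eta>^2" by simp
      have "1 / 2 * (225 / 256 * \<eta>^2 - 9) \<le> ?d / 4 * ((\<eta>^2 - sq y)^2 / \<eta>^2 - 9)"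
        using d2 q \<eta>2 by (intro mult_mono) auto
      also have "\<dots> \<le> u y" by (rule lower) (use y \<eta> \<rho> in linarith)+
      finally have u9: "1 / 2 * (225 / 256 * \<eta>^2 - 9) \<le> u y" .
      have "0 \<le> a - b" if "1 / 2 * (225 / 256 * t - 9) \<le> a" "16 * b \<le> t" "1024 \<le> t" for a b t :: real
        using that by (simp add: field_simps)
      from this[OF u9 sS \<eta>2] show ?thesis .
    qed
    have "0 \<le> u x - sq x"
    proof (rule min_principle[where v = "\<lambda>x. u x - sq x" and \<Omega> = ?\<Omega>])
      show "finite ?\<Omega>" unfolding r_def by (rule finite_sqrt_sq_less)
      show "lap (\<lambda>x. u x - sq x) x \<le> 0" for x
        unfolding lap_diff lap_sq using u(2)[of x] pm[of x] by linarith
      show "0 \<le> u (x + axis i 1) - sq (x + axis i 1)" if "x \<in> ?\<Omega>" "x + axis i 1 \<notin> ?\<Omega>" for x i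
        using that nb(1)[of x i] \<rho> by (intro bd) auto
      show "0 \<le> u (x - axis i 1) - sq (x - axis i 1)" if "x \<in> ?\<Omega>" "x - axis i 1 \<notin> ?\<Omega>" for x i
        using that nb(2)[of x i] \<rho> by (intro bd) auto
    qed (use True in simp)
    thus ?thesis using sq_ge_2[of x] by linarith
  qed
qed

section \<open>Comparison of the occupied set with balls\<close>

lemma powr_inverse_power:
  assumes "x \<ge> 0" "n > 0" shows "(x powr (1 / real n)) ^ n = x"
proof (cases "x = 0")
  case False
  hence "(x powr (1 / real n)) ^ n = (x powr (1 / real n)) powr real n"
    using assms by (intro powr_realpow[symmetric]) auto
  also have "\<dots> = x" using assms by (simp add: powr_powr)
  finally show ?thesis .
qed (use assms in auto)

definition barrier_above :: "real \<Rightarrow> real \<Rightarrow> 'd::finite config \<Rightarrow> bool" where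
  "barrier_above m a w \<longleftrightarrow> (\<forall>x. 0 \<le> w x) \<and> (\<forall>x. point_mass m x + lap w x \<le> 1) \<and>
    (\<forall>x. sqrt (sq x) \<ge> a \<longrightarrow> w x = 0)"

definition forces_positive :: "real \<Rightarrow> real \<Rightarrow> 'd::finite itself \<Rightarrow> bool" where
  "forces_positive m b _ \<longleftrightarrow> (\<forall>u :: 'd config. (\<forall>x. 0 \<le> u x) \<longrightarrow> (\<forall>x. point_mass m x + lap u x \<le> 1) \<longrightarrow>
    (\<forall>x. sqrt (sq x) < b \<longrightarrow> 0 < u x))"

text \<open>All constants precede the mass: A comes from the errors of the two Laplacians, and
  \<open>m0\<close> makes every m \<ge> \<open>m0\<close> give a \<rho> as large as both barriers
  demand, whatever the capacity is between \<open>kmin\<close> and \<open>kmax\<close>.\<close>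

lemma barriers:
  assumes d2: "CARD('d::finite) \<ge> 2"
  obtains R m0 where "R \<ge> 3" "m0 > 0"
    "\<And>m. m \<ge> m0 \<Longrightarrow> \<exists>\<rho>>0. (\<exists>w :: 'd config. barrier_above m (\<rho> + R) w) \<and> forces_positive m (\<rho> - R) TYPE('d)"
proof -
  let ?n = "CARD('d)"
  obtain C where C: "C > 0" "\<And>x :: 'd site. \<bar>lap Pot x\<bar> \<le> C * sq x powr (- (real ?n / 2) - 1)"
    by (rule lap_Pot_bound[where 'd='d]) blast
  obtain K \<rho>0 where K: "K > 0" "\<rho>0 \<ge> 1" and green: "\<And>\<rho> L. \<rho> \<ge> \<rho>0 \<Longrightarrow> L > 2 \<Longrightarrow> \<exists>E :: 'd site \<Rightarrow> real.
      (\<forall>x. sq x < L \<longrightarrow> \<bar>lap (\<lambda>x. Pot x + E x) x + (if x = 0 then capacity L TYPE('d) else 0)\<bar> \<le> K / \<rho> ^ (?n + 1)) \<and>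
      (\<forall>x. sqrt (sq x) \<ge> 1 / 32 * \<rho> \<longrightarrow> \<bar>E x\<bar> \<le> K * (\<rho>^2 / \<rho> ^ (?n + 1)))"
    by (rule approximate_green[of "1 / 32", where 'd='d]) (simp, blast)
  obtain kmax where kmax: "kmax > 0" "\<And>L. capacity L TYPE('d) \<le> kmax"
    by (rule capacity_upper[where 'd='d]) blast
  define kmin where "kmin = omega TYPE('d) / 4 ^ ?n"
  have kmin: "kmin > 0" using omega_pos[where 'd='d] by (simp add: kmin_def)
  define A where "A = 2 * K + 2 ^ ?n * C * 16 ^ (?n + 2)"
  have CA: "0 < 2 ^ ?n * C * 16 ^ (?n + 2)" using C(1) by simp
  have A: "A \<ge> 2 * K" "A \<ge> 2 ^ ?n * C * 16 ^ (?n + 2)" "A > 0" using CA K(1) unfolding A_def by linarith+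
  define \<rho>1 where "\<rho>1 = \<rho>0 + 64 + 8 * A + 3 * (real ?n + 2)"
  have \<rho>1: "\<rho>1 > 0" using K A by (simp add: \<rho>1_def)
  define m0 where "m0 = kmax * \<rho>1 ^ ?n"
  have m0: "m0 > 0" using kmax \<rho>1 by (simp add: m0_def)
  have n0: "?n > 0" using d2 by linarith
  have "\<exists>\<rho>>0. (\<exists>w :: 'd config. barrier_above m (\<rho> + (4 * A + 3)) w) \<and> forces_positive m (\<rho> - (4 * A + 3)) TYPE('d)"
    if m: "m \<ge> m0" for m
  proof -
    have m_pos: "m > 0" using m m0 by linarith
    \<comment> \<open>The capacity depends on L and \<rho> on the capacity, while the barriers
      demand L \<ge> \<rho>^2. Bounding \<rho> in advance through \<open>kmin\<close> breaks the
      circle; the second summand is the threshold of \<open>capacity_lower\<close>.\<close>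
    define L where "L = ((m / kmin) powr (1 / real ?n))^2 + (4 * (real ?n + 1))^2"
    have "4^2 \<le> (4 * (real ?n + 1))^2" by (intro power_mono) auto
    moreover have "(4::real)^2 = 16" by simp
    moreover have "0 \<le> ((m / kmin) powr (1 / real ?n))^2" by simp
    ultimately have L2: "L > 2" unfolding L_def by linarith
    define \<kappa> where "\<kappa> = capacity L TYPE('d)"
    have "kmin \<le> \<kappa>" unfolding kmin_def \<kappa>_def by (rule capacity_lower) (simp add: L_def)
    hence \<kappa>: "\<kappa> > 0" "kmin \<le> \<kappa>" "\<kappa> \<le> kmax" using kmin kmax(2)[of L] by (auto simp: \<kappa>_def)
    define \<rho> where "\<rho> = (m / \<kappa>) powr (1 / real ?n)"
    have \<rho>n: "\<rho> ^ ?n = m / \<kappa>" unfolding \<rho>_def using m_pos \<kappa> n0 by (intro powr_inverse_power) auto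
    have \<rho>_nonneg: "\<rho> \<ge> 0" by (simp add: \<rho>_def)
    have meq: "m = \<kappa> * \<rho> ^ ?n" using \<rho>n \<kappa> by simp
    have "\<rho> \<le> (m / kmin) powr (1 / real ?n)"
      unfolding \<rho>_def using m_pos \<kappa> kmin by (intro powr_mono2 divide_left_mono) auto
    hence "\<rho>^2 \<le> ((m / kmin) powr (1 / real ?n))^2" using \<rho>_nonneg by (intro power_mono)
    hence L\<rho>: "L \<ge> \<rho>^2" unfolding L_def using zero_le_power2[of "4 * (real ?n + 1)"] by linarith
    have "\<rho>1 ^ ?n = m0 / kmax" using kmax by (simp add: m0_def)
    also have "\<dots> \<le> m / \<kappa>" using m m0 \<kappa> kmax m_pos by (intro frac_le) auto
    finally have "\<rho>1 ^ ?n \<le> \<rho> ^ ?n" using \<rho>n by simp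
    hence "\<rho>1 \<le> \<rho>" using \<rho>1 \<rho>_nonneg n0 by (simp add: power_mono_iff)
    hence \<rho>: "\<rho> \<ge> \<rho>0" "\<rho> \<ge> 64" "\<rho> \<ge> 8 * A" "\<rho> \<ge> 4 * A" "\<rho> \<ge> 3 * (real ?n + 2)" "\<rho> > 0"
      using K A n0 unfolding \<rho>1_def by (smt (verit) of_nat_0_le_iff)+
    obtain E :: "'d site \<Rightarrow> real" where
      E1: "\<And>x. sq x < L \<Longrightarrow> \<bar>lap (\<lambda>x. Pot x + E x) x + (if x = 0 then \<kappa> else 0)\<bar> \<le> K / \<rho> ^ (?n + 1)" and
      E2: "\<And>x. sqrt (sq x) \<ge> 1 / 32 * \<rho> \<Longrightarrow> \<bar>E x\<bar> \<le> K * (\<rho>^2 / \<rho> ^ (?n + 1))"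
      using green[OF \<rho>(1) L2] unfolding \<kappa>_def by blast
    have \<kappa>0: "\<kappa> \<ge> 0" using \<kappa> by simp
    obtain w :: "'d site \<Rightarrow> real" where w: "\<And>x. 0 \<le> w x" "\<And>x. point_mass (\<kappa> * \<rho> ^ ?n) x + lap w x \<le> 1"
      "\<And>x. sqrt (sq x) \<ge> \<rho> + 4 * A \<Longrightarrow> w x = 0"
      using upper_barrier[OF d2 C(2,1) E1 E2 \<kappa>0 K(1) L\<rho> A(1,2) \<rho>(2,4,5)] by blast
    have low: "0 < u x" if "\<And>x. 0 \<le> u x" "\<And>x. point_mass (\<kappa> * \<rho> ^ ?n) x + lap u x \<le> 1" "sqrt (sq x) < \<rho> - 4 * A - 3"
      for u :: "'d site \<Rightarrow> real" and x
      by (rule lower_barrier[OF d2 C(2,1) E1 E2 \<kappa>0 K(1) L\<rho> A(1,2) \<rho>(2,3) that])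
    show ?thesis
    proof (intro exI[of _ \<rho>] conjI exI[of _ w])
      show "0 < \<rho>" by (rule \<rho>(6))
      show "barrier_above m (\<rho> + (4 * A + 3)) w"
        unfolding barrier_above_def meq using w by simp
      show "forces_positive m (\<rho> - (4 * A + 3)) TYPE('d)"
        unfolding forces_positive_def meq
      proof (intro allI impI)
        fix u :: "'d site \<Rightarrow> real" and x :: "'d site"
        assume *: "\<forall>x. 0 \<le> u x" "\<forall>x. point_mass (\<kappa> * \<rho> ^ ?n) x + lap u x \<le> 1" "sqrt (sq x) < \<rho> - (4 * A + 3)"
        show "0 < u x"
        proof (rule low)
          show "0 \<le> u x" for x using *(1) by (rule spec)
          show "point_mass (\<kappa> * \<rho> ^ ?n) x + lap u x \<le> 1" for x using *(2) by (rule spec)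
          show "sqrt (sq x) < \<rho> - 4 * A - 3" using *(3) by linarith
        qed
      qed
    qed
  qed
  thus ?thesis using that[of "4 * A + 3" m0] A m0 by simp
qed

lemma enorm_nonneg: "0 \<le> enorm x"
  by (simp add: enorm_def sum_nonneg)

lemma enorm_le_sqrt_sq: "enorm x \<le> sqrt (sq x)"
  by (intro real_le_rsqrt) (simp add: sq_enorm)

lemma sqrt_sq_le_enorm: "sqrt (sq x) \<le> enorm x + 2"
  using enorm_nonneg[of x] by (intro real_le_lsqrt) (auto simp: sq_enorm power2_sum)

text \<open>At distance a + 1 or more, u vanishes at the site and at all its neighbours, so no mass
  arrives and \<nu> is 0 there; a \<ge> 2 keeps the origin, which starts with mass, out of this
  region.\<close>

lemma occupied_subset:
  fixes \<nu> u w :: "'d::finite config"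
  assumes a: "a \<ge> 2" and u0: "\<And>x. 0 \<le> u x" and uw: "\<And>x. u x \<le> w x" and w: "\<And>x. sqrt (sq x) \<ge> a \<Longrightarrow> w x = 0"
    and nu: "\<And>x. point_mass m x + lap u x = \<nu> x"
  shows "occupied \<nu> \<subseteq> {x. sqrt (sq x) < a + 1}"
proof
  fix x assume x: "x \<in> occupied \<nu>"
  have 0: "u y = 0" if "sqrt (sq y) \<ge> a" for y
    using u0[of y] uw[of y] w[OF that] by simp
  show "x \<in> {x. sqrt (sq x) < a + 1}"
  proof (rule ccontr)
    assume "x \<notin> {x. sqrt (sq x) < a + 1}"
    hence ge: "sqrt (sq x) \<ge> a + 1" by simp
    have "u x = 0" "u (x + axis i 1) = 0" "u (x - axis i 1) = 0" for i
      using ge sqrt_sq_neighbour(3,4)[of x i] by (auto intro!: 0)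
    hence "lap u x = 0" by (simp add: lap_def)
    moreover have "x \<noteq> 0"
    proof
      assume "x = 0"
      moreover have "sqrt 2 \<le> (2::real)" by (rule real_le_lsqrt) auto
      ultimately show False using ge a by (simp add: sq_0)
    qed
    ultimately have "\<nu> x = 0" using nu[of x] by (simp add: point_mass_def)
    thus False using x by (simp add: occupied_def)
  qed
qed

theorem mainTheorem4:
  assumes "CARD('d::finite) \<ge> 2"
  shows "\<exists>c c' :: real. \<forall>m :: real. \<forall>\<mu> xs (\<nu> :: 'd config).
     m \<ge> 0 \<longrightarrow> toppling_seq m \<mu> xs \<longrightarrow> (\<forall>y. (\<lambda>k. \<mu> k y) \<longlonglongrightarrow> \<nu> y) \<longrightarrow>
     (let r = (m / omega TYPE('d)) powr (1 / real CARD('d))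
      in lball (r - c) \<subseteq> occupied \<nu> \<and> occupied \<nu> \<subseteq> lball (r + c'))"
proof -
  let ?n = "CARD('d)"
  let ?\<omega> = "omega TYPE('d)"
  have n0: "?n > 0" using assms by linarith
  obtain R m0 where R: "R \<ge> 3" and m0: "m0 > 0" and
    barrier: "\<And>m. m \<ge> m0 \<Longrightarrow> \<exists>\<rho>>0. (\<exists>w :: 'd config. barrier_above m (\<rho> + R) w) \<and> forces_positive m (\<rho> - R) TYPE('d)"
    by (rule barriers[OF assms]) blast
  obtain \<rho>0 and w0 :: "'d site \<Rightarrow> real" where \<rho>0: "\<rho>0 > 0" and "barrier_above m0 (\<rho>0 + R) w0"
    using barrier[OF order_refl] by blast
  hence w0: "\<And>x. 0 \<le> w0 x" "\<And>x. point_mass m0 x + lap w0 x \<le> 1"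
    "\<And>x. sqrt (sq x) \<ge> \<rho>0 + R \<Longrightarrow> w0 x = 0"
    by (simp_all add: barrier_above_def)
  define rad where "rad m = (m / ?\<omega>) powr (1 / real ?n)" for m
  have rad_nonneg: "rad m \<ge> 0" for m by (simp add: rad_def)
  \<comment> \<open>The terms \<open>rad m0\<close> here and \<open>\<rho>0\<close> in
    \<open>c'\<close> dispose of the masses below \<open>m0\<close>: the inner ball is then empty,
    and the occupied set is confined by the fixed barrier for \<open>m0\<close>.\<close>
  define c where "c = 2 * R + real ?n + 4 + rad m0"
  define c' where "c' = 2 * R + real ?n + 3 + \<rho>0"
  have "lball (rad m - c) \<subseteq> occupied \<nu> \<and> occupied \<nu> \<subseteq> lball (rad m + c')"
    if m: "m \<ge> 0" and seq: "toppling_seq m \<mu> xs" and lim: "\<And>y. (\<lambda>k. \<mu> k y) \<longlonglongrightarrow> \<nu> y"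
    for m \<mu> xs and \<nu> :: "'d config"
  proof (cases "m \<ge> m0")
    case False
    \<comment> \<open>A supersolution for \<open>m0\<close> is one for every smaller mass.\<close>
    have super: "point_mass m x + lap w0 x \<le> 1" for x
    proof -
      have "point_mass m x \<le> point_mass m0 x" using False by (simp add: point_mass_def)
      thus ?thesis using w0(2)[of x] by linarith
    qed
    obtain u where u: "\<And>x. 0 \<le> u x" "\<And>x. u x \<le> w0 x" "\<And>x. point_mass m x + lap u x = \<nu> x" "\<And>x. 0 < u x \<Longrightarrow> \<nu> x = 1"
      by (rule limit_odometer[OF seq m lim w0(1) super]) blast
    have "occupied \<nu> \<subseteq> {x. sqrt (sq x) < \<rho>0 + R + 1}"
      by (rule occupied_subset[OF _ u(1,2) w0(3) u(3)]) (use R \<rho>0 in linarith)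
    moreover have "x \<in> lball (rad m + c')" if "sqrt (sq x) < \<rho>0 + R + 1" for x :: "'d site"
      using that enorm_le_sqrt_sq[of x] rad_nonneg[of m] R unfolding lball_def c'_def by simp
    moreover have "rad m \<le> rad m0"
      unfolding rad_def using m False omega_pos[where 'd='d] by (intro powr_mono2 divide_right_mono) auto
    hence "x \<notin> lball (rad m - c)" for x :: "'d site"
      using enorm_nonneg[of x] R unfolding lball_def c_def by simp
    ultimately show ?thesis by blast
  next
    case True
    obtain \<rho> and w :: "'d site \<Rightarrow> real" where \<rho>: "\<rho> > 0" and "barrier_above m (\<rho> + R) w"
      and pos: "forces_positive m (\<rho> - R) TYPE('d)"
      using barrier[OF True] by blast
    hence w: "\<And>x. 0 \<le> w x" "\<And>x. point_mass m x + lap w x \<le> 1" "\<And>x. sqrt (sq x) \<ge> \<rho> + R \<Longrightarrow> w x = 0"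
      by (simp_all add: barrier_above_def)
    obtain u where u: "\<And>x. 0 \<le> u x" "\<And>x. u x \<le> w x" "\<And>x. point_mass m x + lap u x = \<nu> x" "\<And>x. 0 < u x \<Longrightarrow> \<nu> x = 1"
      by (rule limit_odometer[OF seq m lim w(1,2)]) blast
    have \<nu>1: "\<nu> x \<le> 1" for x by (rule limit_le_1[OF seq lim])
    have \<nu>0: "0 \<le> \<nu> x" for x
      by (rule LIMSEQ_le_const[OF lim]) (use config_nonneg[OF seq m] in auto)
    have core: "\<nu> x = 1" if "sqrt (sq x) < \<rho> - R" for x
    proof (rule u(4))
      show "0 < u x"
        using pos that u(1) \<nu>1 unfolding forces_positive_def by (simp add: u(3))
    qed
    \<comment> \<open>One layer more than the support of w, so that u vanishes at both ends of every
      edge leaving F.\<close>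
    define F where "F = {x :: 'd site. sqrt (sq x) < \<rho> + R + 1}"
    have finF: "finite F" unfolding F_def by (rule finite_sqrt_sq_less)
    have u_out: "u x = 0" if "sqrt (sq x) \<ge> \<rho> + R" for x
      using u(1,2)[of x] w(3)[OF that] by simp
    have mass: "(\<Sum>x\<in>F. \<nu> x) = m"
    proof (rule sandpile_mass[OF finF _ u(3)])
      have "sqrt 2 \<le> (2::real)" by (rule real_le_lsqrt) auto
      thus "0 \<in> F" using R \<rho> by (simp add: F_def sq_0)
      show "u x = 0 \<and> u (x + axis i 1) = 0" if "x \<in> F" "x + axis i 1 \<notin> F" for x i
        using that sqrt_sq_neighbour(1)[of x i] by (auto simp: F_def intro!: u_out)
      show "u x = 0 \<and> u (x - axis i 1) = 0" if "x \<in> F" "x - axis i 1 \<notin> F" for x i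
        using that sqrt_sq_neighbour(2)[of x i] by (auto simp: F_def intro!: u_out)
    qed
    have rad_n: "rad m ^ ?n = m / ?\<omega>"
      unfolding rad_def using m omega_pos[where 'd='d] n0 by (intro powr_inverse_power) auto
    \<comment> \<open>The two volume comparisons tie \<rho> to \<open>rad m\<close>: all mass lies
      in F with at most 1 per site, and each site of the smaller set G below carries exactly
      1.\<close>
    have "m \<le> real (card F)"
      using sum_mono[of F \<nu> "\<lambda>_. 1"] \<nu>1 mass by simp
    also have "\<dots> \<le> ?\<omega> * (\<rho> + R + 1 + real ?n + 1) ^ ?n"
    proof (rule card_le_volume[OF finF])
      show "enorm x \<le> \<rho> + R + 1" if "x \<in> F" for x
        using that enorm_le_sqrt_sq[of x] by (simp add: F_def)
    qed (use \<rho> R in simp)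
    finally have "rad m ^ ?n \<le> (\<rho> + R + 1 + real ?n + 1) ^ ?n"
      unfolding rad_n using omega_pos[where 'd='d] by (simp add: divide_le_eq mult.commute)
    hence up: "rad m \<le> \<rho> + R + 1 + real ?n + 1"
      using rad_nonneg[of m] \<rho> R n0 by (subst (asm) power_mono_iff) auto
    have down: "\<rho> \<le> rad m + R + 2 + real ?n"
    \<comment> \<open>If the radius is too small for the volume bound, the claim is immediate from
      \<open>rad m\<close> \<ge> 0.\<close>
    proof (cases "\<rho> - R - 2 \<ge> real ?n")
      case False
      thus ?thesis using rad_nonneg[of m] by linarith
    next
      case True
      define G where "G = {x :: 'd site. sqrt (sq x) < \<rho> - R}"
      have finG: "finite G" unfolding G_def by (rule finite_sqrt_sq_less)
      have "?\<omega> * (\<rho> - R - 2 - real ?n) ^ ?n \<le> real (card G)"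
      proof (rule card_ge_volume[OF finG _ True])
        show "x \<in> G" if "enorm x < \<rho> - R - 2" for x
          using that sqrt_sq_le_enorm[of x] by (simp add: G_def)
      qed
      also have "\<dots> = (\<Sum>x\<in>G. \<nu> x)" using core by (simp add: G_def)
      also have "\<dots> \<le> (\<Sum>x\<in>F. \<nu> x)"
        using finF \<nu>0 R by (intro sum_mono2) (auto simp: F_def G_def)
      also have "\<dots> = m" by (rule mass)
      finally have "(\<rho> - R - 2 - real ?n) ^ ?n \<le> rad m ^ ?n"
        unfolding rad_n using omega_pos[where 'd='d] by (simp add: le_divide_eq mult.commute)
      hence "\<rho> - R - 2 - real ?n \<le> rad m"
        using rad_nonneg[of m] True n0 by (subst (asm) power_mono_iff) auto
      thus ?thesis by linarith
    qed
    have "occupied \<nu> \<subseteq> {x. sqrt (sq x) < \<rho> + R + 1}"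
      by (rule occupied_subset[OF _ u(1,2) w(3) u(3)]) (use R \<rho> in linarith)
    moreover have "x \<in> lball (rad m + c')" if "sqrt (sq x) < \<rho> + R + 1" for x :: "'d site"
      using that enorm_le_sqrt_sq[of x] down \<rho>0 unfolding lball_def c'_def by simp
    moreover have "x \<in> occupied \<nu>" if "x \<in> lball (rad m - c)" for x
    proof -
      have "sqrt (sq x) < \<rho> - R"
        using that sqrt_sq_le_enorm[of x] up rad_nonneg[of m0] unfolding lball_def c_def by simp
      thus ?thesis using core by (simp add: occupied_def)
    qed
    ultimately show ?thesis by blast
  qed
  thus ?thesis unfolding Let_def rad_def by blast
qed

end
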